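(* Assume $\mu(\mathbb R^n)=\infty$. Let $|\alpha|<\frac{\varepsilon}{4}$ and $1\le p,q\le\infty$. Suppose that $\{S_k\}_{k\in\mathbb Z}$ and $\{P_k\}_{k\in\mathbb Z}$ are approximations to the identity associated with $\mathcal F$. Set $D_k=S_k-S_{k-1}$ and $E_k=P_k-P_{k-1}$. Then for $f\in L^2_\mu$, $$\bigg\{\sum_{k\in\mathbb Z}\Big(2^{k\alpha}\|D_k(f)\|_{L^p_\mu}\Big)^q\bigg\}^{1/q}\approx\bigg\{\sum_{k\in\mathbb Z}\Big(2^{k\alpha}\|E_k(f)\|_{L^p_\mu}\Big)^q\bigg\}^{1/q},$$ i.e. each side is at most a constant, independent of $f$, times the other (with suprema over $k$ in place of the sums when $q=\infty$).
   Context: Setting. Let $\phi:\mathbb R^n\to\mathbb R$ be strictly convex and smooth, let $\mu=\det D^2\phi$ be its Monge-Ampère measure ($d\mu=\det D^2\phi\,dx$), let $\rho(x,y)=\phi(y)-\phi(x)-\nabla\phi(x)\cdot(y-x)$ and $S_\phi(x,t)=\{y:\rho(x,y)<t\}$. Assume $\mu$ is doubling: there are $C>0$ and $0<\lambda<1$ with $\mu(S_\phi(x,t))\le C\mu(\lambda S_\phi(x,t))$ for all $x\in\mathbb R^n$, $t>0$, where $\lambda S_\phi(x,t)$ is the $\lambda$-dilation of $S_\phi(x,t)$ about its center of mass. Then $\frac12(\rho(x,y)+\rho(y,x))$ is a quasi-metric, and (Macías–Segovia) it is geometrically equivalent to a quasi-metric with a regularity property. Fix such a quasi-metric $\bar\rho$: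 it is symmetric, nonnegative, vanishes exactly on the diagonal, is bounded above and below by constant multiples of $\frac12(\rho(x,y)+\rho(y,x))$, satisfies $\bar\rho(x,y)\le A_0[\bar\rho(x,z)+\bar\rho(z,y)]$ with $A_0\ge1$, and for some $\varepsilon\in(0,1)$ and $C_0$, $|\bar\rho(x,y)-\bar\rho(x',y)|\le C_0\,\bar\rho(x,x')^{\varepsilon}[\bar\rho(x,y)+\bar\rho(x',y)]^{1-\varepsilon}$ for all $x,x',y$. Put $S(x,t)=\{y:\bar\rho(x,y)<t\}$ and $\mathcal F=\{S(x,t):x\in\mathbb R^n,\ t>0\}$; $\mu$ satisfies $\mu(S(x,2t))\le C_\mu\mu(S(x,t))<\infty$. Write $V_k(x)=\mu(S(x,2^{-k}))$ and $L^p_\mu=L^p(\mathbb R^n,d\mu)$. Approximation to the identity associated with $\mathcal F$: a sequence of integral operators $\{S_k\}_{k\in\mathbb Z}$, $S_kf(x)=\int S_k(x,y)f(y)d\mu(y)$, for which there is $C>0$ such that for all $k\in\mathbb Z$ and $x,x',y,y'\in\mathbb R^n$: (i) $S_k(x,y)=0$ if $\bar\rho(x,y)>C2^{-k}$; (ii) $|S_k(x,y)|\le \frac{C}{V_k(x)+V_k(y)}$; (iii) $|S_k(x,y)-S_k(x',y)|\le C\frac{(2^k\bar\rho(x,x'))^\varepsilon}{V_k(x)+V_k(y)}$ for $\bar\rho(x,x')\le C2^{-k}$; (iv) $|S_k(x,y)-S_k(x,y')|\le C\frac{(2^k\bar\rho(y,y'))^\varepsilon}{V_k(x)+V_k(y)}$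 for $\bar\rho(y,y')\le C2^{-k}$; (v) $|[S_k(x,y)-S_k(x',y)]-[S_k(x,y')-S_k(x',y')]|\le C\frac{(2^k\bar\rho(x,x'))^\varepsilon(2^k\bar\rho(y,y'))^\varepsilon}{V_k(x)+V_k(y)}$ for $\bar\rho(x,x')\le C2^{-k}$ and $\bar\rho(y,y')\le C2^{-k}$; (vi) $\int S_k(x,y)d\mu(x)=1$ for all $y$; (vii) $\int S_k(x,y)d\mu(y)=1$ for all $x$. *)

theory Defs
  imports "HOL-Analysis.Analysis" "HOL-Probability.Essential_Supremum"
begin

subsection \<open>The Monge-Ampere measure and the sections of a convex function\<close>

definition partial :: "'n \<Rightarrow> (real^'n \<Rightarrow> real) \<Rightarrow> real^'n \<Rightarrow> real" where
  "partial i f x = frechet_derivative f (at x) (axis i 1)"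

definition gradient :: "(real^'n \<Rightarrow> real) \<Rightarrow> real^'n \<Rightarrow> real^'n" where
  "gradient f x = (\<chi> i. partial i f x)"

definition hessian :: "(real^'n \<Rightarrow> real) \<Rightarrow> real^'n \<Rightarrow> real^'n^'n" where
  "hessian f x = (\<chi> i j. partial i (partial j f) x)"

primrec times_continuously_differentiable :: "nat \<Rightarrow> (real^'n \<Rightarrow> real) \<Rightarrow> bool" where
  "times_continuously_differentiable 0 f \<longleftrightarrow> continuous_on UNIV f"
| "times_continuously_differentiable (Suc k) f \<longleftrightarrow>
     (\<forall>x. f differentiable (at x)) \<and> (\<forall>i. times_continuously_differentiable k (partial i f))"

definition smooth :: "(real^'n \<Rightarrow> real) \<Rightarrow> bool" where
  "smooth f \<longleftrightarrow> (\<forall>k. times_continuously_differentiable k f)"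

definition strictly_convex :: "('a::real_vector \<Rightarrow> real) \<Rightarrow> bool" where
  "strictly_convex f \<longleftrightarrow>
     (\<forall>x y t. x \<noteq> y \<and> 0 < t \<and> t < 1 \<longrightarrow>
        f ((1 - t) *\<^sub>R x + t *\<^sub>R y) < (1 - t) * f x + t * f y)"

text \<open>For convex \<open>\<phi>\<close> the determinant is nonnegative, so the truncation at \<open>0\<close> in \<open>ennreal\<close> is harmless.\<close>

definition monge_ampere :: "(real^'n \<Rightarrow> real) \<Rightarrow> (real^'n) measure" where
  "monge_ampere \<phi> = density lborel (\<lambda>x. ennreal (det (hessian \<phi> x)))"

definition rho :: "(real^'n \<Rightarrow> real) \<Rightarrow> real^'n \<Rightarrow> real^'n \<Rightarrow> real" where
  "rho \<phi> x y = \<phi> y - \<phi> x - gradient \<phi> x \<bullet> (y - x)"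

definition convex_section :: "(real^'n \<Rightarrow> real) \<Rightarrow> real^'n \<Rightarrow> real \<Rightarrow> (real^'n) set" where
  "convex_section \<phi> x t = {y. rho \<phi> x y < t}"

definition center_of_mass :: "'a::euclidean_space set \<Rightarrow> 'a" where
  "center_of_mass A = (LINT y:A|lborel. y) /\<^sub>R measure lborel A"

definition dilate :: "real \<Rightarrow> 'a::euclidean_space set \<Rightarrow> 'a set" where
  "dilate r A = (\<lambda>y. center_of_mass A + r *\<^sub>R (y - center_of_mass A)) ` A"

definition doubling_on_sections :: "(real^'n \<Rightarrow> real) \<Rightarrow> bool" where
  "doubling_on_sections \<phi> \<longleftrightarrow>
     (\<exists>C>0. \<exists>r. 0 < r \<and> r < 1 \<and>
        (\<forall>x. \<forall>t>0. emeasure (monge_ampere \<phi>) (convex_section \<phi> x t)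
              \<le> ennreal C * emeasure (monge_ampere \<phi>) (dilate r (convex_section \<phi> x t))))"


subsection \<open>Approximations to the identity\<close>

definition qball :: "('a \<Rightarrow> 'a \<Rightarrow> real) \<Rightarrow> 'a \<Rightarrow> real \<Rightarrow> 'a set" where
  "qball d x t = {y. d x y < t}"

definition vol :: "'a measure \<Rightarrow> ('a \<Rightarrow> 'a \<Rightarrow> real) \<Rightarrow> int \<Rightarrow> 'a \<Rightarrow> real" where
  "vol M d k x = measure M (qball d x (2 powi (-k)))"

definition approx_identity ::
  "'a measure \<Rightarrow> ('a \<Rightarrow> 'a \<Rightarrow> real) \<Rightarrow> real \<Rightarrow> (int \<Rightarrow> 'a \<Rightarrow> 'a \<Rightarrow> complex) \<Rightarrow> bool" where
  "approx_identity M d \<epsilon> S \<longleftrightarrow> (\<exists>C>0.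
     (\<forall>k x y. d x y > C * 2 powi (-k) \<longrightarrow> S k x y = 0) \<and>
     (\<forall>k x y. norm (S k x y) \<le> C / (vol M d k x + vol M d k y)) \<and>
     (\<forall>k x x' y. d x x' \<le> C * 2 powi (-k) \<longrightarrow>
        norm (S k x y - S k x' y)
          \<le> C * (2 powi k * d x x') powr \<epsilon> / (vol M d k x + vol M d k y)) \<and>
     (\<forall>k x y y'. d y y' \<le> C * 2 powi (-k) \<longrightarrow>
        norm (S k x y - S k x y')
          \<le> C * (2 powi k * d y y') powr \<epsilon> / (vol M d k x + vol M d k y)) \<and>
     (\<forall>k x x' y y'. d x x' \<le> C * 2 powi (-k) \<and> d y y' \<le> C * 2 powi (-k) \<longrightarrow>
        norm ((S k x y - S k x' y) - (S k x y' - S k x' y'))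
          \<le> C * (2 powi k * d x x') powr \<epsilon> * (2 powi k * d y y') powr \<epsilon>
              / (vol M d k x + vol M d k y)) \<and>
     (\<forall>k y. (LINT x|M. S k x y) = 1) \<and>
     (\<forall>k x. (LINT y|M. S k x y) = 1))"

definition int_op :: "'a measure \<Rightarrow> ('a \<Rightarrow> 'a \<Rightarrow> complex) \<Rightarrow> ('a \<Rightarrow> complex) \<Rightarrow> 'a \<Rightarrow> complex" where
  "int_op M K f x = (LINT y|M. K x y * f y)"

definition diff_op ::
  "'a measure \<Rightarrow> (int \<Rightarrow> 'a \<Rightarrow> 'a \<Rightarrow> complex) \<Rightarrow> int \<Rightarrow> ('a \<Rightarrow> complex) \<Rightarrow> 'a \<Rightarrow> complex" where
  "diff_op M S k f x = int_op M (S k) f x - int_op M (S (k - 1)) f x"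


subsection \<open>Extended-valued norms\<close>

text \<open>Powers with exponent \<open>r > 0\<close>, with \<open>\<infinity>\<close> raised to \<open>r\<close> being \<open>\<infinity>\<close>.\<close>

definition epowr :: "ennreal \<Rightarrow> real \<Rightarrow> ennreal" where
  "epowr x r = (if x = \<infinity> then \<infinity> else ennreal (enn2real x powr r))"

definition Lp_norm :: "ennreal \<Rightarrow> 'a measure \<Rightarrow> ('a \<Rightarrow> complex) \<Rightarrow> ennreal" where
  "Lp_norm p M f =
     (if p = \<infinity> then esssup M (\<lambda>x. ennreal (norm (f x)))
      else epowr (\<integral>\<^sup>+x. ennreal (norm (f x) powr enn2real p) \<partial>M) (1 / enn2real p))"

definition Lp_functions :: "ennreal \<Rightarrow> 'a measure \<Rightarrow> ('a \<Rightarrow> complex) set" where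
  "Lp_functions p M = {f \<in> borel_measurable M. Lp_norm p M f < \<infinity>}"

definition besov_norm ::
  "real \<Rightarrow> ennreal \<Rightarrow> ennreal \<Rightarrow> 'a measure \<Rightarrow> (int \<Rightarrow> 'a \<Rightarrow> 'a \<Rightarrow> complex) \<Rightarrow> ('a \<Rightarrow> complex) \<Rightarrow> ennreal" where
  "besov_norm \<alpha> p q M S f =
     (if q = \<infinity> then (SUP k. ennreal (2 powr (of_int k * \<alpha>)) * Lp_norm p M (diff_op M S k f))
      else epowr (\<Sum>\<^sub>\<infinity>k. epowr (ennreal (2 powr (of_int k * \<alpha>)) * Lp_norm p M (diff_op M S k f)) (enn2real q))
             (1 / enn2real q))"

end

theory Submission
  imports Defs
begin

text \<open>
Write \<open>D\<^sub>k = S\<^sub>k - S\<^sub>k\<^sub>-\<^sub>1\<close> and \<open>E\<^sub>j = P\<^sub>j - P\<^sub>j\<^sub>-\<^sub>1\<close>. The heart of the matter is the estimate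
\<open>\<parallel>E\<^sub>j f\<parallel>\<^sub>p \<le> B \<Sum>\<^sub>k 2\<^bsup>-(\<epsilon>/4)|j-k|\<^esup> \<parallel>D\<^sub>k f\<parallel>\<^sub>p\<close> for \<open>f\<close> in \<open>L\<^sup>2\<close>, which is \<open>Lp_norm_le_smear\<close>. Since
\<open>|\<alpha>| < \<epsilon>/4\<close>, multiplication by \<open>2\<^bsup>j\<alpha>\<^esup>\<close> leaves a convolution with a summable sequence, which acts boundedly
on \<open>\<ell>\<^sup>q\<close>; exchanging the roles of the two families gives the reverse inequality.

Two facts about the operators are used. Kernels with integral zero composed at different scales are
small, \<open>\<parallel>E\<^sub>j D\<^sub>k\<parallel> \<le> \<kappa> 2\<^bsup>-\<epsilon>|j-k|\<^esup>\<close> on \<open>L\<^sup>p\<close> (\<open>kernel_comp_bound\<close>, \<open>Lp_norm_two_kernels\<close>): subtract from the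
coarser kernel its value at the point around which the finer one is concentrated, and use its Hoelder
continuity. And \<open>\<Sum>\<^sub>k D\<^sub>k f = f\<close> when tested against Hoelder functions of bounded support
(\<open>reproducing_limit\<close>): the sum telescopes, \<open>S\<^sub>n\<close> tends to the identity, and \<open>S\<^sub>-\<^sub>n\<close> tends to zero because
the whole space has infinite measure.

The naive expansion \<open>E\<^sub>j f = \<Sum>\<^sub>k E\<^sub>j D\<^sub>k f\<close> is of no use by itself: the decay in \<open>|j-k|\<close> is lost once the norm of
\<open>D\<^sub>k f\<close> has to be kept. So one expands twice, \<open>E\<^sub>j f = \<Sum>\<^sub>a \<Sum>\<^sub>b E\<^sub>j D\<^sub>a D\<^sub>b f\<close>, and fixes a large \<open>N\<close>. A pair with
\<open>|a-b| \<le> N\<close> is harmless, for \<open>\<parallel>E\<^sub>j D\<^sub>a D\<^sub>b f\<parallel> \<le> \<kappa> 2\<^bsup>-\<epsilon>|j-a|\<^esup> \<parallel>D\<^sub>b f\<parallel>\<close> decays in \<open>|j-b|\<close> as well. In the terms with \<open>|a-b| > N\<close>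
the function \<open>f\<close> is expanded in the same way again, and so on (\<open>chain_iterate\<close>). This produces chains
\<open>E\<^sub>j D\<^sub>a\<^sub>1 D\<^sub>a\<^sub>2 \<dots> D\<^sub>a\<^sub>n\<close>. Grouping the factors of a chain into adjacent pairs in the two possible ways and
taking the geometric mean of the resulting bounds gives a factor \<open>2\<^bsup>-(\<epsilon>/2)|a-a'|\<^esup>\<close> for every link of the
chain (\<open>chain_bound\<close>). Of each exponent \<open>\<epsilon>/2\<close>, one half is spent on summing over the intermediate
scales, where the restriction to pairs with \<open>|a-b| > N\<close> makes every round of expansion gain a factor
\<open>1/2\<close> (\<open>far_iterate_bound\<close>); the other half survives, by the triangle inequality, as the decay
\<open>2\<^bsup>-(\<epsilon>/4)|j-k|\<^esup>\<close>. The same bound with \<open>p = 2\<close> shows that the unexpanded remainder after \<open>n\<close> rounds tends to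
zero in \<open>L\<^sup>2\<close>, so that its infimum over \<open>n\<close> vanishes almost everywhere, whatever \<open>p\<close> is.

All sums of norms are taken in \<open>[0, \<infinity>]\<close> as integrals over counting measures, so no summability has to be
checked; Minkowski's inequality for such sums and Schur's test both come from one inequality between
power means, \<open>nn_integral_power_mean\<close>.
\<close>

section \<open>Lebesgue norms of functions with values in the extended half-line\<close>

lemma epowr_ennreal: "0 \<le> a \<Longrightarrow> epowr (ennreal a) r = ennreal (a powr r)"
  by (simp add: epowr_def)

lemma epowr_top [simp]: "epowr \<infinity> r = \<infinity>" "epowr top r = top"
  by (simp_all add: epowr_def)

lemma epowr_mono: "0 \<le> r \<Longrightarrow> x \<le> y \<Longrightarrow> epowr x r \<le> epowr y r"
proof (cases x; cases y)
  fix a b assume "0 \<le> r" "x \<le> y" "x = ennreal a" "0 \<le> a" "y = ennreal b" "0 \<le> b"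
  then show ?thesis by (simp add: epowr_ennreal powr_mono2 ennreal_leI)
qed (simp_all add: epowr_ennreal top_unique)

lemma epowr_epowr: "epowr (epowr x r) s = epowr x (r * s)"
  by (cases x) (simp_all add: epowr_ennreal powr_powr)

lemma epowr_1 [simp]: "epowr x 1 = x"
  by (cases x) (simp_all add: epowr_ennreal)

lemma epowr_le_iff: "0 < r \<Longrightarrow> epowr x r \<le> epowr y r \<longleftrightarrow> x \<le> y"
proof
  assume "0 < r" "epowr x r \<le> epowr y r"
  then have "epowr (epowr x r) (1 / r) \<le> epowr (epowr y r) (1 / r)"
    by (intro epowr_mono[of "1 / r" "epowr x r"]) simp_all
  moreover have "r * (1 / r) = 1" using \<open>0 < r\<close> by simp
  ultimately show "x \<le> y" by (simp only: epowr_epowr epowr_1)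
qed (simp add: epowr_mono)

lemma epowr_mult:
  assumes "0 \<le> a"
  shows "epowr (ennreal a * x) r = ennreal (a powr r) * epowr x r"
proof (cases x)
  case (real b)
  then show ?thesis
    using assms by (simp add: epowr_ennreal powr_mult ennreal_mult[symmetric])
next
  case top
  then show ?thesis
    using assms by (cases "a = 0") (simp_all add: epowr_def ennreal_mult_top)
qed

lemma epowr_2: "epowr x 2 = x\<^sup>2"
  by (cases x) (simp_all add: epowr_ennreal ennreal_power)

lemma borel_measurable_epowr [measurable]:
  assumes [measurable]: "f \<in> borel_measurable M"
  shows "(\<lambda>x. epowr (f x) r) \<in> borel_measurable M"
  unfolding epowr_def by measurable

text \<open>Jensen's inequality for the power \<open>r\<close> and a measure of total mass at most \<open>A\<close>. By Young's inequality
\<open>t\<^bsup>r-1\<^esup> z \<le> z\<^sup>r/r + (1 - 1/r) t\<^sup>r\<close>; integrating this with \<open>z = F x\<close> and optimizing over \<open>t\<close> gives the claim.\<close>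

lemma nn_integral_power_mean:
  assumes A: "0 < A" and r: "1 \<le> r"
    and [measurable]: "k \<in> borel_measurable N" "F \<in> borel_measurable N"
    and k: "(\<integral>\<^sup>+x. k x \<partial>N) \<le> ennreal A"
  shows "epowr (\<integral>\<^sup>+x. k x * F x \<partial>N) r
           \<le> ennreal (A powr (r - 1)) * (\<integral>\<^sup>+x. k x * epowr (F x) r \<partial>N)" (is "_ \<le> _ * ?B")
proof (cases "?B = \<infinity>")
  case True
  then show ?thesis using A by (simp add: ennreal_mult_top)
next
  case False
  then obtain B where B: "?B = ennreal B" "0 \<le> B"
    by (cases ?B) auto
  have bound: "epowr (\<integral>\<^sup>+x. k x * F x \<partial>N) r \<le> ennreal (b * A powr (r - 1))" if b: "B < b" for b
  proof -
    have b0: "0 < b" using b B by simp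
    \<comment> \<open>with this \<open>t\<close> both terms of the integrated inequality are at most multiples of \<open>b\<close>, and these add up to \<open>b\<close>\<close>
    define t where "t = (b / A) powr (1 / r)"
    have t: "0 < t" "t powr r = b / A"
      using A b0 r by (auto simp: t_def powr_powr)
    have young: "ennreal (t powr (r - 1)) * z \<le> ennreal (1 / r) * epowr z r + ennreal ((1 - 1 / r) * t powr r)"
      (is "_ \<le> ?R z") for z
    proof (cases z)
      case (real a)
      have "t powr (r - 1) * a \<le> 1 / r * a powr r + (1 - 1 / r) * t powr r"
      proof (cases "a = 0")
        case False
        have "(a powr r) powr (1 / r) * (t powr r) powr (1 - 1 / r)
              \<le> 1 / r * a powr r + (1 - 1 / r) * t powr r"
          using r t False real A b0 by (intro Youngs_inequality_0) auto
        moreover have "(t powr r) powr (1 - 1 / r) = t powr (r - 1)"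
        proof -
          have "r * (1 - 1 / r) = r - 1" using r by (simp add: right_diff_distrib)
          then show ?thesis by (simp add: powr_powr)
        qed
        ultimately show ?thesis
          using r real False by (simp add: powr_powr mult.commute)
      qed (use r in simp)
      then show ?thesis
        using r real by (simp add: epowr_ennreal ennreal_mult[symmetric] ennreal_plus[symmetric] ennreal_leI del: ennreal_plus)
    next
      case top
      then show ?thesis using r by (simp add: ennreal_mult_top)
    qed
    have "ennreal (t powr (r - 1)) * (\<integral>\<^sup>+x. k x * F x \<partial>N)
          = (\<integral>\<^sup>+x. k x * (ennreal (t powr (r - 1)) * F x) \<partial>N)"
      by (subst nn_integral_cmult[symmetric]) (auto simp: ac_simps)
    also have "\<dots> \<le> (\<integral>\<^sup>+x. k x * (ennreal (1 / r) * epowr (F x) r + ennreal ((1 - 1 / r) * t powr r)) \<partial>N)"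
      by (intro nn_integral_mono mult_left_mono young) auto
    also have "\<dots> = (\<integral>\<^sup>+x. ennreal (1 / r) * (k x * epowr (F x) r)
                          + ennreal ((1 - 1 / r) * t powr r) * k x \<partial>N)"
      by (intro nn_integral_cong) (simp add: distrib_left ac_simps)
    also have "\<dots> = ennreal (1 / r) * ?B + ennreal ((1 - 1 / r) * t powr r) * (\<integral>\<^sup>+x. k x \<partial>N)"
      by (simp add: nn_integral_add nn_integral_cmult)
    also have "\<dots> \<le> ennreal (1 / r) * ennreal B + ennreal ((1 - 1 / r) * t powr r) * ennreal A"
      using B k by (intro add_mono mult_left_mono) auto
    also have "\<dots> = ennreal (1 / r * B + (1 - 1 / r) * t powr r * A)"
      using r B A by (subst ennreal_plus) (auto simp: ennreal_mult[symmetric])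
    also have "\<dots> \<le> ennreal b"
    proof (rule ennreal_leI)
      have "1 / r * B + (1 - 1 / r) * t powr r * A \<le> 1 / r * b + (1 - 1 / r) * b"
        using b r A t by (intro add_mono mult_left_mono) auto
      then show "1 / r * B + (1 - 1 / r) * t powr r * A \<le> b" by (simp add: algebra_simps)
    qed
    finally have "epowr (ennreal (t powr (r - 1)) * (\<integral>\<^sup>+x. k x * F x \<partial>N)) r \<le> epowr (ennreal b) r"
      using r by (intro epowr_mono) auto
    then have "ennreal ((t powr (r - 1)) powr r) * epowr (\<integral>\<^sup>+x. k x * F x \<partial>N) r \<le> ennreal (b powr r)"
      using b0 by (simp add: epowr_mult epowr_ennreal)
    moreover have "(t powr (r - 1)) powr r = (b / A) powr (r - 1)"
      unfolding powr_powr by (subst mult.commute) (simp add: powr_powr[symmetric] t)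
    ultimately have *: "ennreal ((b / A) powr (r - 1)) * epowr (\<integral>\<^sup>+x. k x * F x \<partial>N) r \<le> ennreal (b powr r)"
      by simp
    have inv: "ennreal ((A / b) powr (r - 1)) * ennreal ((b / A) powr (r - 1)) = 1"
      using A b0 by (simp add: ennreal_mult[symmetric] powr_mult[symmetric])
    have "epowr (\<integral>\<^sup>+x. k x * F x \<partial>N) r
        = ennreal ((A / b) powr (r - 1)) * (ennreal ((b / A) powr (r - 1)) * epowr (\<integral>\<^sup>+x. k x * F x \<partial>N) r)"
      by (simp only: mult.assoc[symmetric] inv mult_1)
    also have "\<dots> \<le> ennreal ((A / b) powr (r - 1)) * ennreal (b powr r)"
      using * by (rule mult_left_mono) simp
    also have "\<dots> = ennreal ((A / b) powr (r - 1) * b powr r)"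
      by (simp add: ennreal_mult)
    also have "(A / b) powr (r - 1) * b powr r = b * A powr (r - 1)"
    proof -
      have "b powr r = b powr (r - 1) * b"
        using b0 powr_add[of b "r - 1" 1] by simp
      then show ?thesis using A b0 by (simp add: powr_divide)
    qed
    finally show ?thesis .
  qed
  have "epowr (\<integral>\<^sup>+x. k x * F x \<partial>N) r \<le> ennreal (A powr (r - 1) * B)"
  proof (rule ennreal_le_epsilon)
    fix e :: real assume e: "0 < e"
    have "epowr (\<integral>\<^sup>+x. k x * F x \<partial>N) r \<le> ennreal ((B + e / A powr (r - 1)) * A powr (r - 1))"
      using e A by (intro bound) auto
    also have "\<dots> = ennreal (A powr (r - 1) * B + e)"
      using A by (simp add: distrib_right mult.commute[of B])
    finally show "epowr (\<integral>\<^sup>+x. k x * F x \<partial>N) r \<le> ennreal (A powr (r - 1) * B) + ennreal e"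
      using e B by simp
  qed
  then show ?thesis using B by (simp add: ennreal_mult)
qed

text \<open>The norm is taken of functions with values in \<open>[0, \<infinity>]\<close>, so that infinite series of absolute values can be
inserted without a convergence hypothesis.\<close>

definition Lp_enorm :: "ennreal \<Rightarrow> 'a measure \<Rightarrow> ('a \<Rightarrow> ennreal) \<Rightarrow> ennreal" where
  "Lp_enorm p M F =
     (if p = \<infinity> then esssup M F
      else epowr (\<integral>\<^sup>+x. epowr (F x) (enn2real p) \<partial>M) (1 / enn2real p))"

lemma Lp_norm_eq: "Lp_norm p M f = Lp_enorm p M (\<lambda>x. ennreal (norm (f x)))"
  by (simp add: Lp_norm_def Lp_enorm_def epowr_ennreal)

lemma Lp_enorm_infinity: "Lp_enorm \<infinity> M F = esssup M F"
  by (simp add: Lp_enorm_def)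

lemma exponent_cases [consumes 1, case_names infinity real]:
  fixes p :: ennreal
  assumes "1 \<le> p"
  obtains "p = \<infinity>" | r where "1 \<le> r" "p = ennreal r"
  using assms by (cases p) auto

lemma Lp_enorm_ennreal:
  "1 \<le> r \<Longrightarrow> Lp_enorm (ennreal r) M F = epowr (\<integral>\<^sup>+x. epowr (F x) r \<partial>M) (1 / r)"
  by (simp add: Lp_enorm_def)

lemma Lp_enorm_le_iff:
  assumes "1 \<le> r"
  shows "Lp_enorm (ennreal r) M F \<le> b \<longleftrightarrow> (\<integral>\<^sup>+x. epowr (F x) r \<partial>M) \<le> epowr b r"
  using assms epowr_le_iff[of r "Lp_enorm (ennreal r) M F" b]
  by (simp add: Lp_enorm_ennreal epowr_epowr)

lemma Lp_enorm_mono_AE: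
  assumes "1 \<le> p" "F \<in> borel_measurable M" "AE x in M. F x \<le> G x"
  shows "Lp_enorm p M F \<le> Lp_enorm p M G"
  using assms(1)
proof (cases rule: exponent_cases)
  case (real r)
  have "(\<integral>\<^sup>+x. epowr (F x) r \<partial>M) \<le> (\<integral>\<^sup>+x. epowr (G x) r \<partial>M)"
  proof (rule nn_integral_mono_AE)
    show "AE x in M. epowr (F x) r \<le> epowr (G x) r"
      using assms(3) by eventually_elim (use real in \<open>simp add: epowr_mono\<close>)
  qed
  then show ?thesis using real by (simp add: Lp_enorm_ennreal epowr_mono)
next
  case infinity
  show ?thesis unfolding infinity Lp_enorm_infinity by (intro esssup_AE_mono assms)
qed

lemma Lp_enorm_mono:
  assumes "1 \<le> p" "F \<in> borel_measurable M" "\<And>x. F x \<le> G x"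
  shows "Lp_enorm p M F \<le> Lp_enorm p M G"
  using assms by (intro Lp_enorm_mono_AE) auto

lemma Lp_enorm_cmult:
  assumes p: "1 \<le> p" and [measurable]: "F \<in> borel_measurable M" and c: "0 \<le> c"
  shows "Lp_enorm p M (\<lambda>x. ennreal c * F x) \<le> ennreal c * Lp_enorm p M F"
  using p
proof (cases rule: exponent_cases)
  case infinity
  have "AE x in M. ennreal c * F x \<le> ennreal c * esssup M F"
    using esssup_AE[of F M] by eventually_elim (simp add: mult_left_mono)
  then show ?thesis
    unfolding infinity Lp_enorm_infinity by (intro esssup_I) auto
next
  case (real r)
  have "(\<integral>\<^sup>+x. epowr (ennreal c * F x) r \<partial>M) = ennreal (c powr r) * (\<integral>\<^sup>+x. epowr (F x) r \<partial>M)"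
    using c by (simp add: epowr_mult nn_integral_cmult)
  then show ?thesis
    using c real by (simp add: Lp_enorm_le_iff epowr_mult) (simp add: Lp_enorm_ennreal epowr_epowr)
qed

text \<open>Schur's test: in each row the kernel is a measure of mass at most \<open>A\<close>, so the power mean inequality moves
the exponent inside, and the column sums bound what remains after exchanging the integrals.\<close>

lemma Lp_enorm_Schur:
  assumes p: "1 \<le> p" and M: "sigma_finite_measure M" and A: "0 < A"
    and K [measurable]: "case_prod K \<in> borel_measurable (M \<Otimes>\<^sub>M M)"
    and F [measurable]: "F \<in> borel_measurable M"
    and rows: "\<And>x. x \<in> space M \<Longrightarrow> (\<integral>\<^sup>+y. K x y \<partial>M) \<le> ennreal A"
    and columns: "\<And>y. y \<in> space M \<Longrightarrow> (\<integral>\<^sup>+x. K x y \<partial>M) \<le> ennreal A"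
  shows "Lp_enorm p M (\<lambda>x. \<integral>\<^sup>+y. K x y * F y \<partial>M) \<le> ennreal A * Lp_enorm p M F"
proof -
  interpret sigma_finite_measure M by fact
  interpret pair_sigma_finite M M ..
  show ?thesis
    using p
  proof (cases rule: exponent_cases)
    case infinity
    have "(\<integral>\<^sup>+y. K x y * F y \<partial>M) \<le> ennreal A * esssup M F" if x: "x \<in> space M" for x
    proof -
      have [measurable]: "K x \<in> borel_measurable M"
        using measurable_Pair2[OF K x] by simp
      have "(\<integral>\<^sup>+y. K x y * F y \<partial>M) \<le> (\<integral>\<^sup>+y. K x y * esssup M F \<partial>M)"
        using esssup_AE[of F M] by (intro nn_integral_mono_AE) (auto elim!: eventually_mono intro: mult_left_mono)
      also have "\<dots> \<le> ennreal A * esssup M F"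
        by (simp add: nn_integral_multc mult_right_mono rows x)
      finally show ?thesis .
    qed
    then show ?thesis
      unfolding infinity Lp_enorm_infinity by (intro esssup_I) auto
  next
    case (real r)
    have "(\<integral>\<^sup>+x. epowr (\<integral>\<^sup>+y. K x y * F y \<partial>M) r \<partial>M)
          \<le> (\<integral>\<^sup>+x. ennreal (A powr (r - 1)) * (\<integral>\<^sup>+y. K x y * epowr (F y) r \<partial>M) \<partial>M)"
    proof (rule nn_integral_mono)
      fix x assume x: "x \<in> space M"
      have [measurable]: "K x \<in> borel_measurable M"
        using measurable_Pair2[OF K x] by simp
      show "epowr (\<integral>\<^sup>+y. K x y * F y \<partial>M) r \<le> ennreal (A powr (r - 1)) * (\<integral>\<^sup>+y. K x y * epowr (F y) r \<partial>M)"
        using A real rows[OF x] by (intro nn_integral_power_mean) auto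
    qed
    also have "\<dots> = ennreal (A powr (r - 1)) * (\<integral>\<^sup>+x. \<integral>\<^sup>+y. K x y * epowr (F y) r \<partial>M \<partial>M)"
      by (simp add: nn_integral_cmult)
    also have "(\<integral>\<^sup>+x. \<integral>\<^sup>+y. K x y * epowr (F y) r \<partial>M \<partial>M) = (\<integral>\<^sup>+y. \<integral>\<^sup>+x. K x y * epowr (F y) r \<partial>M \<partial>M)"
      by (rule Fubini'[symmetric]) simp
    also have "\<dots> \<le> (\<integral>\<^sup>+y. ennreal A * epowr (F y) r \<partial>M)"
      using columns by (intro nn_integral_mono) (simp add: nn_integral_multc mult_right_mono)
    also have "\<dots> = ennreal A * (\<integral>\<^sup>+y. epowr (F y) r \<partial>M)"
      by (simp add: nn_integral_cmult)
    finally have "(\<integral>\<^sup>+x. epowr (\<integral>\<^sup>+y. K x y * F y \<partial>M) r \<partial>M)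
        \<le> ennreal (A powr (r - 1)) * (ennreal A * (\<integral>\<^sup>+y. epowr (F y) r \<partial>M))"
      by (simp add: mult_left_mono)
    also have "\<dots> = ennreal (A powr r) * (\<integral>\<^sup>+y. epowr (F y) r \<partial>M)"
      using A by (simp add: mult.assoc[symmetric] ennreal_mult[symmetric] powr_diff)
    finally show ?thesis
      using A real by (simp add: Lp_enorm_le_iff epowr_mult) (simp add: Lp_enorm_ennreal epowr_epowr)
  qed
qed

lemma borel_measurable_nn_integral_count_space [measurable]:
  fixes F :: "'i::countable \<Rightarrow> 'a \<Rightarrow> ennreal"
  assumes [measurable]: "\<And>i. F i \<in> borel_measurable M"
  shows "(\<lambda>x. \<integral>\<^sup>+i. F i x \<partial>count_space UNIV) \<in> borel_measurable M"
proof -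
  interpret sigma_finite_measure "count_space (UNIV :: 'i set)"
    by (simp add: sigma_finite_measure_count_space)
  show ?thesis
  proof (rule borel_measurable_nn_integral)
    have "(\<lambda>z. F (snd z) (fst z)) \<in> borel_measurable (M \<Otimes>\<^sub>M count_space UNIV)"
      by (rule measurable_compose_countable[where f="\<lambda>i z. F i (fst z)" and g=snd]) auto
    then show "(\<lambda>(x, i). F i x) \<in> borel_measurable (M \<Otimes>\<^sub>M count_space UNIV)"
      by (simp add: case_prod_beta')
  qed
qed

text \<open>Minkowski's inequality for countable sums. With \<open>b\<^sub>i\<close> slightly larger than the norm of \<open>F\<^sub>i\<close>, write
\<open>F\<^sub>i = b\<^sub>i G\<^sub>i\<close>, where \<open>G\<^sub>i\<close> has norm at most one, and apply the power mean inequality with the weights \<open>b\<^sub>i\<close>.\<close>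

lemma Lp_enorm_nn_integral_count_space:
  fixes F :: "'i::countable \<Rightarrow> 'a \<Rightarrow> ennreal"
  assumes p: "1 \<le> p" and [measurable]: "\<And>i. F i \<in> borel_measurable M"
  shows "Lp_enorm p M (\<lambda>x. \<integral>\<^sup>+i. F i x \<partial>count_space UNIV)
           \<le> (\<integral>\<^sup>+i. Lp_enorm p M (F i) \<partial>count_space UNIV)"
  using p
proof (cases rule: exponent_cases)
  case infinity
  have "AE x in M. \<forall>i. F i x \<le> esssup M (F i)"
    unfolding AE_all_countable using esssup_AE by blast
  then have "AE x in M. (\<integral>\<^sup>+i. F i x \<partial>count_space UNIV) \<le> (\<integral>\<^sup>+i. esssup M (F i) \<partial>count_space UNIV)"
    by eventually_elim (auto intro!: nn_integral_mono)
  then show ?thesis unfolding infinity Lp_enorm_infinity by (intro esssup_I) auto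
next
  case (real r)
  define a where "a i = Lp_enorm p M (F i)" for i
  show ?thesis
  proof (cases "(\<integral>\<^sup>+i. a i \<partial>count_space UNIV) = \<infinity>")
    case False
    then obtain T where T: "(\<integral>\<^sup>+i. a i \<partial>count_space UNIV) = ennreal T" "0 \<le> T"
      by (cases "\<integral>\<^sup>+i. a i \<partial>count_space UNIV") auto
    have fin: "a i < \<infinity>" for i
    proof -
      have "a i = (\<integral>\<^sup>+j. a j * indicator {i} j \<partial>count_space UNIV)" by simp
      also have "\<dots> \<le> (\<integral>\<^sup>+j. a j \<partial>count_space UNIV)"
        by (intro nn_integral_mono) (auto simp: indicator_def)
      finally show ?thesis using T by (auto simp: less_top[symmetric] top_unique)
    qed
    have "Lp_enorm p M (\<lambda>x. \<integral>\<^sup>+i. F i x \<partial>count_space UNIV) \<le> ennreal T"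
    proof (rule ennreal_le_epsilon)
      fix e :: real assume e: "0 < e"
      \<comment> \<open>the extra summand keeps the weights positive when \<open>F i\<close> vanishes almost everywhere; it adds at most \<open>e\<close> in total\<close>
      define b where "b i = enn2real (a i) + e * (1/2) ^ Suc (to_nat i)" for i
      have b0: "0 < b i" for i using e by (simp add: b_def add_nonneg_pos)
      have "(\<integral>\<^sup>+i. ennreal (b i) \<partial>count_space UNIV)
            = (\<integral>\<^sup>+i. a i + ennreal e * ennreal ((1/2) ^ Suc (to_nat i)) \<partial>count_space UNIV)"
      proof (intro nn_integral_cong)
        fix i
        have "ennreal (b i) = ennreal (enn2real (a i)) + ennreal (e * (1/2) ^ Suc (to_nat i))"
          unfolding b_def using e by (intro ennreal_plus) auto
        also have "\<dots> = a i + ennreal e * ennreal ((1/2) ^ Suc (to_nat i))"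
          using e fin[of i] by (subst ennreal_mult) (auto simp: less_top)
        finally show "ennreal (b i) = a i + ennreal e * ennreal ((1/2) ^ Suc (to_nat i))" .
      qed
      also have "\<dots> = ennreal T + ennreal e * (\<integral>\<^sup>+i. ennreal ((1/2) ^ Suc (to_nat (i::'i))) \<partial>count_space UNIV)"
        by (simp add: nn_integral_add nn_integral_cmult T)
      also have "(\<integral>\<^sup>+i. ennreal ((1/2) ^ Suc (to_nat (i::'i))) \<partial>count_space UNIV)
          = (\<integral>\<^sup>+n. ennreal ((1/2) ^ Suc n) \<partial>count_space (range (to_nat :: 'i \<Rightarrow> nat)))"
        by (rule nn_integral_bij_count_space) (simp add: inj_on_imp_bij_betw)
      also have "\<dots> \<le> (\<integral>\<^sup>+n. ennreal ((1/2) ^ Suc n) \<partial>count_space UNIV)"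
        by (subst nn_integral_count_space_indicator) (auto intro!: nn_integral_mono simp: indicator_def)
      also have "\<dots> = (\<Sum>n. ennreal ((1/2) ^ Suc n))"
        by (simp add: nn_integral_count_space_nat)
      also have "\<dots> = 1"
        by (subst suminf_ennreal_eq[OF _ power_half_series]) auto
      finally have sb: "(\<integral>\<^sup>+i. ennreal (b i) \<partial>count_space UNIV) \<le> ennreal (T + e)"
        unfolding ennreal_plus[OF T(2) less_imp_le[OF e]] by (simp add: mult_left_mono)
      define G where "G i x = ennreal (1 / b i) * F i x" for i x
      have [measurable]: "G i \<in> borel_measurable M" for i
        unfolding G_def by simp
      have FG: "F i x = ennreal (b i) * G i x" for i x
        using b0[of i] by (simp add: G_def mult.assoc[symmetric] ennreal_mult[symmetric])
      have G1: "(\<integral>\<^sup>+x. epowr (G i x) r \<partial>M) \<le> 1" for i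
      proof -
        have "Lp_enorm (ennreal r) M (G i) \<le> ennreal (1 / b i) * a i"
          unfolding G_def a_def real using b0[of i] real by (intro Lp_enorm_cmult) (auto simp: less_imp_le)
        also have "\<dots> \<le> ennreal (1 / b i) * ennreal (b i)"
          using fin[of i] e by (intro mult_left_mono) (auto simp: b_def less_top)
        also have "\<dots> = 1" using b0[of i] by (simp add: ennreal_mult[symmetric])
        finally show ?thesis using real by (simp add: Lp_enorm_le_iff epowr_ennreal[of 1, simplified])
      qed
      have "(\<integral>\<^sup>+x. epowr (\<integral>\<^sup>+i. F i x \<partial>count_space UNIV) r \<partial>M)
          \<le> (\<integral>\<^sup>+x. ennreal ((T + e) powr (r - 1)) * (\<integral>\<^sup>+i. ennreal (b i) * epowr (G i x) r \<partial>count_space UNIV) \<partial>M)"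
        unfolding FG using e T real sb
        by (intro nn_integral_mono nn_integral_power_mean) auto
      also have "\<dots> = ennreal ((T + e) powr (r - 1)) * (\<integral>\<^sup>+i. ennreal (b i) * (\<integral>\<^sup>+x. epowr (G i x) r \<partial>M) \<partial>count_space UNIV)"
        by (subst nn_integral_cmult, simp, subst nn_integral_count_space_nn_integral) (simp_all add: nn_integral_cmult)
      also have "\<dots> \<le> ennreal ((T + e) powr (r - 1)) * (\<integral>\<^sup>+i. ennreal (b i) * 1 \<partial>count_space UNIV)"
        by (intro mult_left_mono nn_integral_mono G1) auto
      also have "\<dots> \<le> ennreal ((T + e) powr (r - 1)) * ennreal (T + e)"
        using sb by (intro mult_left_mono) auto
      also have "\<dots> = epowr (ennreal (T + e)) r"
        using e T unfolding epowr_ennreal[OF add_nonneg_nonneg[OF T(2) less_imp_le[OF e]]]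
        by (subst ennreal_mult[symmetric]) (auto simp: powr_diff)
      finally show "Lp_enorm p M (\<lambda>x. \<integral>\<^sup>+i. F i x \<partial>count_space UNIV) \<le> ennreal T + ennreal e"
        using real e T by (simp add: Lp_enorm_le_iff)
    qed
    then show ?thesis using T by (simp add: a_def)
  qed (simp add: a_def)
qed

section \<open>Quasi-metric spaces with a doubling measure\<close>

lemma two_powi_powr: "(2::real) powi k = 2 powr (of_int k)"
  by (simp add: powr_real_of_int')

text \<open>When \<open>f\<close> is not integrable the left-hand side is zero by convention.\<close>

lemma ennreal_norm_integral_le:
  fixes f :: "'a \<Rightarrow> complex"
  shows "ennreal (norm (LINT x|M. f x)) \<le> (\<integral>\<^sup>+x. ennreal (norm (f x)) \<partial>M)"
proof (cases "integrable M f")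
  case True
  then show ?thesis by (rule integral_norm_bound_ennreal)
qed (simp add: not_integrable_integral_eq)

locale doubling_space =
  fixes M :: "'a::{second_countable_topology, t2_space} measure"
    and d :: "'a \<Rightarrow> 'a \<Rightarrow> real"
    and A\<^sub>0 C\<^sub>d \<epsilon> :: real
  assumes sets_M [measurable_cong]: "sets M = sets borel"
    and continuous_d: "continuous_on UNIV (\<lambda>(x, y). d x y)"
    and d_sym: "d x y = d y x"
    and d_nonneg: "0 \<le> d x y"
    and d_self: "d x x = 0"
    and A0: "1 \<le> A\<^sub>0"
    and d_triangle: "d x y \<le> A\<^sub>0 * (d x z + d z y)"
    and eps: "0 < \<epsilon>"
    and finite_balls: "0 < t \<Longrightarrow> emeasure M (qball d x t) < \<infinity>"
    and doubling_balls: "0 < t \<Longrightarrow> emeasure M (qball d x (2 * t)) \<le> ennreal C\<^sub>d * emeasure M (qball d x t)"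
    and infinite_space: "emeasure M UNIV = \<infinity>"
begin

lemma space_M [simp]: "space M = UNIV"
  using sets_eq_imp_space_eq[OF sets_M] by simp

lemma sets_MM: "sets (M \<Otimes>\<^sub>M M) = sets (borel :: ('a \<times> 'a) measure)"
  unfolding borel_prod[symmetric] by (rule sets_pair_measure_cong[OF sets_M sets_M])

lemma continuous_imp_measurable_MM:
  fixes f :: "'a \<times> 'a \<Rightarrow> 'b::topological_space"
  assumes "continuous_on UNIV f"
  shows "f \<in> borel_measurable (M \<Otimes>\<^sub>M M)"
  using borel_measurable_continuous_onI[OF assms] measurable_cong_sets[OF sets_MM refl] by blast

lemma measurable_d [measurable]: "(\<lambda>(x, y). d x y) \<in> borel_measurable (M \<Otimes>\<^sub>M M)"
  by (rule continuous_imp_measurable_MM) (rule continuous_d)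

lemma measurable_d' [measurable]:
  assumes [measurable]: "f \<in> measurable N M" "g \<in> measurable N M"
  shows "(\<lambda>x. d (f x) (g x)) \<in> borel_measurable N"
  using measurable_compose[OF measurable_Pair[OF assms] measurable_d] by simp

lemma qball_sets [measurable]: "qball d x t \<in> sets M"
proof -
  have "{y \<in> space M. d x y < t} \<in> sets M" by measurable
  then show ?thesis by (simp add: qball_def)
qed

lemma UN_qball: "(\<Union>n. qball d x (t * 2 ^ n)) = UNIV" if "0 < t"
proof -
  have "\<exists>n. d x y < t * 2 ^ n" for y
  proof -
    obtain n where "d x y / t < 2 ^ n" using real_arch_pow[of 2 "d x y / t"] by auto
    then show ?thesis using that by (auto simp: field_simps)
  qed
  then show ?thesis by (auto simp: qball_def)
qed

lemma sigma_finite_M: "sigma_finite_measure M"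
proof
  show "\<exists>A. countable A \<and> A \<subseteq> sets M \<and> \<Union>A = space M \<and> (\<forall>a\<in>A. emeasure M a \<noteq> \<infinity>)"
    using UN_qball[of 1 undefined] finite_balls[of "1 * 2 ^ _" undefined]
    by (intro exI[of _ "range (\<lambda>n::nat. qball d undefined (1 * 2 ^ n))"]) (auto simp: less_top)
qed

sublocale sigma_finite_measure M by (rule sigma_finite_M)

sublocale MM: pair_sigma_finite M M ..

lemma emeasure_qball: "0 < t \<Longrightarrow> emeasure M (qball d x t) = ennreal (measure M (qball d x t))"
  using finite_balls[of t x] by (intro emeasure_eq_ennreal_measure) auto

lemma fmeasurable_qball: "0 < t \<Longrightarrow> qball d x t \<in> fmeasurable M"
  using finite_balls[of t x] by (intro fmeasurableI) auto

lemma doubling_iterate: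
  assumes "0 < t"
  shows "measure M (qball d x (t * 2 ^ n)) \<le> (max 1 C\<^sub>d) ^ n * measure M (qball d x t)"
proof (induction n)
  case (Suc n)
  have "ennreal (measure M (qball d x (2 * (t * 2 ^ n)))) \<le> ennreal C\<^sub>d * ennreal (measure M (qball d x (t * 2 ^ n)))"
    using doubling_balls[of "t * 2 ^ n" x] assms by (simp add: emeasure_qball)
  also have "\<dots> \<le> ennreal (max 1 C\<^sub>d) * ennreal (measure M (qball d x (t * 2 ^ n)))"
    by (intro mult_right_mono ennreal_leI) auto
  finally have "measure M (qball d x (2 * (t * 2 ^ n))) \<le> max 1 C\<^sub>d * measure M (qball d x (t * 2 ^ n))"
    by (simp add: ennreal_mult[symmetric])
  also have "\<dots> \<le> max 1 C\<^sub>d * ((max 1 C\<^sub>d) ^ n * measure M (qball d x t))"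
    by (intro mult_left_mono Suc) auto
  finally show ?case by (simp add: ac_simps)
qed simp

lemma measure_qball_unbounded:
  assumes "0 < t"
  shows "\<exists>n. B < measure M (qball d x (t * 2 ^ n))"
proof (rule ccontr)
  assume "\<not> ?thesis"
  then have *: "measure M (qball d x (t * 2 ^ n)) \<le> B" for n by (auto simp: not_less)
  have "(SUP n. emeasure M (qball d x (t * 2 ^ n))) = emeasure M (\<Union>n. qball d x (t * 2 ^ n))"
    using assms
    by (intro SUP_emeasure_incseq)
       (auto simp: incseq_def qball_def intro: less_le_trans power_increasing mult_left_mono)
  then have "\<infinity> = (SUP n. emeasure M (qball d x (t * 2 ^ n)))"
    by (simp only: UN_qball[OF assms] infinite_space)
  also have "\<dots> \<le> ennreal B"
    using * assms by (intro SUP_least) (simp add: emeasure_qball ennreal_leI)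
  finally show False by (simp add: top_unique)
qed

text \<open>If one ball were a null set, doubling would make all balls about its center null sets, and so the space.\<close>

lemma measure_qball_pos: "0 < t \<Longrightarrow> 0 < measure M (qball d x t)"
proof (rule ccontr)
  assume t: "0 < t" and "\<not> 0 < measure M (qball d x t)"
  then have "measure M (qball d x t) = 0" by (simp add: not_less antisym)
  then have "measure M (qball d x (t * 2 ^ n)) \<le> 0" for n
    using doubling_iterate[OF t, of x n] by simp
  then show False using measure_qball_unbounded[OF t, of 0 x] by (auto simp: not_less[symmetric])
qed

lemma qball_mono: "s \<le> t \<Longrightarrow> measure M (qball d x s) \<le> measure M (qball d x t)" if "0 < t"
  using that by (intro measure_mono_fmeasurable) (auto simp: qball_def fmeasurable_qball[unfolded qball_def])

text \<open>If \<open>d x y \<le> c t\<close>, the ball of radius \<open>c t\<close> about \<open>x\<close> lies in the ball of radius \<open>2 A\<^sub>0 c t\<close> about \<open>y\<close>, and the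
exponent is an \<open>n\<close> with \<open>2 A\<^sub>0 c \<le> n \<le> 2\<^sup>n\<close>.\<close>

definition ball_ratio :: "real \<Rightarrow> real" where
  "ball_ratio c = (max 1 C\<^sub>d) ^ nat \<lceil>2 * A\<^sub>0 * c\<rceil>"

lemma ball_ratio_ge_1: "1 \<le> ball_ratio c"
  by (simp add: ball_ratio_def one_le_power)

lemma measure_qball_compare:
  assumes t: "0 < t" and c: "0 < c" and xy: "d x y \<le> c * t"
  shows "measure M (qball d x (c * t)) \<le> ball_ratio c * measure M (qball d y t)"
proof -
  define n where "n = nat \<lceil>2 * A\<^sub>0 * c\<rceil>"
  have "2 * A\<^sub>0 * c \<le> real n" unfolding n_def by linarith
  also have "\<dots> < 2 ^ n" by simp
  finally have n: "2 * A\<^sub>0 * c \<le> 2 ^ n" by simp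
  have "qball d x (c * t) \<subseteq> qball d y (t * 2 ^ n)"
  proof
    fix z assume "z \<in> qball d x (c * t)"
    then have "d x z < c * t" by (simp add: qball_def)
    then have "A\<^sub>0 * (d y x + d x z) < A\<^sub>0 * (c * t + c * t)"
      using xy A0 by (intro mult_strict_left_mono) (auto simp: d_sym[of y])
    also have "\<dots> = 2 * A\<^sub>0 * c * t" by (simp add: algebra_simps)
    also have "\<dots> \<le> 2 ^ n * t" using n t by (intro mult_right_mono) auto
    finally show "z \<in> qball d y (t * 2 ^ n)"
      using d_triangle[of y z x] by (simp add: qball_def mult.commute)
  qed
  then have "measure M (qball d x (c * t)) \<le> measure M (qball d y (t * 2 ^ n))"
    using t by (intro measure_mono_fmeasurable fmeasurable_qball) auto
  also have "\<dots> \<le> ball_ratio c * measure M (qball d y t)"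
    unfolding ball_ratio_def n_def by (rule doubling_iterate[OF t])
  finally show ?thesis .
qed

abbreviation radius :: "int \<Rightarrow> real" where "radius k \<equiv> 2 powi (- k)"

abbreviation V :: "int \<Rightarrow> 'a \<Rightarrow> real" where "V \<equiv> vol M d"

lemma radius_mono: "j \<le> k \<Longrightarrow> radius k \<le> radius j"
  by (simp add: two_powi_powr)

lemma V_pos: "0 < V k x"
  unfolding vol_def by (rule measure_qball_pos) simp

lemma V_antimono: "j \<le> k \<Longrightarrow> V k x \<le> V j x"
  unfolding vol_def by (intro qball_mono radius_mono) auto

lemma V_compare:
  assumes "1 \<le> c" "d x y \<le> c * radius k"
  shows "V k x \<le> ball_ratio c * V k y"
proof -
  have "V k x \<le> measure M (qball d x (c * radius k))"
    unfolding vol_def using assms by (intro qball_mono) auto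
  also have "\<dots> \<le> ball_ratio c * V k y"
    unfolding vol_def using assms by (intro measure_qball_compare) auto
  finally show ?thesis .
qed

lemma V_measurable [measurable]: "V k \<in> borel_measurable M"
proof -
  have "{z \<in> space (M \<Otimes>\<^sub>M M). d (fst z) (snd z) < radius k} \<in> sets (M \<Otimes>\<^sub>M M)" (is "?Q \<in> _")
    by measurable
  from measurable_emeasure_Pair[OF this] have "(\<lambda>x. enn2real (emeasure M (Pair x -` ?Q))) \<in> borel_measurable M"
    by measurable
  moreover have "Pair x -` ?Q = qball d x (radius k)" for x
    by (auto simp: qball_def space_pair_measure)
  ultimately have "(\<lambda>x. enn2real (emeasure M (qball d x (radius k)))) \<in> borel_measurable M"
    by (simp only:)
  then show ?thesis by (simp only: vol_def[abs_def] measure_def)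
qed

text \<open>The kernel of the averaging operator over balls of radius \<open>c 2\<^sup>-\<^sup>k\<close>, up to normalization. All kernels below
are dominated by multiples of it, so that their boundedness on \<open>L\<^sup>p\<close> reduces to that of these averages.\<close>

definition ball_avg :: "real \<Rightarrow> int \<Rightarrow> 'a \<Rightarrow> 'a \<Rightarrow> real" where
  "ball_avg c k x y = (if d x y \<le> c * radius k then 1 / V k x else 0)"

lemma ball_avg_nonneg: "0 \<le> ball_avg c k x y"
  using V_pos[of k x] by (simp add: ball_avg_def)

lemma ball_avg_measurable [measurable]: "(\<lambda>(x, y). ball_avg c k x y) \<in> borel_measurable (M \<Otimes>\<^sub>M M)"
  unfolding ball_avg_def by measurable

lemma ball_avg_swap:
  assumes "1 \<le> c"
  shows "ball_avg c k x y \<le> ball_ratio c * ball_avg c k y x"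
  using V_compare[of c y x k] assms V_pos[of k x] V_pos[of k y]
  by (auto simp: ball_avg_def d_sym[of y x] field_simps)

lemma ball_avg_rows:
  assumes c: "1 \<le> c"
  shows "(\<integral>\<^sup>+y. ennreal (ball_avg c k x y) \<partial>M) \<le> ennreal (ball_ratio (2 * c))"
proof -
  have "(\<integral>\<^sup>+y. ennreal (ball_avg c k x y) \<partial>M)
      \<le> (\<integral>\<^sup>+y. ennreal (1 / V k x) * indicator (qball d x (2 * c * radius k)) y \<partial>M)"
  proof (rule nn_integral_mono)
    fix y
    have "0 < c * radius k" using c by simp
    then have "d x y \<le> c * radius k \<Longrightarrow> d x y < 2 * c * radius k" by linarith
    then show "ennreal (ball_avg c k x y) \<le> ennreal (1 / V k x) * indicator (qball d x (2 * c * radius k)) y"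
      by (auto simp: ball_avg_def qball_def indicator_def)
  qed
  also have "\<dots> = ennreal (1 / V k x * measure M (qball d x (2 * c * radius k)))"
    using c V_pos[of k x] by (simp add: nn_integral_cmult_indicator emeasure_qball ennreal_mult[symmetric])
  also have "\<dots> \<le> ennreal (ball_ratio (2 * c))"
  proof (rule ennreal_leI)
    have "measure M (qball d x (2 * c * radius k)) \<le> ball_ratio (2 * c) * V k x"
      unfolding vol_def using c by (intro measure_qball_compare) (auto simp: d_self)
    then show "1 / V k x * measure M (qball d x (2 * c * radius k)) \<le> ball_ratio (2 * c)"
      using V_pos[of k x] by (simp add: field_simps)
  qed
  finally show ?thesis .
qed

text \<open>The factor \<open>ball_ratio (2 * c)\<close> bounds the rows of \<open>ball_avg c k\<close>; the other one is the price for exchanging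
its two arguments.\<close>

definition avg_norm :: "real \<Rightarrow> real" where
  "avg_norm c = ball_ratio c * ball_ratio (2 * c)"

lemma avg_norm_ge_1: "1 \<le> avg_norm c"
  using ball_ratio_ge_1[of c] ball_ratio_ge_1[of "2 * c"] mult_mono[of 1 "ball_ratio c" 1 "ball_ratio (2*c)"]
  by (simp add: avg_norm_def)

lemma ball_avg_rows':
  assumes c: "1 \<le> c"
  shows "(\<integral>\<^sup>+y. ennreal (ball_avg c k x y) \<partial>M) \<le> ennreal (avg_norm c)"
proof (rule order_trans[OF ball_avg_rows[OF c]])
  show "ennreal (ball_ratio (2 * c)) \<le> ennreal (avg_norm c)"
    unfolding avg_norm_def using ball_ratio_ge_1[of c] ball_ratio_ge_1[of "2 * c"]
    by (intro ennreal_leI) simp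
qed

lemma ball_avg_columns:
  assumes c: "1 \<le> c"
  shows "(\<integral>\<^sup>+x. ennreal (ball_avg c k x y) \<partial>M) \<le> ennreal (avg_norm c)"
proof -
  have "(\<integral>\<^sup>+x. ennreal (ball_avg c k x y) \<partial>M) \<le> (\<integral>\<^sup>+x. ennreal (ball_ratio c) * ennreal (ball_avg c k y x) \<partial>M)"
    using ball_avg_swap[OF c] ball_ratio_ge_1[of c] ball_avg_nonneg
    by (intro nn_integral_mono) (simp add: ennreal_mult[symmetric] ennreal_leI)
  also have "\<dots> \<le> ennreal (ball_ratio c) * ennreal (ball_ratio (2 * c))"
    by (subst nn_integral_cmult) (auto intro!: mult_left_mono ball_avg_rows[OF c])
  also have "\<dots> = ennreal (avg_norm c)"
    using ball_ratio_ge_1[of c] ball_ratio_ge_1[of "2 * c"] by (simp add: avg_norm_def ennreal_mult)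
  finally show ?thesis .
qed

lemma Lp_enorm_ball_avg:
  assumes p: "1 \<le> p" and c: "1 \<le> c" and [measurable]: "F \<in> borel_measurable M"
  shows "Lp_enorm p M (\<lambda>x. \<integral>\<^sup>+y. ennreal (ball_avg c k x y) * F y \<partial>M) \<le> ennreal (avg_norm c) * Lp_enorm p M F"
  using avg_norm_ge_1[of c] ball_avg_rows'[OF c] ball_avg_columns[OF c]
  by (intro Lp_enorm_Schur[OF p sigma_finite_M]) auto

text \<open>The first bound, with the absolute values inside the integral, is what Fubini's theorem asks for.\<close>

lemma Lp_norm_int_op:
  assumes p: "1 \<le> p" and c: "1 \<le> c" and b: "0 \<le> b"
    and K [measurable]: "case_prod K \<in> borel_measurable (M \<Otimes>\<^sub>M M)"
    and [measurable]: "g \<in> borel_measurable M"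
    and bound: "\<And>x y. norm (K x y) \<le> b * ball_avg c k x y"
  shows "Lp_enorm p M (\<lambda>x. \<integral>\<^sup>+y. ennreal (norm (K x y) * norm (g y)) \<partial>M) \<le> ennreal (b * avg_norm c) * Lp_norm p M g"
    and "Lp_norm p M (int_op M K g) \<le> ennreal (b * avg_norm c) * Lp_norm p M g"
proof -
  have "Lp_enorm p M (\<lambda>x. \<integral>\<^sup>+y. ennreal (norm (K x y) * norm (g y)) \<partial>M)
     \<le> Lp_enorm p M (\<lambda>x. ennreal b * (\<integral>\<^sup>+y. ennreal (ball_avg c k x y) * ennreal (norm (g y)) \<partial>M))"
  proof (rule Lp_enorm_mono[OF p])
    fix x
    have "(\<integral>\<^sup>+y. ennreal (norm (K x y) * norm (g y)) \<partial>M) \<le> (\<integral>\<^sup>+y. ennreal b * (ennreal (ball_avg c k x y) * ennreal (norm (g y))) \<partial>M)"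
      using bound b ball_avg_nonneg[of c k x]
      by (intro nn_integral_mono) (auto simp: ennreal_mult[symmetric] mult.assoc[symmetric] intro!: ennreal_leI mult_right_mono)
    also have "\<dots> = ennreal b * (\<integral>\<^sup>+y. ennreal (ball_avg c k x y) * ennreal (norm (g y)) \<partial>M)"
      by (intro nn_integral_cmult) measurable
    finally show "(\<integral>\<^sup>+y. ennreal (norm (K x y) * norm (g y)) \<partial>M) \<le> ennreal b * (\<integral>\<^sup>+y. ennreal (ball_avg c k x y) * ennreal (norm (g y)) \<partial>M)" .
  qed measurable
  also have "\<dots> \<le> ennreal b * Lp_enorm p M (\<lambda>x. \<integral>\<^sup>+y. ennreal (ball_avg c k x y) * ennreal (norm (g y)) \<partial>M)"
    by (rule Lp_enorm_cmult[OF p _ b]) measurable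
  also have "\<dots> \<le> ennreal b * (ennreal (avg_norm c) * Lp_norm p M g)"
    unfolding Lp_norm_eq by (intro mult_left_mono Lp_enorm_ball_avg[OF p c]) auto
  also have "\<dots> = ennreal (b * avg_norm c) * Lp_norm p M g"
    using b avg_norm_ge_1[of c] by (simp add: ennreal_mult mult.assoc)
  finally show *: "Lp_enorm p M (\<lambda>x. \<integral>\<^sup>+y. ennreal (norm (K x y) * norm (g y)) \<partial>M) \<le> ennreal (b * avg_norm c) * Lp_norm p M g" .
  have "Lp_norm p M (int_op M K g) \<le> Lp_enorm p M (\<lambda>x. \<integral>\<^sup>+y. ennreal (norm (K x y) * norm (g y)) \<partial>M)"
    unfolding Lp_norm_eq
  proof (rule Lp_enorm_mono[OF p])
    fix x
    show "ennreal (norm (int_op M K g x)) \<le> (\<integral>\<^sup>+y. ennreal (norm (K x y) * norm (g y)) \<partial>M)"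
      using ennreal_norm_integral_le[of M "\<lambda>y. K x y * g y"] by (simp add: int_op_def norm_mult)
  qed (unfold int_op_def, measurable)
  with * show "Lp_norm p M (int_op M K g) \<le> ennreal (b * avg_norm c) * Lp_norm p M g"
    by (rule order_trans[rotated])
qed

lemma int_op_measurable [measurable]:
  assumes [measurable]: "case_prod K \<in> borel_measurable (M \<Otimes>\<^sub>M M)" "g \<in> borel_measurable M"
  shows "int_op M K g \<in> borel_measurable M"
  unfolding int_op_def by measurable

lemma Lp_functions_int_op:
  assumes p: "1 \<le> p" and c: "1 \<le> c" and b: "0 \<le> b"
    and K [measurable]: "case_prod K \<in> borel_measurable (M \<Otimes>\<^sub>M M)"
    and g: "g \<in> Lp_functions p M"
    and bound: "\<And>x y. norm (K x y) \<le> b * ball_avg c k x y"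
  shows "int_op M K g \<in> Lp_functions p M"
proof -
  have [measurable]: "g \<in> borel_measurable M" and "Lp_norm p M g < \<infinity>"
    using g by (auto simp: Lp_functions_def)
  moreover have "Lp_norm p M (int_op M K g) \<le> ennreal (b * avg_norm c) * Lp_norm p M g"
    by (rule Lp_norm_int_op(2)[OF p c b K _ bound]) simp
  ultimately show ?thesis
    by (auto simp: Lp_functions_def ennreal_mult_less_top intro: le_less_trans)
qed

end

section \<open>Hoelder kernels and their compositions\<close>

context doubling_space
begin

text \<open>In contrast to the defining estimates of an approximation to the identity, the Hoelder conditions are
imposed on all pairs of points, with the volume about the point that stays fixed. In this form the estimates are invariant under transposition and survive the passage
from \<open>S\<^sub>k\<close> to \<open>S\<^sub>k - S\<^sub>k\<^sub>-\<^sub>1\<close>.\<close>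

definition hoelder_kernel :: "real \<Rightarrow> int \<Rightarrow> ('a \<Rightarrow> 'a \<Rightarrow> complex) \<Rightarrow> bool" where
  "hoelder_kernel C k K \<longleftrightarrow>
     (\<forall>x y. C * radius k < d x y \<longrightarrow> K x y = 0) \<and>
     (\<forall>x y. norm (K x y) \<le> C / V k x) \<and>
     (\<forall>x y. norm (K x y) \<le> C / V k y) \<and>
     (\<forall>x x' y. norm (K x y - K x' y) \<le> C * (2 powi k * d x x') powr \<epsilon> / V k y) \<and>
     (\<forall>x y y'. norm (K x y - K x y') \<le> C * (2 powi k * d y y') powr \<epsilon> / V k x)"

lemma hoelder_kernelD:
  assumes "hoelder_kernel C k K"
  shows "C * radius k < d x y \<Longrightarrow> K x y = 0"
    and "norm (K x y) \<le> C / V k x"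
    and "norm (K x y) \<le> C / V k y"
    and "norm (K x y - K x' y) \<le> C * (2 powi k * d x x') powr \<epsilon> / V k y"
    and "norm (K x y - K x y') \<le> C * (2 powi k * d y y') powr \<epsilon> / V k x"
  using assms unfolding hoelder_kernel_def by blast+

lemma hoelder_kernel_transpose:
  "hoelder_kernel C k K \<Longrightarrow> hoelder_kernel C k (\<lambda>x y. K y x)"
  unfolding hoelder_kernel_def by (simp add: d_sym)

lemma hoelder_kernel_mono:
  assumes K: "hoelder_kernel C k K" and C: "C \<le> C'"
  shows "hoelder_kernel C' k K"
  unfolding hoelder_kernel_def
proof (intro conjI allI impI)
  fix x x' y y'
  have V: "0 \<le> V k z" for z using V_pos[of k z] by simp
  show "K x y = 0" if "C' * radius k < d x y"
    using that C by (intro hoelder_kernelD(1)[OF K]) (auto intro: le_less_trans[OF mult_right_mono])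
  show "norm (K x y) \<le> C' / V k x"
    using hoelder_kernelD(2)[OF K, of x y] divide_right_mono[OF C V, of x] by linarith
  show "norm (K x y) \<le> C' / V k y"
    using hoelder_kernelD(3)[OF K, of x y] divide_right_mono[OF C V, of y] by linarith
  have "C * (2 powi k * d x x') powr \<epsilon> / V k y \<le> C' * (2 powi k * d x x') powr \<epsilon> / V k y"
    using C V by (intro divide_right_mono mult_right_mono) auto
  then show "norm (K x y - K x' y) \<le> C' * (2 powi k * d x x') powr \<epsilon> / V k y"
    using hoelder_kernelD(4)[OF K, of x y x'] by linarith
  have "C * (2 powi k * d y y') powr \<epsilon> / V k x \<le> C' * (2 powi k * d y y') powr \<epsilon> / V k x"
    using C V by (intro divide_right_mono mult_right_mono) auto
  then show "norm (K x y - K x y') \<le> C' * (2 powi k * d y y') powr \<epsilon> / V k x"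
    using hoelder_kernelD(5)[OF K, of x y y'] by linarith
qed

lemma hoelder_kernel_diff:
  assumes K: "hoelder_kernel C k K" and L: "hoelder_kernel C (k - 1) L" and C: "0 \<le> C"
  shows "hoelder_kernel (2 * C) k (\<lambda>x y. K x y - L x y)"
  unfolding hoelder_kernel_def
proof (intro conjI allI impI)
  fix x x' y y'
  have r: "radius (k - 1) = 2 * radius k"
    using power_int_add[of "2::real" 1 "- k"] by simp
  have V: "C / V (k - 1) z \<le> C / V k z" for z
    using V_pos[of k z] C V_antimono[of "k - 1" k z] by (intro divide_left_mono mult_pos_pos V_pos) auto
  have H: "C * (2 powi (k - 1) * d u v) powr \<epsilon> / V (k - 1) z \<le> C * (2 powi k * d u v) powr \<epsilon> / V k z" for u v z
  proof -
    have "(2::real) powi (k - 1) \<le> 2 powi k" by (simp add: two_powi_powr)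
    then have "(2 powi (k - 1) * d u v) powr \<epsilon> \<le> (2 powi k * d u v) powr \<epsilon>"
      using d_nonneg[of u v] eps by (intro powr_mono2 mult_right_mono) auto
    then show ?thesis
      using V_pos[of k z] C V_antimono[of "k - 1" k z] by (intro frac_le mult_left_mono) auto
  qed
  show "K x y - L x y = 0" if *: "2 * C * radius k < d x y"
  proof -
    have "0 \<le> C * radius k" using C by simp
    then have "C * radius k < d x y" "C * radius (k - 1) < d x y"
      using * unfolding r by linarith+
    then show ?thesis using hoelder_kernelD(1)[OF K] hoelder_kernelD(1)[OF L] by simp
  qed
  show "norm (K x y - L x y) \<le> 2 * C / V k x"
    using hoelder_kernelD(2)[OF K, of x y] hoelder_kernelD(2)[OF L, of x y] V[of x]
      norm_triangle_ineq4[of "K x y" "L x y"] by linarith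
  show "norm (K x y - L x y) \<le> 2 * C / V k y"
    using hoelder_kernelD(3)[OF K, of x y] hoelder_kernelD(3)[OF L, of x y] V[of y]
      norm_triangle_ineq4[of "K x y" "L x y"] by linarith
  have "norm ((K x y - K x' y) - (L x y - L x' y)) \<le> 2 * (C * (2 powi k * d x x') powr \<epsilon> / V k y)"
    using hoelder_kernelD(4)[OF K, of x y x'] hoelder_kernelD(4)[OF L, of x y x'] H[of x x' y]
      norm_triangle_ineq4[of "K x y - K x' y" "L x y - L x' y"] by linarith
  then show "norm (K x y - L x y - (K x' y - L x' y)) \<le> 2 * C * (2 powi k * d x x') powr \<epsilon> / V k y"
    by (simp add: algebra_simps)
  have "norm ((K x y - K x y') - (L x y - L x y')) \<le> 2 * (C * (2 powi k * d y y') powr \<epsilon> / V k x)"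
    using hoelder_kernelD(5)[OF K, of x y y'] hoelder_kernelD(5)[OF L, of x y y'] H[of y y' x]
      norm_triangle_ineq4[of "K x y - K x y'" "L x y - L x y'"] by linarith
  then show "norm (K x y - L x y - (K x y' - L x y')) \<le> 2 * C * (2 powi k * d y y') powr \<epsilon> / V k x"
    by (simp add: algebra_simps)
qed

lemma continuous_d_compose:
  fixes f g :: "'b::topological_space \<Rightarrow> 'a"
  assumes "(f \<longlongrightarrow> a) F" "(g \<longlongrightarrow> b) F"
  shows "((\<lambda>z. d (f z) (g z)) \<longlongrightarrow> d a b) F"
proof -
  have "isCont (\<lambda>(x, y). d x y) (a, b)"
    using continuous_d by (simp add: continuous_on_eq_continuous_at)
  from isCont_tendsto_compose[OF this tendsto_Pair[OF assms]] show ?thesis by simp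
qed

text \<open>Joint continuity provides the measurability on the product space that Fubini's theorem requires. The
volume about the moving point \<open>y\<close> is controlled by that about \<open>b\<close> once \<open>d y b\<close> is below \<open>2\<^sup>-\<^sup>k\<close>.\<close>

lemma hoelder_kernel_continuous:
  assumes K: "hoelder_kernel C k K" and C: "0 \<le> C"
  shows "continuous_on UNIV (\<lambda>(x, y). K x y)"
  unfolding continuous_on_eq_continuous_at[OF open_UNIV] isCont_def
proof (rule ballI)
  fix w :: "'a \<times> 'a"
  obtain a b where w: "w = (a, b)" by (cases w)
  let ?F = "at (a, b) :: ('a \<times> 'a) filter"
  have fst: "(fst \<longlongrightarrow> a) ?F" and snd: "(snd \<longlongrightarrow> b) ?F"
    by (auto intro!: tendsto_eq_intros)
  define R where "R z = C * (2 powi k * d (fst z) a) powr \<epsilon> * ball_ratio 1 / V k b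
                      + C * (2 powi k * d (snd z) b) powr \<epsilon> / V k a" for z
  have d0: "((\<lambda>z. d (fst z) a) \<longlongrightarrow> d a a) ?F" "((\<lambda>z. d (snd z) b) \<longlongrightarrow> d b b) ?F"
    by (intro continuous_d_compose fst snd tendsto_const)+
  have "(R \<longlongrightarrow> C * (2 powi k * d a a) powr \<epsilon> * ball_ratio 1 / V k b + C * (2 powi k * d b b) powr \<epsilon> / V k a) ?F"
    unfolding R_def using V_pos[of k a] V_pos[of k b] eps
    by (intro tendsto_intros d0 tendsto_powr') (auto simp: d_nonneg)
  then have R0: "(R \<longlongrightarrow> 0) ?F" by (simp add: d_self)
  have "\<forall>\<^sub>F z in ?F. norm ((case z of (x, y) \<Rightarrow> K x y) - K a b) \<le> R z"
  proof -
    have "\<forall>\<^sub>F z in ?F. d (snd z) b < radius k"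
      using order_tendstoD(2)[OF d0(2), of "radius k"] by (simp add: d_self)
    then show ?thesis
    proof eventually_elim
      case (elim z)
      obtain x y where z: "z = (x, y)" by (cases z)
      have V: "C * (2 powi k * d x a) powr \<epsilon> / V k y \<le> C * (2 powi k * d x a) powr \<epsilon> * ball_ratio 1 / V k b"
      proof -
        have "V k b \<le> ball_ratio 1 * V k y"
          using elim z by (intro V_compare) (auto simp: d_sym[of b])
        then have "1 / V k y \<le> ball_ratio 1 / V k b"
          using V_pos[of k y] V_pos[of k b] by (simp add: field_simps)
        then have "C * (2 powi k * d x a) powr \<epsilon> * (1 / V k y) \<le> C * (2 powi k * d x a) powr \<epsilon> * (ball_ratio 1 / V k b)"
          using C by (intro mult_left_mono) auto
        then show ?thesis by simp
      qed
      have "norm (K x y - K a b) \<le> norm (K x y - K a y) + norm (K a y - K a b)"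
        using norm_triangle_ineq[of "K x y - K a y" "K a y - K a b"] by simp
      also have "\<dots> \<le> R z"
        using hoelder_kernelD(4)[OF K, of x y a] hoelder_kernelD(5)[OF K, of a y b] V
        by (simp add: R_def z)
      finally show ?case by (simp add: z)
    qed
  qed
  then have "((\<lambda>z. (case z of (x, y) \<Rightarrow> K x y) - K a b) \<longlongrightarrow> 0) ?F"
    by (rule Lim_null_comparison[OF _ R0])
  then show "((\<lambda>z. case z of (x, y) \<Rightarrow> K x y) \<longlongrightarrow> (case w of (x, y) \<Rightarrow> K x y)) (at w)"
    unfolding w prod.case by (subst Lim_null)
qed

lemma hoelder_kernel_measurable:
  assumes "hoelder_kernel C k K" "0 \<le> C"
  shows "case_prod K \<in> borel_measurable (M \<Otimes>\<^sub>M M)"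
  using continuous_imp_measurable_MM[OF hoelder_kernel_continuous[OF assms]] by simp

lemma hoelder_kernel_le_ball_avg:
  assumes K: "hoelder_kernel C k K"
  shows "norm (K x y) \<le> C * ball_avg C k x y"
  using hoelder_kernelD(1)[OF K, of x y] hoelder_kernelD(2)[OF K, of x y]
  by (auto simp: ball_avg_def not_le)

lemma hoelder_kernel_rows:
  assumes K: "hoelder_kernel C k K" and C: "1 \<le> C"
  shows "(\<integral>\<^sup>+y. ennreal (norm (K x y)) \<partial>M) \<le> ennreal (C * avg_norm C)"
proof -
  have "(\<integral>\<^sup>+y. ennreal (norm (K x y)) \<partial>M) \<le> (\<integral>\<^sup>+y. ennreal C * ennreal (ball_avg C k x y) \<partial>M)"
    using hoelder_kernel_le_ball_avg[OF K] C ball_avg_nonneg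
    by (intro nn_integral_mono) (simp add: ennreal_mult[symmetric] ennreal_leI)
  also have "\<dots> \<le> ennreal C * ennreal (avg_norm C)"
    by (subst nn_integral_cmult) (auto intro!: mult_left_mono ball_avg_rows'[OF C])
  finally show ?thesis using C avg_norm_ge_1[of C] by (simp add: ennreal_mult)
qed

lemma hoelder_kernel_columns:
  assumes K: "hoelder_kernel C k K" and C: "1 \<le> C"
  shows "(\<integral>\<^sup>+x. ennreal (norm (K x y)) \<partial>M) \<le> ennreal (C * avg_norm C)"
  using hoelder_kernel_rows[OF hoelder_kernel_transpose[OF K] C] .

lemma hoelder_kernel_integrable:
  assumes K: "hoelder_kernel C k K" and C: "1 \<le> C"
  shows "integrable M (\<lambda>y. K x y)" "integrable M (\<lambda>x. K x y)"
proof -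
  have [measurable]: "case_prod K \<in> borel_measurable (M \<Otimes>\<^sub>M M)"
    using hoelder_kernel_measurable[OF K] C by simp
  show "integrable M (\<lambda>y. K x y)" "integrable M (\<lambda>x. K x y)"
    using hoelder_kernel_rows[OF K C, of x] hoelder_kernel_columns[OF K C, of y]
    by (auto intro!: integrableI_bounded elim!: le_less_trans)
qed

definition cancelling :: "('a \<Rightarrow> 'a \<Rightarrow> complex) \<Rightarrow> bool" where
  "cancelling K \<longleftrightarrow> (\<forall>y. (LINT x|M. K x y) = 0) \<and> (\<forall>x. (LINT y|M. K x y) = 0)"

definition kernel_comp :: "('a \<Rightarrow> 'a \<Rightarrow> complex) \<Rightarrow> ('a \<Rightarrow> 'a \<Rightarrow> complex) \<Rightarrow> 'a \<Rightarrow> 'a \<Rightarrow> complex" where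
  "kernel_comp K L x y = (LINT z|M. K x z * L z y)"

lemma kernel_comp_measurable [measurable]:
  assumes [measurable]: "case_prod K \<in> borel_measurable (M \<Otimes>\<^sub>M M)" "case_prod L \<in> borel_measurable (M \<Otimes>\<^sub>M M)"
  shows "case_prod (kernel_comp K L) \<in> borel_measurable (M \<Otimes>\<^sub>M M)"
  unfolding kernel_comp_def by measurable

definition composition_const :: "real \<Rightarrow> real" where
  "composition_const C = C * C powr \<epsilon> * (C * avg_norm C)"

text \<open>As the finer kernel \<open>L\<close> has integral zero, \<open>K x z\<close> may be replaced by \<open>K x z - K x y\<close> in the composition.
Only points \<open>z\<close> within distance \<open>C 2\<^sup>-\<^sup>k\<close> of \<open>y\<close> contribute, and on the scale of \<open>K\<close> this distance is small.\<close>

lemma kernel_comp_bound_le: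
  assumes K: "hoelder_kernel C j K" and L: "hoelder_kernel C k L" and C: "1 \<le> C"
    and jk: "j \<le> k" and cancel: "\<And>y. (LINT z|M. L z y) = 0"
  shows "norm (kernel_comp K L x y)
           \<le> composition_const C * 2 powr (- \<epsilon> * of_int (k - j)) * ball_avg (2 * A\<^sub>0 * C) j x y"
proof (cases "d x y \<le> 2 * A\<^sub>0 * C * radius j")
  case False
  have "K x z * L z y = 0" for z
  proof (rule ccontr)
    assume "K x z * L z y \<noteq> 0"
    then have "d x z \<le> C * radius j" "d z y \<le> C * radius k"
      using hoelder_kernelD(1)[OF K, of x z] hoelder_kernelD(1)[OF L, of z y] by (auto simp: not_less[symmetric])
    moreover have "C * radius k \<le> C * radius j"
      using C radius_mono[OF jk] by (intro mult_left_mono) auto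
    ultimately have "A\<^sub>0 * (d x z + d z y) \<le> A\<^sub>0 * (C * radius j + C * radius j)"
      using A0 by (intro mult_left_mono add_mono) auto
    then show False using d_triangle[of x y z] False by (simp add: algebra_simps)
  qed
  then have "kernel_comp K L x y = 0"
    unfolding kernel_comp_def by (simp only: integral_zero)
  then show ?thesis using False by (simp add: ball_avg_def)
next
  case True
  have int_K: "integrable M (\<lambda>z. K x z * L z y)"
  proof (rule Bochner_Integration.integrable_bound[of M "\<lambda>z. of_real (C / V j x) * L z y"])
    show "AE z in M. norm (K x z * L z y) \<le> norm (of_real (C / V j x) * L z y)"
    proof (rule AE_I2)
      fix z
      have "norm (K x z) * norm (L z y) \<le> \<bar>C / V j x\<bar> * norm (L z y)"
        using order_trans[OF hoelder_kernelD(2)[OF K, of x z] abs_ge_self]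
        by (rule mult_right_mono) simp
      then show "norm (K x z * L z y) \<le> norm (of_real (C / V j x) * L z y)"
        by (simp only: norm_mult norm_of_real)
    qed
    have [measurable]: "case_prod K \<in> borel_measurable (M \<Otimes>\<^sub>M M)" "case_prod L \<in> borel_measurable (M \<Otimes>\<^sub>M M)"
      using hoelder_kernel_measurable[OF K] hoelder_kernel_measurable[OF L] C by simp_all
    show "(\<lambda>z. K x z * L z y) \<in> borel_measurable M" by measurable
  qed (intro integrable_mult_right hoelder_kernel_integrable[OF L C])
  have int_L: "integrable M (\<lambda>z. K x y * L z y)"
    by (intro integrable_mult_right hoelder_kernel_integrable[OF L C])
  have "kernel_comp K L x y = (LINT z|M. (K x z - K x y) * L z y)"
    using int_K int_L cancel[of y] by (simp add: kernel_comp_def left_diff_distrib)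
  then have "ennreal (norm (kernel_comp K L x y)) \<le> (\<integral>\<^sup>+z. ennreal (norm ((K x z - K x y) * L z y)) \<partial>M)"
    by (metis ennreal_norm_integral_le)
  also have "\<dots> \<le> (\<integral>\<^sup>+z. ennreal (C * C powr \<epsilon> * 2 powr (- \<epsilon> * of_int (k - j)) / V j x) * ennreal (norm (L z y)) \<partial>M)"
  proof (rule nn_integral_mono)
    fix z
    have "norm (K x z - K x y) * norm (L z y) \<le> C * C powr \<epsilon> * 2 powr (- \<epsilon> * of_int (k - j)) / V j x * norm (L z y)"
    proof (cases "C * radius k < d z y")
      case False
      have "(2 powi j * d z y) powr \<epsilon> \<le> (2 powi j * (C * radius k)) powr \<epsilon>"
        using False eps d_nonneg[of z y] by (intro powr_mono2 mult_left_mono) auto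
      also have "2 powi j * (C * radius k) = C * 2 powr (- of_int (k - j))"
      proof -
        have "2 powr of_int j * 2 powr of_int (- k) = (2::real) powr (- of_int (k - j))"
          unfolding powr_add[symmetric] by simp
        then show ?thesis
          unfolding two_powi_powr mult.left_commute[of "2 powr of_int j"] by (simp only:)
      qed
      also have "\<dots> powr \<epsilon> = C powr \<epsilon> * 2 powr (- \<epsilon> * of_int (k - j))"
        using C unfolding powr_mult powr_powr by (simp only: mult.commute[of \<epsilon>] mult_minus_left)
      finally have "C * (2 powi j * d z y) powr \<epsilon> / V j x \<le> C * (C powr \<epsilon> * 2 powr (- \<epsilon> * of_int (k - j))) / V j x"
        using C V_pos[of j x] by (intro divide_right_mono mult_left_mono) auto
      then have "norm (K x z - K x y) \<le> C * C powr \<epsilon> * 2 powr (- \<epsilon> * of_int (k - j)) / V j x"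
        using hoelder_kernelD(5)[OF K, of x z y] by (simp add: mult.assoc)
      then show ?thesis by (intro mult_right_mono) auto
    qed (simp add: hoelder_kernelD(1)[OF L])
    then show "ennreal (norm ((K x z - K x y) * L z y))
        \<le> ennreal (C * C powr \<epsilon> * 2 powr (- \<epsilon> * of_int (k - j)) / V j x) * ennreal (norm (L z y))"
      using C V_pos[of j x] by (simp add: norm_mult ennreal_mult[symmetric] ennreal_leI)
  qed
  also have "\<dots> \<le> ennreal (C * C powr \<epsilon> * 2 powr (- \<epsilon> * of_int (k - j)) / V j x) * ennreal (C * avg_norm C)"
    using hoelder_kernel_columns[OF L C, of y] hoelder_kernel_integrable(2)[OF L C]
    by (subst nn_integral_cmult) (auto intro!: mult_left_mono)
  also have "\<dots> = ennreal (composition_const C * 2 powr (- \<epsilon> * of_int (k - j)) * ball_avg (2 * A\<^sub>0 * C) j x y)"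
    using True C V_pos[of j x] avg_norm_ge_1[of C]
    by (subst ennreal_mult[symmetric]) (auto simp: composition_const_def ball_avg_def)
  finally show ?thesis
    using C avg_norm_ge_1[of C] ball_avg_nonneg[of "2 * A\<^sub>0 * C" j x y]
    by (subst (asm) ennreal_le_iff) (auto simp: composition_const_def)
qed

text \<open>If \<open>K\<close> is the finer kernel, transposition exchanges the roles of the two factors.\<close>

lemma kernel_comp_bound:
  assumes K: "hoelder_kernel C j K" "cancelling K" and L: "hoelder_kernel C k L" "cancelling L"
    and C: "1 \<le> C"
  shows "norm (kernel_comp K L x y)
           \<le> composition_const C * ball_ratio (2 * A\<^sub>0 * C) * 2 powr (- \<epsilon> * of_int \<bar>j - k\<bar>) * ball_avg (2 * A\<^sub>0 * C) (min j k) x y"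
proof (cases "j \<le> k")
  case True
  have "norm (kernel_comp K L x y) \<le> composition_const C * 2 powr (- \<epsilon> * of_int (k - j)) * ball_avg (2 * A\<^sub>0 * C) j x y"
    using L by (intro kernel_comp_bound_le[OF K(1) L(1) C True]) (simp add: cancelling_def)
  also have "\<dots> = composition_const C * 1 * 2 powr (- \<epsilon> * of_int \<bar>j - k\<bar>) * ball_avg (2 * A\<^sub>0 * C) (min j k) x y"
    using True by simp
  also have "\<dots> \<le> composition_const C * ball_ratio (2 * A\<^sub>0 * C) * 2 powr (- \<epsilon> * of_int \<bar>j - k\<bar>) * ball_avg (2 * A\<^sub>0 * C) (min j k) x y"
    using C avg_norm_ge_1[of C]
    by (intro mult_right_mono mult_left_mono ball_ratio_ge_1 ball_avg_nonneg) (auto simp: composition_const_def)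
  finally show ?thesis .
next
  case False
  have "1 \<le> A\<^sub>0 * C" using mult_mono[of 1 A\<^sub>0 1 C] A0 C by simp
  then have c: "1 \<le> 2 * A\<^sub>0 * C" by simp
  have "kernel_comp K L x y = kernel_comp (\<lambda>x y. L y x) (\<lambda>x y. K y x) y x"
    by (simp add: kernel_comp_def mult.commute)
  also have "norm \<dots> \<le> composition_const C * 2 powr (- \<epsilon> * of_int (j - k)) * ball_avg (2 * A\<^sub>0 * C) k y x"
    by (rule kernel_comp_bound_le[OF hoelder_kernel_transpose[OF L(1)] hoelder_kernel_transpose[OF K(1)] C])
       (use K False in \<open>auto simp: cancelling_def\<close>)
  also have "\<dots> \<le> composition_const C * 2 powr (- \<epsilon> * of_int (j - k)) * (ball_ratio (2 * A\<^sub>0 * C) * ball_avg (2 * A\<^sub>0 * C) k x y)"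
    using C avg_norm_ge_1[of C] by (intro mult_left_mono ball_avg_swap[OF c]) (auto simp: composition_const_def)
  finally show ?thesis using False by (simp add: ac_simps)
qed

end

section \<open>Duality with test functions\<close>

lemma Lp_enorm_2: "Lp_enorm 2 M h = epowr (\<integral>\<^sup>+x. (h x)\<^sup>2 \<partial>M) (1 / 2)"
  using Lp_enorm_ennreal[of 2 M h] by (simp add: epowr_2)

lemma Lp_enorm_2_finite_iff: "Lp_enorm 2 M h < \<infinity> \<longleftrightarrow> (\<integral>\<^sup>+x. (h x)\<^sup>2 \<partial>M) < \<infinity>"
  by (cases "\<integral>\<^sup>+x. (h x)\<^sup>2 \<partial>M") (simp_all add: Lp_enorm_2 epowr_ennreal)

lemma nn_integral_mult_finite:
  assumes [measurable]: "f \<in> borel_measurable M" "h \<in> borel_measurable M"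
    and "(\<integral>\<^sup>+x. (f x)\<^sup>2 \<partial>M) < \<infinity>" "(\<integral>\<^sup>+x. (h x)\<^sup>2 \<partial>M) < \<infinity>"
  shows "(\<integral>\<^sup>+x. f x * h x \<partial>M) < \<infinity>"
proof -
  have "(\<integral>\<^sup>+x. f x * h x \<partial>M)\<^sup>2 \<le> (\<integral>\<^sup>+x. (f x)\<^sup>2 \<partial>M) * (\<integral>\<^sup>+x. (h x)\<^sup>2 \<partial>M)"
    by (rule Cauchy_Schwarz_nn_integral) fact+
  also have "\<dots> < \<infinity>" using assms(3,4) by (simp add: ennreal_mult_less_top)
  finally show ?thesis by (simp add: power_less_top_ennreal)
qed

lemma Lp_functions_2_iff:
  "g \<in> Lp_functions 2 M \<longleftrightarrow> g \<in> borel_measurable M \<and> (\<integral>\<^sup>+x. (ennreal (norm (g x)))\<^sup>2 \<partial>M) < \<infinity>"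
  unfolding Lp_functions_def Lp_norm_eq Lp_enorm_2_finite_iff by simp

context doubling_space
begin

text \<open>For every point \<open>x\<close>, the value at \<open>x\<close> of a chain of operators applied to \<open>f\<close> is the integral of \<open>f\<close> against a
function of this kind. Such functions are stable under the transposed operators, and they are regular
enough for the reproducing limit.\<close>

definition test_function :: "('a \<Rightarrow> complex) \<Rightarrow> bool" where
  "test_function r \<longleftrightarrow> r \<in> borel_measurable M \<and>
     (\<exists>B x\<^sub>0 R. (\<forall>x. norm (r x) \<le> B) \<and> (\<forall>x. R < d x\<^sub>0 x \<longrightarrow> r x = 0)) \<and>
     (\<exists>H. \<forall>x y. norm (r x - r y) \<le> H * d x y powr \<epsilon>)"

lemma test_functionE:
  assumes "test_function r"
  obtains B x\<^sub>0 R H where "r \<in> borel_measurable M" "0 \<le> B" "0 \<le> R" "0 \<le> H"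
    "\<And>x. norm (r x) \<le> B" "\<And>x. R < d x\<^sub>0 x \<Longrightarrow> r x = 0"
    "\<And>x y. norm (r x - r y) \<le> H * d x y powr \<epsilon>"
proof -
  obtain B x\<^sub>0 R H where *: "\<And>x. norm (r x) \<le> B" "\<And>x. R < d x\<^sub>0 x \<Longrightarrow> r x = 0"
      "\<And>x y. norm (r x - r y) \<le> H * d x y powr \<epsilon>"
    using assms unfolding test_function_def by blast
  show ?thesis
  proof (rule that[of "max 0 B" "max 0 R" "max 0 H" x\<^sub>0])
    fix x y
    have "H * d x y powr \<epsilon> \<le> max 0 H * d x y powr \<epsilon>" by (intro mult_right_mono) auto
    then show "norm (r x - r y) \<le> max 0 H * d x y powr \<epsilon>" using *(3)[of x y] by linarith
    show "norm (r x) \<le> max 0 B" using *(1)[of x] by linarith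
  qed (use assms *(2) in \<open>auto simp: test_function_def\<close>)
qed

lemma bounded_support_power_integrable:
  assumes [measurable]: "r \<in> borel_measurable M"
    and B: "\<And>x. norm (r x) \<le> B" and R: "\<And>x. R < d x\<^sub>0 x \<Longrightarrow> r x = 0"
    and n: "0 < n"
  shows "(\<integral>\<^sup>+x. (ennreal (norm (r x)))^n \<partial>M) < \<infinity>"
proof -
  have "(\<integral>\<^sup>+x. (ennreal (norm (r x)))^n \<partial>M) \<le> (\<integral>\<^sup>+x. ennreal (B ^ n) * indicator (qball d x\<^sub>0 (\<bar>R\<bar> + 1)) x \<partial>M)"
  proof (rule nn_integral_mono)
    fix x
    have "norm (r x) ^ n \<le> B ^ n" using B by (intro power_mono) auto
    moreover have "r x = 0" if "x \<notin> qball d x\<^sub>0 (\<bar>R\<bar> + 1)"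
      using that by (intro R) (auto simp: qball_def)
    ultimately show "(ennreal (norm (r x)))^n \<le> ennreal (B ^ n) * indicator (qball d x\<^sub>0 (\<bar>R\<bar> + 1)) x"
      using n by (auto simp: indicator_def ennreal_power intro!: ennreal_leI)
  qed
  also have "\<dots> < \<infinity>"
    using finite_balls[of "\<bar>R\<bar> + 1" x\<^sub>0] by (simp add: nn_integral_cmult_indicator ennreal_mult_less_top)
  finally show ?thesis .
qed

lemma test_function_integrable:
  assumes "test_function r"
  shows "integrable M r"
  using assms
proof (rule test_functionE)
  fix B x\<^sub>0 R assume "r \<in> borel_measurable M" "\<And>x. norm (r x) \<le> B" "\<And>x. R < d x\<^sub>0 x \<Longrightarrow> r x = 0"
  then show ?thesis
    using bounded_support_power_integrable[of r B R x\<^sub>0 1] by (intro integrableI_bounded) auto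
qed

lemma test_function_square_integrable:
  assumes "test_function r"
  shows "(\<integral>\<^sup>+x. (ennreal (norm (r x)))\<^sup>2 \<partial>M) < \<infinity>"
  using assms
proof (rule test_functionE)
  fix B x\<^sub>0 R assume "r \<in> borel_measurable M" "\<And>x. norm (r x) \<le> B" "\<And>x. R < d x\<^sub>0 x \<Longrightarrow> r x = 0"
  then show ?thesis
    using bounded_support_power_integrable[of r B R x\<^sub>0 2] by auto
qed

lemma test_function_mult_integrable:
  assumes r: "test_function r" and g: "g \<in> Lp_functions 2 M"
  shows "integrable M (\<lambda>x. r x * g x)"
proof (rule integrableI_bounded)
  have [measurable]: "r \<in> borel_measurable M" "g \<in> borel_measurable M"
    using r g by (auto simp: test_function_def Lp_functions_def)
  show "(\<lambda>x. r x * g x) \<in> borel_measurable M" by measurable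
  have "(\<integral>\<^sup>+x. ennreal (norm (r x)) * ennreal (norm (g x)) \<partial>M) < \<infinity>"
    using test_function_square_integrable[OF r] g
    by (intro nn_integral_mult_finite) (auto simp: Lp_functions_2_iff)
  then show "(\<integral>\<^sup>+x. ennreal (norm (r x * g x)) \<partial>M) < \<infinity>"
    by (simp add: norm_mult ennreal_mult)
qed

text \<open>Fubini's theorem applies because \<open>r\<close> and \<open>|L| |g|\<close> are square integrable.\<close>

lemma integral_mult_int_op:
  assumes r: "test_function r" and c: "1 \<le> c" and b: "0 \<le> b"
    and L [measurable]: "case_prod L \<in> borel_measurable (M \<Otimes>\<^sub>M M)"
    and bound: "\<And>x y. norm (L x y) \<le> b * ball_avg c k x y"
    and g: "g \<in> Lp_functions 2 M"
  shows "(LINT z|M. r z * int_op M L g z) = (LINT y|M. (LINT z|M. r z * L z y) * g y)"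
proof -
  have [measurable]: "r \<in> borel_measurable M" "g \<in> borel_measurable M"
    using r g by (auto simp: test_function_def Lp_functions_def)
  define h where "h z = (\<integral>\<^sup>+y. ennreal (norm (L z y) * norm (g y)) \<partial>M)" for z
  have [measurable]: "h \<in> borel_measurable M" unfolding h_def by measurable
  have "Lp_enorm 2 M h \<le> ennreal (b * avg_norm c) * Lp_norm 2 M g"
    unfolding h_def by (rule Lp_norm_int_op(1)[OF _ c b L _ bound]) auto
  also have "\<dots> < \<infinity>" using g by (simp add: Lp_functions_def ennreal_mult_less_top)
  finally have "(\<integral>\<^sup>+z. (h z)\<^sup>2 \<partial>M) < \<infinity>" by (simp only: Lp_enorm_2_finite_iff)
  then have fin: "(\<integral>\<^sup>+z. ennreal (norm (r z)) * h z \<partial>M) < \<infinity>"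
    using test_function_square_integrable[OF r] by (intro nn_integral_mult_finite) auto
  have "integrable (M \<Otimes>\<^sub>M M) (\<lambda>(z, y). r z * L z y * g y)"
  proof (rule integrableI_bounded)
    have "(\<integral>\<^sup>+w. ennreal (norm (case w of (z, y) \<Rightarrow> r z * L z y * g y)) \<partial>(M \<Otimes>\<^sub>M M))
        = (\<integral>\<^sup>+z. \<integral>\<^sup>+y. ennreal (norm (r z * L z y * g y)) \<partial>M \<partial>M)"
      by (subst nn_integral_fst[symmetric]) auto
    also have "\<dots> = (\<integral>\<^sup>+z. ennreal (norm (r z)) * h z \<partial>M)"
      unfolding h_def by (subst nn_integral_cmult[symmetric])
        (auto intro!: nn_integral_cong simp: norm_mult ennreal_mult mult.assoc)
    finally show "(\<integral>\<^sup>+w. ennreal (norm (case w of (z, y) \<Rightarrow> r z * L z y * g y)) \<partial>(M \<Otimes>\<^sub>M M)) < \<infinity>"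
      using fin by simp
  qed measurable
  from MM.Fubini_integral[OF this]
  have "(LINT y|M. (LINT z|M. r z * L z y * g y)) = (LINT z|M. (LINT y|M. r z * (L z y * g y)))"
    by (simp add: mult.assoc)
  then show ?thesis
    unfolding int_op_def by (simp only: integral_mult_right_zero integral_mult_left_zero)
qed

lemma hoelder_kernel_row_test:
  assumes K: "hoelder_kernel C k K" and C: "0 \<le> C"
  shows "test_function (\<lambda>y. K x y)"
  unfolding test_function_def
proof (intro conjI)
  have [measurable]: "case_prod K \<in> borel_measurable (M \<Otimes>\<^sub>M M)"
    by (rule hoelder_kernel_measurable[OF K C])
  show "(\<lambda>y. K x y) \<in> borel_measurable M" by measurable
  show "\<exists>B x\<^sub>0 R. (\<forall>y. norm (K x y) \<le> B) \<and> (\<forall>y. R < d x\<^sub>0 y \<longrightarrow> K x y = 0)"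
    using hoelder_kernelD(1,2)[OF K] by blast
  have "norm (K x y - K x y') \<le> C * (2 powi k) powr \<epsilon> / V k x * d y y' powr \<epsilon>" for y y'
    using hoelder_kernelD(5)[OF K, of x y y'] d_nonneg[of y y'] by (simp add: powr_mult)
  then show "\<exists>H. \<forall>y y'. norm (K x y - K x y') \<le> H * d y y' powr \<epsilon>" by blast
qed

text \<open>Volumes at a fixed scale are bounded below on bounded sets, so that the factors \<open>1 / V k z\<close> in the kernel
estimates are harmless on the support of a test function.\<close>

lemma V_local_bound: "\<exists>v>0. \<forall>z. d x\<^sub>0 z \<le> R \<longrightarrow> v \<le> V k z"
proof (intro exI conjI allI impI)
  define c where "c = max 1 (R / radius k)"
  show "0 < V k x\<^sub>0 / ball_ratio c"
    using V_pos[of k x\<^sub>0] ball_ratio_ge_1[of c] by simp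
  fix z assume "d x\<^sub>0 z \<le> R"
  also have "R = R / radius k * radius k" by simp
  also have "\<dots> \<le> c * radius k" unfolding c_def by (intro mult_right_mono) auto
  finally have "V k x\<^sub>0 \<le> ball_ratio c * V k z" by (intro V_compare) (auto simp: c_def)
  then show "V k x\<^sub>0 / ball_ratio c \<le> V k z"
    using ball_ratio_ge_1[of c] by (simp add: field_simps)
qed

lemma norm_integral_mult_le:
  fixes r F :: "'a \<Rightarrow> complex"
  assumes r: "integrable M r" and F: "\<And>z. r z \<noteq> 0 \<Longrightarrow> norm (F z) \<le> b" and b: "0 \<le> b"
  shows "norm (LINT z|M. r z * F z) \<le> (LINT z|M. norm (r z)) * b"
proof -
  have "ennreal (norm (LINT z|M. r z * F z)) \<le> (\<integral>\<^sup>+z. ennreal (norm (r z * F z)) \<partial>M)"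
    by (rule ennreal_norm_integral_le)
  also have "\<dots> \<le> (\<integral>\<^sup>+z. ennreal (norm (r z) * b) \<partial>M)"
  proof (intro nn_integral_mono ennreal_leI)
    fix z show "norm (r z * F z) \<le> norm (r z) * b"
      using F[of z] by (cases "r z = 0") (auto simp: norm_mult intro: mult_left_mono)
  qed
  also have "\<dots> = ennreal ((LINT z|M. norm (r z)) * b)"
    using r b by (subst nn_integral_eq_integral) auto
  finally show ?thesis using b by (subst (asm) ennreal_le_iff) auto
qed

lemma test_function_step:
  assumes r: "test_function r" and K: "hoelder_kernel C k K" and C: "1 \<le> C"
  shows "test_function (\<lambda>y. LINT z|M. r z * K z y)"
  using r
proof (rule test_functionE)
  fix B x\<^sub>0 R H assume [measurable]: "r \<in> borel_measurable M"
    and r: "0 \<le> B" "0 \<le> R" "0 \<le> H" "\<And>x. norm (r x) \<le> B" "\<And>x. R < d x\<^sub>0 x \<Longrightarrow> r x = 0"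
      "\<And>x y. norm (r x - r y) \<le> H * d x y powr \<epsilon>"
  have [measurable]: "case_prod K \<in> borel_measurable (M \<Otimes>\<^sub>M M)"
    using hoelder_kernel_measurable[OF K] C by simp
  have int_r: "integrable M r" by (rule test_function_integrable) fact
  obtain v where v: "0 < v" "\<And>z. d x\<^sub>0 z \<le> R \<Longrightarrow> v \<le> V k z"
    using V_local_bound[of x\<^sub>0 R k] by blast
  have inv: "a / V k z \<le> a / v" if "r z \<noteq> 0" "0 \<le> a" for z a
  proof -
    have "v \<le> V k z" using that r(5)[of z] by (intro v) (auto simp: not_less[symmetric])
    then show ?thesis using v(1) that V_pos[of k z] by (intro divide_left_mono) auto
  qed
  show ?thesis
    unfolding test_function_def
  proof (intro conjI exI allI impI)
    show "(\<lambda>y. LINT z|M. r z * K z y) \<in> borel_measurable M" by measurable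
    show "norm (LINT z|M. r z * K z y) \<le> (LINT z|M. norm (r z)) * (C / v)" for y
    proof (rule norm_integral_mult_le[OF int_r])
      show "norm (K z y) \<le> C / v" if "r z \<noteq> 0" for z
        using inv[OF that, of C] hoelder_kernelD(2)[OF K, of z y] C by linarith
    qed (use C v in auto)
    show "(LINT z|M. r z * K z y) = 0" if y: "A\<^sub>0 * (R + C * radius k) < d x\<^sub>0 y" for y
    proof -
      have "r z * K z y = 0" for z
      proof (rule ccontr)
        assume "r z * K z y \<noteq> 0"
        then have "d x\<^sub>0 z \<le> R" "d z y \<le> C * radius k"
          using r(5)[of z] hoelder_kernelD(1)[OF K, of z y] by (auto simp: not_less[symmetric])
        then have "A\<^sub>0 * (d x\<^sub>0 z + d z y) \<le> A\<^sub>0 * (R + C * radius k)"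
          using A0 by (intro mult_left_mono add_mono) auto
        then show False using d_triangle[of x\<^sub>0 y z] y by linarith
      qed
      then show ?thesis by (simp only: integral_zero)
    qed
    fix y y'
    define a where "a = C * (2 powi k * d y y') powr \<epsilon>"
    have a: "0 \<le> a" using C by (simp add: a_def)
    have int: "integrable M (\<lambda>z. r z * K z u)" for u
    proof (rule Bochner_Integration.integrable_bound[of M "\<lambda>z. of_real (C / v) * r z"])
      show "AE z in M. norm (r z * K z u) \<le> norm (of_real (C / v) * r z)"
      proof (rule AE_I2)
        fix z
        have "norm (K z u) * norm (r z) \<le> \<bar>C / v\<bar> * norm (r z)"
        proof (cases "r z = 0")
          case False
          have "norm (K z u) \<le> \<bar>C / v\<bar>"
            using inv[OF False, of C] hoelder_kernelD(2)[OF K, of z u] C by linarith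
          then show ?thesis by (rule mult_right_mono) simp
        qed simp
        then show "norm (r z * K z u) \<le> norm (of_real (C / v) * r z)"
          by (simp only: norm_mult norm_of_real mult.commute[of "norm (r z)"])
      qed
    qed (use int_r in \<open>auto intro!: integrable_mult_right\<close>)
    have "(LINT z|M. r z * K z y) - (LINT z|M. r z * K z y') = (LINT z|M. r z * (K z y - K z y'))"
      using int by (simp add: right_diff_distrib)
    also have "norm \<dots> \<le> (LINT z|M. norm (r z)) * (a / v)"
    proof (rule norm_integral_mult_le[OF int_r])
      show "norm (K z y - K z y') \<le> a / v" if "r z \<noteq> 0" for z
        using inv[OF that a] hoelder_kernelD(5)[OF K, of z y y'] by (simp add: a_def)
    qed (use a v in auto)
    finally show "norm ((LINT z|M. r z * K z y) - (LINT z|M. r z * K z y'))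
        \<le> (LINT z|M. norm (r z)) * (C * (2 powi k) powr \<epsilon> / v) * d y y' powr \<epsilon>"
      using d_nonneg[of y y'] by (simp add: a_def powr_mult)
  qed
qed

end

section \<open>Approximations to the identity and the reproducing limit\<close>

context doubling_space
begin

text \<open>The constant is an argument, in order that two families can be given the same one.\<close>

definition unit_kernels :: "real \<Rightarrow> (int \<Rightarrow> 'a \<Rightarrow> 'a \<Rightarrow> complex) \<Rightarrow> bool" where
  "unit_kernels C S \<longleftrightarrow> 1 \<le> C \<and> (\<forall>k. hoelder_kernel C k (S k)) \<and>
     (\<forall>k y. (LINT x|M. S k x y) = 1) \<and> (\<forall>k x. (LINT y|M. S k x y) = 1)"

lemma unit_kernels_mono:
  assumes "unit_kernels C S" "C \<le> C'"
  shows "unit_kernels C' S"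
  using assms hoelder_kernel_mono[OF _ \<open>C \<le> C'\<close>] by (auto simp: unit_kernels_def)

text \<open>For points further apart than the distance up to which the Hoelder estimates are given, \<open>2\<^sup>k d x x'\<close>
exceeds a constant, and the size estimate is enough.\<close>

lemma approx_identity_imp_unit_kernels:
  assumes "approx_identity M d \<epsilon> S"
  shows "\<exists>C. unit_kernels C S"
proof -
  obtain C where C: "0 < C"
    and supp: "\<And>k x y. C * radius k < d x y \<Longrightarrow> S k x y = 0"
    and size: "\<And>k x y. norm (S k x y) \<le> C / (V k x + V k y)"
    and hoelder1: "\<And>k x x' y. d x x' \<le> C * radius k \<Longrightarrow>
        norm (S k x y - S k x' y) \<le> C * (2 powi k * d x x') powr \<epsilon> / (V k x + V k y)"
    and hoelder2: "\<And>k x y y'. d y y' \<le> C * radius k \<Longrightarrow>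
        norm (S k x y - S k x y') \<le> C * (2 powi k * d y y') powr \<epsilon> / (V k x + V k y)"
    and unit: "\<And>k y. (LINT x|M. S k x y) = 1" "\<And>k x. (LINT y|M. S k x y) = 1"
    using assms unfolding approx_identity_def by metis
  define C' where "C' = max 1 (max C (2 * C * C powr (- \<epsilon>)))"
  have C': "1 \<le> C'" "C \<le> C'" "2 * C * C powr (- \<epsilon>) \<le> C'" by (auto simp: C'_def)
  have shrink: "a / (V k x + V k y) \<le> a / V k x" "a / (V k x + V k y) \<le> a / V k y" if "0 \<le> a" for a k x y
    using that V_pos[of k x] V_pos[of k y] by (auto intro!: divide_left_mono)
  have grow: "C * a / V k x \<le> C' * a / V k x" if "0 \<le> a" for a k x
    using that V_pos[of k x] C'(2) by (intro divide_right_mono mult_right_mono) auto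
  have far: "2 * C / V k z \<le> C' * (2 powi k * t) powr \<epsilon> / V k z" if t: "C * radius k < t" for k t z
  proof -
    have "C = 2 powi k * (C * radius k)"
      by (simp add: power_int_minus)
    also have "\<dots> \<le> 2 powi k * t" using t by (intro mult_left_mono) auto
    finally have "C powr \<epsilon> \<le> (2 powi k * t) powr \<epsilon>" using C eps by (intro powr_mono2) auto
    then have "2 * C * C powr (- \<epsilon>) * C powr \<epsilon> \<le> C' * (2 powi k * t) powr \<epsilon>"
      using C' by (intro mult_mono) auto
    moreover have "C powr (- \<epsilon>) * C powr \<epsilon> = 1" using C by (simp add: powr_add[symmetric])
    ultimately show ?thesis
      using V_pos[of k z] by (intro divide_right_mono) (auto simp: mult.assoc)
  qed
  have "hoelder_kernel C' k (S k)" for k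
    unfolding hoelder_kernel_def
  proof (intro conjI allI impI)
    fix x x' y y'
    show "S k x y = 0" if "C' * radius k < d x y"
    proof (rule supp)
      have "C * radius k \<le> C' * radius k" using C' by (intro mult_right_mono) auto
      with that show "C * radius k < d x y" by linarith
    qed
    show "norm (S k x y) \<le> C' / V k x" "norm (S k x y) \<le> C' / V k y"
      using size[of k x y] shrink[of C k x y] grow[of 1 k x] grow[of 1 k y] C by auto
    show "norm (S k x y - S k x' y) \<le> C' * (2 powi k * d x x') powr \<epsilon> / V k y"
    proof (cases "d x x' \<le> C * radius k")
      case True
      then show ?thesis
        using hoelder1[OF True, of y] shrink(2)[of "C * (2 powi k * d x x') powr \<epsilon>" k x y]
          grow[of "(2 powi k * d x x') powr \<epsilon>" k y] C by auto
    next
      case False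
      have "norm (S k x y - S k x' y) \<le> 2 * C / V k y"
        using size[of k x y] size[of k x' y] shrink(2)[of C k x y] shrink(2)[of C k x' y] C
          norm_triangle_ineq4[of "S k x y" "S k x' y"] by auto
      then show ?thesis using far[of k "d x x'" y] False by auto
    qed
    show "norm (S k x y - S k x y') \<le> C' * (2 powi k * d y y') powr \<epsilon> / V k x"
    proof (cases "d y y' \<le> C * radius k")
      case True
      then show ?thesis
        using hoelder2[OF True, of x] shrink(1)[of "C * (2 powi k * d y y') powr \<epsilon>" k x y]
          grow[of "(2 powi k * d y y') powr \<epsilon>" k x] C by auto
    next
      case False
      have "norm (S k x y - S k x y') \<le> 2 * C / V k x"
        using size[of k x y] size[of k x y'] shrink(1)[of C k x y] shrink(1)[of C k x y'] C
          norm_triangle_ineq4[of "S k x y" "S k x y'"] by auto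
      then show ?thesis using far[of k "d y y'" x] False by auto
    qed
  qed
  then show ?thesis using C' unit by (auto simp: unit_kernels_def)
qed

definition differences :: "(int \<Rightarrow> 'a \<Rightarrow> 'a \<Rightarrow> complex) \<Rightarrow> int \<Rightarrow> 'a \<Rightarrow> 'a \<Rightarrow> complex" where
  "differences S k x y = S k x y - S (k - 1) x y"

lemma differences_hoelder_kernel:
  assumes "unit_kernels C S"
  shows "hoelder_kernel (2 * C) k (differences S k)"
  using assms unfolding differences_def[abs_def] unit_kernels_def by (intro hoelder_kernel_diff) auto

lemma differences_cancelling:
  assumes S: "unit_kernels C S"
  shows "cancelling (differences S k)"
proof -
  have "hoelder_kernel C k (S k)" "1 \<le> C" for k using S by (auto simp: unit_kernels_def)
  note hoelder_kernel_integrable[OF this]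
  then show ?thesis using S by (simp add: cancelling_def differences_def unit_kernels_def)
qed

lemma Lp_functions_hoelder_kernel:
  assumes K: "hoelder_kernel C k K" and C: "1 \<le> C" and p: "1 \<le> p" and g: "g \<in> Lp_functions p M"
  shows "int_op M K g \<in> Lp_functions p M"
  using C by (intro Lp_functions_int_op[OF p C _ hoelder_kernel_measurable[OF K] g hoelder_kernel_le_ball_avg[OF K]]) auto

lemma integral_mult_hoelder_kernel:
  assumes r: "test_function r" and K: "hoelder_kernel C k K" and C: "1 \<le> C" and g: "g \<in> Lp_functions 2 M"
  shows "(LINT z|M. r z * int_op M K g z) = (LINT y|M. (LINT z|M. r z * K z y) * g y)"
  using C by (intro integral_mult_int_op[OF r C _ hoelder_kernel_measurable[OF K] hoelder_kernel_le_ball_avg[OF K] g]) auto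

lemma int_op_differences:
  assumes S: "unit_kernels C S" and f: "f \<in> Lp_functions 2 M"
  shows "int_op M (differences S k) f = diff_op M S k f"
proof
  fix x
  have "integrable M (\<lambda>y. S k x y * f y)" for k
    using S by (intro test_function_mult_integrable[OF hoelder_kernel_row_test f]) (auto simp: unit_kernels_def)
  then show "int_op M (differences S k) f x = diff_op M S k f x"
    by (simp add: int_op_def diff_op_def differences_def left_diff_distrib)
qed

text \<open>By duality the operator acts on the test function: as its columns have integral one, the transposed
operator changes \<open>r\<close> by at most its oscillation over distances \<open>C 2\<^sup>-\<^sup>n\<close>. The result is supported in a ball
that does not depend on \<open>n\<close>, and \<open>f\<close> is integrable there.\<close>

lemma unit_kernels_fine_limit:
  assumes S: "unit_kernels C S" and r: "test_function r" and f: "f \<in> Lp_functions 2 M"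
  shows "(\<lambda>n. LINT z|M. r z * int_op M (S (int n)) f z) \<longlonglongrightarrow> (LINT y|M. r y * f y)"
  using r
proof (rule test_functionE)
  fix B x\<^sub>0 R H assume [measurable]: "r \<in> borel_measurable M"
    and B: "0 \<le> B" "0 \<le> R" "0 \<le> H" "\<And>x. norm (r x) \<le> B" "\<And>x. R < d x\<^sub>0 x \<Longrightarrow> r x = 0"
      "\<And>x y. norm (r x - r y) \<le> H * d x y powr \<epsilon>"
  have K: "hoelder_kernel C k (S k)" and C: "1 \<le> C" and unit: "(LINT x|M. S k x y) = 1" for k y
    using S by (auto simp: unit_kernels_def)
  have Km [measurable]: "case_prod (S k) \<in> borel_measurable (M \<Otimes>\<^sub>M M)" for k
    using C by (intro hoelder_kernel_measurable[OF K]) auto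
  have [measurable]: "f \<in> borel_measurable M" using f by (simp add: Lp_functions_def)
  define r' where "r' k y = (LINT z|M. r z * S k z y)" for k y
  have r': "test_function (r' k)" for k
    unfolding r'_def[abs_def] by (rule test_function_step[OF r K C])
  define T where "T = A\<^sub>0 * (R + C) + 1"
  have T: "A\<^sub>0 * (R + C) < T" "0 < T" using A0 B C by (auto simp: T_def intro!: add_nonneg_pos)
  define e where "e n = H * (C * radius (int n)) powr \<epsilon> * (C * avg_norm C)" for n
  have e0: "0 \<le> e n" for n using B C avg_norm_ge_1[of C] by (simp add: e_def)
  have diff: "r' k y - r y = (LINT z|M. (r z - r y) * S k z y)" for k y
  proof -
    have "integrable M (\<lambda>z. r z * S k z y)"
    proof (rule Bochner_Integration.integrable_bound[of M "\<lambda>z. of_real B * S k z y"])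
      show "AE z in M. norm (r z * S k z y) \<le> norm (of_real B * S k z y)"
        using B by (auto simp: norm_mult intro!: AE_I2 mult_right_mono)
    qed (auto intro!: integrable_mult_right hoelder_kernel_integrable[OF K C])
    moreover have "integrable M (\<lambda>z. r y * S k z y)"
      by (intro integrable_mult_right hoelder_kernel_integrable[OF K C])
    ultimately show ?thesis by (simp add: r'_def left_diff_distrib unit)
  qed
  have close: "norm (r' (int n) y - r y) \<le> e n" for n y
  proof -
    have "ennreal (norm (r' (int n) y - r y)) \<le> (\<integral>\<^sup>+z. ennreal (norm ((r z - r y) * S (int n) z y)) \<partial>M)"
      unfolding diff by (rule ennreal_norm_integral_le)
    also have "\<dots> \<le> (\<integral>\<^sup>+z. ennreal (H * (C * radius (int n)) powr \<epsilon>) * ennreal (norm (S (int n) z y)) \<partial>M)"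
    proof (rule nn_integral_mono)
      fix z
      have "norm (r z - r y) * norm (S (int n) z y) \<le> H * (C * radius (int n)) powr \<epsilon> * norm (S (int n) z y)"
      proof (cases "C * radius (int n) < d z y")
        case False
        have "norm (r z - r y) \<le> H * d z y powr \<epsilon>" by (rule B)
        also have "\<dots> \<le> H * (C * radius (int n)) powr \<epsilon>"
          using False B eps d_nonneg[of z y] by (intro mult_left_mono powr_mono2) auto
        finally show ?thesis by (intro mult_right_mono) auto
      qed (simp add: hoelder_kernelD(1)[OF K])
      then show "ennreal (norm ((r z - r y) * S (int n) z y))
          \<le> ennreal (H * (C * radius (int n)) powr \<epsilon>) * ennreal (norm (S (int n) z y))"
        using B by (simp add: norm_mult ennreal_mult[symmetric] ennreal_leI)
    qed
    also have "\<dots> \<le> ennreal (H * (C * radius (int n)) powr \<epsilon>) * ennreal (C * avg_norm C)"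
      using hoelder_kernel_columns[OF K C] by (subst nn_integral_cmult) (auto intro!: mult_left_mono)
    also have "\<dots> = ennreal (e n)"
      using B C avg_norm_ge_1[of C] by (simp add: e_def ennreal_mult[symmetric])
    finally show ?thesis using e0 by simp
  qed
  have far: "r' (int n) y - r y = 0" if y: "T \<le> d x\<^sub>0 y" for n y
  proof -
    have "(r z - r y) * S (int n) z y = 0" for z
    proof (rule ccontr)
      assume nz: "(r z - r y) * S (int n) z y \<noteq> 0"
      have "1 * R \<le> A\<^sub>0 * (R + C)" using A0 B C by (intro mult_mono) auto
      then have "r y = 0" using y T by (intro B(5)) auto
      then have "d x\<^sub>0 z \<le> R" "d z y \<le> C * radius (int n)"
        using nz B(5)[of z] hoelder_kernelD(1)[OF K, of "int n" z y] by (auto simp: not_less[symmetric])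
      moreover have "C * radius (int n) \<le> C * radius 0"
        using C radius_mono[of 0 "int n"] by (intro mult_left_mono) auto
      ultimately have "A\<^sub>0 * (d x\<^sub>0 z + d z y) \<le> A\<^sub>0 * (R + C)"
        using A0 by (intro mult_left_mono add_mono) auto
      then show False using d_triangle[of x\<^sub>0 y z] y T by linarith
    qed
    then show ?thesis unfolding diff by (simp only: integral_zero)
  qed
  define W where "W = (\<integral>\<^sup>+y. indicator (qball d x\<^sub>0 T) y * ennreal (norm (f y)) \<partial>M)"
  have "(\<integral>\<^sup>+y. (indicator (qball d x\<^sub>0 T) y :: ennreal)\<^sup>2 \<partial>M) = (\<integral>\<^sup>+y. indicator (qball d x\<^sub>0 T) y \<partial>M)"
    by (intro nn_integral_cong) (simp add: indicator_def)
  then have W: "W < \<infinity>"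
    unfolding W_def using f finite_balls[OF T(2), of x\<^sub>0]
    by (intro nn_integral_mult_finite) (auto simp: Lp_functions_2_iff)
  have bound: "norm ((LINT z|M. r z * int_op M (S (int n)) f z) - (LINT y|M. r y * f y)) \<le> e n * enn2real W" for n
  proof -
    have "(LINT z|M. r z * int_op M (S (int n)) f z) - (LINT y|M. r y * f y) = (LINT y|M. (r' (int n) y - r y) * f y)"
      unfolding integral_mult_hoelder_kernel[OF r K C f] r'_def[symmetric]
      using test_function_mult_integrable[OF r f] test_function_mult_integrable[OF r' f, of "int n"]
      by (simp add: left_diff_distrib)
    then have "ennreal (norm ((LINT z|M. r z * int_op M (S (int n)) f z) - (LINT y|M. r y * f y)))
        \<le> (\<integral>\<^sup>+y. ennreal (norm ((r' (int n) y - r y) * f y)) \<partial>M)"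
      by (simp only: ennreal_norm_integral_le)
    also have "\<dots> \<le> (\<integral>\<^sup>+y. ennreal (e n) * (indicator (qball d x\<^sub>0 T) y * ennreal (norm (f y))) \<partial>M)"
    proof (rule nn_integral_mono)
      fix y
      show "ennreal (norm ((r' (int n) y - r y) * f y)) \<le> ennreal (e n) * (indicator (qball d x\<^sub>0 T) y * ennreal (norm (f y)))"
      proof (cases "d x\<^sub>0 y < T")
        case True
        have "norm (r' (int n) y - r y) * norm (f y) \<le> e n * norm (f y)"
          by (intro mult_right_mono close) auto
        then show ?thesis using True e0 by (simp add: qball_def norm_mult ennreal_mult[symmetric] ennreal_leI)
      qed (use far in auto)
    qed
    also have "\<dots> = ennreal (e n) * W" unfolding W_def by (intro nn_integral_cmult) measurable
    also have "\<dots> = ennreal (e n * enn2real W)" using W e0 by (simp add: ennreal_mult less_top)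
    finally show ?thesis using e0 by simp
  qed
  have "(\<lambda>n. radius (int n)) \<longlonglongrightarrow> 0"
    using LIMSEQ_inverse_realpow_zero[of 2] by (simp add: power_int_minus)
  then have "(\<lambda>n. C * radius (int n)) \<longlonglongrightarrow> 0" by (rule tendsto_mult_right_zero)
  then have "(\<lambda>n. (C * radius (int n)) powr \<epsilon>) \<longlonglongrightarrow> 0"
    using eps C by (intro tendsto_zero_powrI[OF _ tendsto_const]) auto
  then have "(\<lambda>n. (C * radius (int n)) powr \<epsilon> * (H * (C * avg_norm C) * enn2real W)) \<longlonglongrightarrow> 0"
    by (rule tendsto_mult_left_zero)
  then have "(\<lambda>n. e n * enn2real W) \<longlonglongrightarrow> 0" by (simp add: e_def ac_simps)
  then have "(\<lambda>n. (LINT z|M. r z * int_op M (S (int n)) f z) - (LINT y|M. r y * f y)) \<longlonglongrightarrow> 0"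
    by (rule Lim_null_comparison[rotated]) (use bound in auto)
  then show ?thesis by (simp only: Lim_null[symmetric])
qed

lemma V_at_infinity: "filterlim (\<lambda>n. V (- int n) x) at_top sequentially"
  unfolding filterlim_at_top
proof
  fix Z
  obtain m where m: "Z < measure M (qball d x (1 * 2 ^ m))" using measure_qball_unbounded[of 1 Z x] by auto
  have "Z \<le> V (- int n) x" if "m \<le> n" for n
    using V_antimono[of "- int n" "- int m" x] that m by (simp add: vol_def)
  then show "\<forall>\<^sub>F n in sequentially. Z \<le> V (- int n) x"
    unfolding eventually_sequentially by blast
qed

text \<open>The transposed operator spreads the mass of \<open>r\<close> over a ball whose volume tends to infinity: the
\<open>L\<^sup>1\<close> norm of the result stays bounded while its supremum tends to zero. Hence its \<open>L\<^sup>2\<close> norm tends to zero,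
and \<open>f\<close> is square integrable.\<close>

lemma unit_kernels_coarse_limit:
  assumes S: "unit_kernels C S" and r: "test_function r" and f: "f \<in> Lp_functions 2 M"
  shows "(\<lambda>n. LINT z|M. r z * int_op M (S (- int n)) f z) \<longlonglongrightarrow> 0"
  using r
proof (rule test_functionE)
  fix B x\<^sub>0 R H assume [measurable]: "r \<in> borel_measurable M"
    and B: "0 \<le> B" "0 \<le> R" "\<And>x. R < d x\<^sub>0 x \<Longrightarrow> r x = 0"
  have K: "hoelder_kernel C k (S k)" and C: "1 \<le> C" for k
    using S by (auto simp: unit_kernels_def)
  have Km [measurable]: "case_prod (S k) \<in> borel_measurable (M \<Otimes>\<^sub>M M)" for k
    using C by (intro hoelder_kernel_measurable[OF K]) auto
  have [measurable]: "f \<in> borel_measurable M" using f by (simp add: Lp_functions_def)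
  define r' where "r' n y = (LINT z|M. r z * S (- int n) z y)" for n y
  have r' [measurable]: "r' n \<in> borel_measurable M" for n unfolding r'_def by measurable
  have int_r: "integrable M r" by (rule test_function_integrable[OF r])
  define N where "N = (LINT z|M. norm (r z))"
  have N: "0 \<le> N" "(\<integral>\<^sup>+z. ennreal (norm (r z)) \<partial>M) = ennreal N"
    unfolding N_def using int_r by (auto intro!: nn_integral_eq_integral)
  define F where "F = enn2real (\<integral>\<^sup>+x. (ennreal (norm (f x)))\<^sup>2 \<partial>M)"
  have F: "0 \<le> F" "(\<integral>\<^sup>+x. (ennreal (norm (f x)))\<^sup>2 \<partial>M) = ennreal F"
    using f by (auto simp: F_def Lp_functions_2_iff less_top)
  define s where "s n = N * (C * ball_ratio 1 / V (- int n) x\<^sub>0)" for n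
  have s0: "0 \<le> s n" for n
    using N C ball_ratio_ge_1[of 1] V_pos[of "- int n" x\<^sub>0] by (simp add: s_def)
  define c where "c = N * (C * avg_norm C) * F"
  have L1: "(\<integral>\<^sup>+y. ennreal (norm (r' n y)) \<partial>M) \<le> ennreal (N * (C * avg_norm C))" for n
  proof -
    have "(\<integral>\<^sup>+y. ennreal (norm (r' n y)) \<partial>M) \<le> (\<integral>\<^sup>+y. \<integral>\<^sup>+z. ennreal (norm (r z * S (- int n) z y)) \<partial>M \<partial>M)"
      unfolding r'_def by (intro nn_integral_mono ennreal_norm_integral_le)
    also have "\<dots> = (\<integral>\<^sup>+z. \<integral>\<^sup>+y. ennreal (norm (r z * S (- int n) z y)) \<partial>M \<partial>M)"
      by (rule MM.Fubini') measurable
    also have "\<dots> = (\<integral>\<^sup>+z. ennreal (norm (r z)) * (\<integral>\<^sup>+y. ennreal (norm (S (- int n) z y)) \<partial>M) \<partial>M)"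
      by (subst nn_integral_cmult[symmetric]) (auto simp: norm_mult ennreal_mult)
    also have "\<dots> \<le> (\<integral>\<^sup>+z. ennreal (norm (r z)) * ennreal (C * avg_norm C) \<partial>M)"
      by (intro nn_integral_mono mult_left_mono hoelder_kernel_rows[OF K C]) auto
    also have "\<dots> = ennreal (N * (C * avg_norm C))"
      using N C avg_norm_ge_1[of C] by (simp add: nn_integral_multc ennreal_mult)
    finally show ?thesis .
  qed
  have sup: "norm (r' n y) \<le> s n" if n: "R \<le> 2 ^ n" for n y
    unfolding r'_def s_def N_def
  proof (rule norm_integral_mult_le[OF int_r])
    fix z assume "r z \<noteq> 0"
    then have "d x\<^sub>0 z \<le> R" using B(3)[of z] by (auto simp: not_less[symmetric])
    then have "V (- int n) x\<^sub>0 \<le> ball_ratio 1 * V (- int n) z"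
      using n by (intro V_compare) auto
    then have "C * (1 / V (- int n) z) \<le> C * (ball_ratio 1 / V (- int n) x\<^sub>0)"
      using C V_pos[of "- int n" z] V_pos[of "- int n" x\<^sub>0] by (intro mult_left_mono) (auto simp: field_simps)
    then show "norm (S (- int n) z y) \<le> C * ball_ratio 1 / V (- int n) x\<^sub>0"
      using hoelder_kernelD(2)[OF K, of "- int n" z y] by simp
  qed (use C V_pos[of "- int n" x\<^sub>0] ball_ratio_ge_1[of 1] in simp)
  have bound: "norm (LINT z|M. r z * int_op M (S (- int n)) f z) \<le> sqrt (s n * c)" if n: "R \<le> 2 ^ n" for n
  proof -
    have "(\<integral>\<^sup>+y. (ennreal (norm (r' n y)))\<^sup>2 \<partial>M) \<le> (\<integral>\<^sup>+y. ennreal (s n) * ennreal (norm (r' n y)) \<partial>M)"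
      unfolding power2_eq_square using sup[OF n] by (intro nn_integral_mono mult_right_mono ennreal_leI) auto
    also have "\<dots> \<le> ennreal (s n) * ennreal (N * (C * avg_norm C))"
      using L1 by (subst nn_integral_cmult) (auto intro!: mult_left_mono)
    finally have sq: "(\<integral>\<^sup>+y. (ennreal (norm (r' n y)))\<^sup>2 \<partial>M) \<le> ennreal (s n) * ennreal (N * (C * avg_norm C))" .
    have "ennreal (norm (LINT z|M. r z * int_op M (S (- int n)) f z)) \<le> (\<integral>\<^sup>+y. ennreal (norm (r' n y * f y)) \<partial>M)"
      unfolding integral_mult_hoelder_kernel[OF r K C f] r'_def[symmetric] by (rule ennreal_norm_integral_le)
    also have "\<dots> = (\<integral>\<^sup>+y. ennreal (norm (r' n y)) * ennreal (norm (f y)) \<partial>M)"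
      by (simp add: norm_mult ennreal_mult)
    finally have "(ennreal (norm (LINT z|M. r z * int_op M (S (- int n)) f z)))\<^sup>2
        \<le> (\<integral>\<^sup>+y. ennreal (norm (r' n y)) * ennreal (norm (f y)) \<partial>M)\<^sup>2"
      by (rule power_mono) simp
    also have "\<dots> \<le> (\<integral>\<^sup>+y. (ennreal (norm (r' n y)))\<^sup>2 \<partial>M) * (\<integral>\<^sup>+y. (ennreal (norm (f y)))\<^sup>2 \<partial>M)"
      by (rule Cauchy_Schwarz_nn_integral) measurable
    also have "\<dots> \<le> (ennreal (s n) * ennreal (N * (C * avg_norm C))) * ennreal F"
      using sq F by (intro mult_mono) auto
    also have "\<dots> = ennreal (s n * c)"
      using s0 N F C avg_norm_ge_1[of C] by (simp add: c_def ennreal_mult[symmetric] mult.assoc)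
    finally have "(norm (LINT z|M. r z * int_op M (S (- int n)) f z))\<^sup>2 \<le> s n * c"
      using s0 N F C avg_norm_ge_1[of C] by (simp add: ennreal_power c_def)
    then show ?thesis by (rule real_le_rsqrt)
  qed
  have "(\<lambda>n. N * (C * ball_ratio 1) * c / V (- int n) x\<^sub>0) \<longlonglongrightarrow> 0"
    by (rule tendsto_divide_0[OF tendsto_const]) (rule filterlim_at_top_imp_at_infinity[OF V_at_infinity])
  then have "(\<lambda>n. s n * c) \<longlonglongrightarrow> 0" by (simp add: s_def)
  then have "(\<lambda>n. sqrt (s n * c)) \<longlonglongrightarrow> 0" using tendsto_real_sqrt by fastforce
  moreover have "\<forall>\<^sub>F n in sequentially. R \<le> 2 ^ n"
  proof -
    obtain m where m: "R < 2 ^ m" using real_arch_pow[of 2 R] by auto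
    have "R \<le> 2 ^ n" if "m \<le> n" for n
      using m power_increasing[OF that, of "2::real"] by linarith
    then show ?thesis unfolding eventually_sequentially by blast
  qed
  then have "\<forall>\<^sub>F n in sequentially. norm (LINT z|M. r z * int_op M (S (- int n)) f z) \<le> sqrt (s n * c)"
    by eventually_elim (rule bound)
  ultimately show ?thesis
    by (rule Lim_null_comparison[rotated])
qed

lemma sum_telescope_symmetric:
  fixes \<phi> :: "int \<Rightarrow> 'b::ab_group_add"
  shows "(\<Sum>k\<in>{- int n..int n}. \<phi> k - \<phi> (k - 1)) = \<phi> (int n) - \<phi> (- int (Suc n))"
proof (induction n)
  case (Suc n)
  have "{- int (Suc n)..int (Suc n)} = insert (int (Suc n)) (insert (- int (Suc n)) {- int n..int n})"
    by auto
  then show ?case using Suc by (simp add: algebra_simps)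
qed simp

lemma reproducing_limit:
  assumes S: "unit_kernels C S" and r: "test_function r" and f: "f \<in> Lp_functions 2 M"
  shows "(\<lambda>n. \<Sum>k\<in>{- int n..int n}. LINT z|M. r z * int_op M (differences S k) f z)
           \<longlonglongrightarrow> (LINT y|M. r y * f y)"
proof -
  define \<phi> where "\<phi> k = (LINT z|M. r z * int_op M (S k) f z)" for k
  have K: "hoelder_kernel C k (S k)" and C: "1 \<le> C" for k
    using S by (auto simp: unit_kernels_def)
  have "(LINT z|M. r z * int_op M (differences S k) f z) = \<phi> k - \<phi> (k - 1)" for k
  proof -
    have "integrable M (\<lambda>z. r z * int_op M (S k) f z)" for k
      by (intro test_function_mult_integrable[OF r] Lp_functions_hoelder_kernel[OF K C _ f]) simp
    then show ?thesis
      by (simp add: int_op_differences[OF S f] diff_op_def right_diff_distrib \<phi>_def)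
  qed
  then have eq: "(\<Sum>k\<in>{- int n..int n}. LINT z|M. r z * int_op M (differences S k) f z)
      = \<phi> (int n) - \<phi> (- int (Suc n))" for n
    by (simp only: sum_telescope_symmetric)
  have "(\<lambda>n. \<phi> (int n) - \<phi> (- int (Suc n))) \<longlonglongrightarrow> (LINT y|M. r y * f y) - 0"
    unfolding \<phi>_def
    by (intro tendsto_diff unit_kernels_fine_limit[OF S r f] LIMSEQ_Suc[OF unit_kernels_coarse_limit[OF S r f]])
  then show ?thesis unfolding eq by simp
qed

end

section \<open>Chains of cancelling operators\<close>

definition geom_sum :: "real \<Rightarrow> real" where
  "geom_sum t = enn2real (\<integral>\<^sup>+k. ennreal (2 powr (- t * of_int \<bar>k\<bar>)) \<partial>count_space (UNIV :: int set))"

lemma sum_le_nn_integral_count_space: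
  assumes "finite A"
  shows "(\<Sum>k\<in>A. f k) \<le> (\<integral>\<^sup>+k. f k \<partial>count_space UNIV)"
proof -
  have "(\<Sum>k\<in>A. f k) = (\<integral>\<^sup>+k. f k * indicator A k \<partial>count_space UNIV)"
    using assms by (simp add: nn_integral_count_space_finite nn_integral_count_space_indicator[symmetric])
  also have "\<dots> \<le> (\<integral>\<^sup>+k. f k \<partial>count_space UNIV)"
    by (intro nn_integral_mono) (simp add: indicator_def)
  finally show ?thesis .
qed

lemma le_nn_integral_count_space: "f k \<le> (\<integral>\<^sup>+k. f k \<partial>count_space UNIV)"
  using sum_le_nn_integral_count_space[of "{k}" f] by simp

lemma nn_integral_geometric_finite:
  assumes t: "0 < t"
  shows "(\<integral>\<^sup>+k. ennreal (2 powr (- t * of_int \<bar>k\<bar>)) \<partial>count_space (UNIV :: int set)) < \<infinity>"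
proof -
  define x where "x = 2 powr (- t)"
  have x: "0 < x" "x < 1" using t powr_less_mono[of "- t" 0 2] by (simp_all add: x_def)
  have "(\<integral>\<^sup>+k. ennreal (2 powr (- t * of_int \<bar>k\<bar>)) \<partial>count_space (UNIV :: int set))
      \<le> (\<integral>\<^sup>+k. (\<integral>\<^sup>+n. ennreal (x ^ n) * indicator {int n, - int n} k \<partial>count_space UNIV) \<partial>count_space UNIV)"
  proof (rule nn_integral_mono)
    fix k :: int
    have "2 powr (- t * of_int \<bar>k\<bar>) = x ^ nat \<bar>k\<bar>"
      unfolding x_def by (subst powr_realpow[symmetric]) (simp_all add: powr_powr)
    then show "ennreal (2 powr (- t * of_int \<bar>k\<bar>)) \<le> (\<integral>\<^sup>+n. ennreal (x ^ n) * indicator {int n, - int n} k \<partial>count_space UNIV)"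
      using le_nn_integral_count_space[of "\<lambda>n. ennreal (x ^ n) * indicator {int n, - int n} k" "nat \<bar>k\<bar>"]
      by (auto simp: indicator_def abs_if split: if_splits)
  qed
  also have "\<dots> = (\<integral>\<^sup>+n. ennreal (x ^ n) * (\<integral>\<^sup>+k. indicator {int n, - int n} k \<partial>count_space UNIV) \<partial>count_space UNIV)"
    by (subst nn_integral_count_space_nn_integral) (auto simp: nn_integral_cmult)
  also have "\<dots> \<le> (\<integral>\<^sup>+n. ennreal (x ^ n) * 2 \<partial>count_space UNIV)"
    by (intro nn_integral_mono mult_left_mono) (auto simp: card_insert_if)
  also have "\<dots> = (\<Sum>n. ennreal (x ^ n)) * 2"
    by (simp add: nn_integral_multc nn_integral_count_space_nat)
  also have "(\<Sum>n. ennreal (x ^ n)) = ennreal (1 / (1 - x))"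
    using x by (intro suminf_ennreal_eq geometric_sums) auto
  finally show ?thesis
    by (rule le_less_trans) (simp add: ennreal_mult_less_top)
qed

lemma nn_integral_geometric:
  assumes t: "0 < t"
  shows "(\<integral>\<^sup>+k. ennreal (2 powr (- t * of_int \<bar>k - h\<bar>)) \<partial>count_space (UNIV :: int set)) = ennreal (geom_sum t)"
proof -
  have "bij_betw (\<lambda>k. k - h) UNIV UNIV"
    by (rule bij_betwI[where g="\<lambda>k. k + h"]) auto
  from nn_integral_bij_count_space[OF this, of "\<lambda>k. ennreal (2 powr (- t * of_int \<bar>k\<bar>))"]
  show ?thesis using nn_integral_geometric_finite[OF t] by (simp add: geom_sum_def less_top)
qed

lemma geom_sum_nonneg: "0 \<le> geom_sum t"
  by (simp add: geom_sum_def)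

lemma nn_integral_two_step:
  assumes t: "0 < t" "0 < t'" and c: "0 \<le> c"
  shows "(\<integral>\<^sup>+a. \<integral>\<^sup>+b. ennreal (c * 2 powr (- t * of_int \<bar>a - h\<bar>) * 2 powr (- t' * of_int \<bar>b - a\<bar>))
            \<partial>count_space UNIV \<partial>count_space (UNIV :: int set)) = ennreal (c * geom_sum t * geom_sum t')"
proof -
  have "(\<integral>\<^sup>+b. ennreal (c * 2 powr (- t * of_int \<bar>a - h\<bar>) * 2 powr (- t' * of_int \<bar>b - a\<bar>)) \<partial>count_space UNIV)
      = ennreal (c * geom_sum t') * ennreal (2 powr (- t * of_int \<bar>a - h\<bar>))" for a :: int
  proof -
    have "(\<integral>\<^sup>+b. ennreal (c * 2 powr (- t * of_int \<bar>a - h\<bar>) * 2 powr (- t' * of_int \<bar>b - a\<bar>)) \<partial>count_space UNIV)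
        = (\<integral>\<^sup>+b. ennreal (c * 2 powr (- t * of_int \<bar>a - h\<bar>)) * ennreal (2 powr (- t' * of_int \<bar>b - a\<bar>)) \<partial>count_space UNIV)"
      using c by (intro nn_integral_cong ennreal_mult) auto
    also have "\<dots> = ennreal (c * 2 powr (- t * of_int \<bar>a - h\<bar>)) * ennreal (geom_sum t')"
      by (subst nn_integral_cmult) (simp_all only: nn_integral_geometric[OF t(2)] borel_measurable_count_space)
    also have "\<dots> = ennreal (c * geom_sum t') * ennreal (2 powr (- t * of_int \<bar>a - h\<bar>))"
      using c geom_sum_nonneg[of t'] by (simp add: ennreal_mult ac_simps)
    finally show ?thesis .
  qed
  then have "(\<integral>\<^sup>+a. \<integral>\<^sup>+b. ennreal (c * 2 powr (- t * of_int \<bar>a - h\<bar>) * 2 powr (- t' * of_int \<bar>b - a\<bar>))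
            \<partial>count_space UNIV \<partial>count_space (UNIV :: int set)) = ennreal (c * geom_sum t') * ennreal (geom_sum t)"
    by (simp only: nn_integral_cmult nn_integral_geometric[OF t(1)] borel_measurable_count_space)
  then show ?thesis
    using c geom_sum_nonneg[of t'] geom_sum_nonneg[of t]
    by (simp add: ennreal_mult ac_simps)
qed

lemma norm_lim_le_nn_integral:
  fixes u :: "'i \<Rightarrow> complex" and A :: "nat \<Rightarrow> 'i set"
  assumes lim: "(\<lambda>n. \<Sum>k\<in>A n. u k) \<longlonglongrightarrow> l" and fin: "\<And>n. finite (A n)"
  shows "ennreal (norm l) \<le> (\<integral>\<^sup>+k. ennreal (norm (u k)) \<partial>count_space UNIV)"
proof (rule LIMSEQ_le_const2)
  show "(\<lambda>n. ennreal (norm (\<Sum>k\<in>A n. u k))) \<longlonglongrightarrow> ennreal (norm l)"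
    by (intro tendsto_ennrealI tendsto_norm lim)
  have "ennreal (norm (\<Sum>k\<in>A n. u k)) \<le> (\<integral>\<^sup>+k. ennreal (norm (u k)) \<partial>count_space UNIV)" for n
  proof -
    have "ennreal (norm (\<Sum>k\<in>A n. u k)) \<le> ennreal (\<Sum>k\<in>A n. norm (u k))"
      by (intro ennreal_leI norm_sum)
    also have "\<dots> = (\<Sum>k\<in>A n. ennreal (norm (u k)))" by simp
    also have "\<dots> \<le> (\<integral>\<^sup>+k. ennreal (norm (u k)) \<partial>count_space UNIV)"
      by (rule sum_le_nn_integral_count_space[OF fin])
    finally show ?thesis .
  qed
  then show "\<exists>N. \<forall>n\<ge>N. ennreal (norm (\<Sum>k\<in>A n. u k)) \<le> (\<integral>\<^sup>+k. ennreal (norm (u k)) \<partial>count_space UNIV)"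
    by blast
qed

lemma le_geometric_mean:
  fixes X Y :: ennreal
  assumes "X \<le> ennreal a * Y" "X \<le> ennreal b * Y" "0 \<le> a" "0 \<le> b"
  shows "X \<le> ennreal (sqrt (a * b)) * Y"
proof -
  have "min a b \<le> sqrt (a * b)"
    using assms(3,4) by (intro real_le_rsqrt) (auto simp: min_def power2_eq_square intro: mult_left_mono mult_right_mono)
  then have "ennreal (min a b) * Y \<le> ennreal (sqrt (a * b)) * Y"
    by (intro mult_right_mono ennreal_leI) auto
  moreover have "X \<le> ennreal (min a b) * Y" using assms(1,2) by (simp add: min_def)
  ultimately show ?thesis by (rule order_trans[rotated])
qed

text \<open>The infimum has norm at most that of every \<open>h n\<close>.\<close>

lemma AE_INF_eq_0:
  assumes [measurable]: "\<And>n. h n \<in> borel_measurable M"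
    and bound: "\<And>n::nat. Lp_enorm 2 M (h n) \<le> ennreal (c * (1/2) ^ n)"
  shows "AE x in M. (INF n. h n x) = 0"
proof -
  have "Lp_enorm 2 M (\<lambda>x. INF n. h n x) \<le> ennreal (c * (1/2) ^ n)" for n
    by (rule order_trans[OF Lp_enorm_mono bound[of n]]) (auto intro: INF_lower)
  moreover have "(\<lambda>n. ennreal (c * (1/2) ^ n)) \<longlonglongrightarrow> ennreal (c * 0)"
    by (intro tendsto_ennrealI tendsto_mult tendsto_const LIMSEQ_power_zero) simp
  ultimately have "Lp_enorm 2 M (\<lambda>x. INF n. h n x) \<le> ennreal (c * 0)"
    by (intro LIMSEQ_le_const) auto
  then have "(\<integral>\<^sup>+x. (INF n. h n x)\<^sup>2 \<partial>M) \<le> 0"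
    using Lp_enorm_le_iff[of 2 M "\<lambda>x. INF n. h n x" 0] epowr_ennreal[of 0 2] by (simp add: epowr_2)
  then show ?thesis by (simp add: nn_integral_0_iff_AE)
qed

context doubling_space
begin

definition op_const :: "real \<Rightarrow> real" where
  "op_const C = max (C * avg_norm C) (composition_const C * ball_ratio (2 * A\<^sub>0 * C) * avg_norm (2 * A\<^sub>0 * C))"

lemma op_const_ge_1: "1 \<le> C \<Longrightarrow> 1 \<le> op_const C"
  using mult_mono[of 1 C 1 "avg_norm C"] avg_norm_ge_1[of C] by (simp add: op_const_def le_max_iff_disj)

lemma Lp_norm_hoelder_kernel:
  assumes p: "1 \<le> p" and K: "hoelder_kernel C k K" and C: "1 \<le> C" and g: "g \<in> borel_measurable M"
  shows "Lp_norm p M (int_op M K g) \<le> ennreal (op_const C) * Lp_norm p M g"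
proof -
  have "Lp_norm p M (int_op M K g) \<le> ennreal (C * avg_norm C) * Lp_norm p M g"
    using C by (intro Lp_norm_int_op(2)[OF p C _ hoelder_kernel_measurable[OF K] g hoelder_kernel_le_ball_avg[OF K]]) auto
  also have "\<dots> \<le> ennreal (op_const C) * Lp_norm p M g"
    by (intro mult_right_mono ennreal_leI) (auto simp: op_const_def)
  finally show ?thesis .
qed

lemma int_op_int_op:
  assumes K: "hoelder_kernel C j K" and L: "hoelder_kernel C k L" and C: "1 \<le> C" and g: "g \<in> Lp_functions 2 M"
  shows "int_op M K (int_op M L g) = int_op M (kernel_comp K L) g"
proof
  fix x
  have "test_function (\<lambda>z. K x z)" using C by (intro hoelder_kernel_row_test[OF K]) auto
  from integral_mult_hoelder_kernel[OF this L C g]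
  show "int_op M K (int_op M L g) x = int_op M (kernel_comp K L) g x"
    by (simp add: int_op_def kernel_comp_def)
qed

lemma Lp_norm_two_kernels:
  assumes p: "1 \<le> p" and K: "hoelder_kernel C j K" "cancelling K" and L: "hoelder_kernel C k L" "cancelling L"
    and C: "1 \<le> C" and g: "g \<in> Lp_functions 2 M"
  shows "Lp_norm p M (int_op M K (int_op M L g)) \<le> ennreal (op_const C * 2 powr (- \<epsilon> * of_int \<bar>j - k\<bar>)) * Lp_norm p M g"
proof -
  have [measurable]: "g \<in> borel_measurable M" "case_prod K \<in> borel_measurable (M \<Otimes>\<^sub>M M)" "case_prod L \<in> borel_measurable (M \<Otimes>\<^sub>M M)"
    using g hoelder_kernel_measurable[OF K(1)] hoelder_kernel_measurable[OF L(1)] C by (auto simp: Lp_functions_def)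
  have "1 \<le> A\<^sub>0 * C" using mult_mono[of 1 A\<^sub>0 1 C] A0 C by simp
  then have c: "1 \<le> 2 * A\<^sub>0 * C" by simp
  define b where "b = composition_const C * ball_ratio (2 * A\<^sub>0 * C) * 2 powr (- \<epsilon> * of_int \<bar>j - k\<bar>)"
  have b: "0 \<le> b" using C avg_norm_ge_1[of C] ball_ratio_ge_1[of "2 * A\<^sub>0 * C"] by (simp add: b_def composition_const_def)
  have "Lp_norm p M (int_op M (kernel_comp K L) g) \<le> ennreal (b * avg_norm (2 * A\<^sub>0 * C)) * Lp_norm p M g"
    by (rule Lp_norm_int_op(2)[OF p c b _ _ kernel_comp_bound[OF K L C, folded b_def]]) measurable
  also have "\<dots> \<le> ennreal (op_const C * 2 powr (- \<epsilon> * of_int \<bar>j - k\<bar>)) * Lp_norm p M g"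
  proof (intro mult_right_mono ennreal_leI)
    have "b * avg_norm (2 * A\<^sub>0 * C)
        = composition_const C * ball_ratio (2 * A\<^sub>0 * C) * avg_norm (2 * A\<^sub>0 * C) * 2 powr (- \<epsilon> * of_int \<bar>j - k\<bar>)"
      by (simp add: b_def ac_simps)
    also have "\<dots> \<le> op_const C * 2 powr (- \<epsilon> * of_int \<bar>j - k\<bar>)"
      by (intro mult_right_mono) (auto simp: op_const_def)
    finally show "b * avg_norm (2 * A\<^sub>0 * C) \<le> op_const C * 2 powr (- \<epsilon> * of_int \<bar>j - k\<bar>)" .
  qed simp
  finally show ?thesis by (simp add: int_op_int_op[OF K(1) L(1) C g])
qed

text \<open>The operator \<open>E\<close> after operators \<open>D\<^sub>a\<close>; the head of the list is the scale that acts on \<open>g\<close> first. In this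
order, expanding the argument of a chain prepends an element to the list.\<close>

fun chain :: "('a \<Rightarrow> 'a \<Rightarrow> complex) \<Rightarrow> (int \<Rightarrow> 'a \<Rightarrow> 'a \<Rightarrow> complex) \<Rightarrow> int list \<Rightarrow> ('a \<Rightarrow> complex) \<Rightarrow> 'a \<Rightarrow> complex" where
  "chain E D [] g = int_op M E g"
| "chain E D (a # ks) g = chain E D ks (int_op M (D a) g)"

text \<open>The norm bound for a chain whose factors are grouped in pairs, beginning with the two that act first.\<close>

fun pair_bound :: "real \<Rightarrow> int \<Rightarrow> int list \<Rightarrow> real" where
  "pair_bound \<kappa> j [] = \<kappa>"
| "pair_bound \<kappa> j [a] = \<kappa> * 2 powr (- \<epsilon> * of_int \<bar>a - j\<bar>)"
| "pair_bound \<kappa> j (a # b # ks) = \<kappa> * 2 powr (- \<epsilon> * of_int \<bar>a - b\<bar>) * pair_bound \<kappa> j ks"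

text \<open>The scale of the operator that acts first, where \<open>j\<close> is the scale of \<open>E\<close>.\<close>

definition inner_scale :: "int \<Rightarrow> int list \<Rightarrow> int" where
  "inner_scale j ks = hd (ks @ [j])"

text \<open>By \<open>sqrt_pair_bound\<close> below, this is the geometric mean of the bounds that result from the two ways of
grouping a chain in adjacent pairs. Each link joins a pair in exactly one of them, so it contributes the
square root of its bound.\<close>

fun chain_weight :: "real \<Rightarrow> int \<Rightarrow> int list \<Rightarrow> real" where
  "chain_weight \<kappa> j [] = \<kappa>"
| "chain_weight \<kappa> j (a # ks) = sqrt \<kappa> * 2 powr (- (\<epsilon> / 2) * of_int \<bar>a - inner_scale j ks\<bar>) * chain_weight \<kappa> j ks"

lemma inner_scale_simps [simp]: "inner_scale j [] = j" "inner_scale j (a # ks) = a"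
  by (simp_all add: inner_scale_def)

lemma pair_bound_nonneg: "0 \<le> \<kappa> \<Longrightarrow> 0 \<le> pair_bound \<kappa> j ks"
  by (induction \<kappa> j ks rule: pair_bound.induct) auto

lemma chain_weight_nonneg: "0 \<le> \<kappa> \<Longrightarrow> 0 \<le> chain_weight \<kappa> j ks"
  by (induction ks) auto

lemma sqrt_two_powr: "sqrt (2 powr (- \<epsilon> * x)) = 2 powr (- (\<epsilon> / 2) * x)"
  by (simp add: powr_half_sqrt[symmetric] powr_powr)

text \<open>The second factor under the root belongs to the grouping that leaves the operator acting first on its own.\<close>

lemma sqrt_pair_bound:
  assumes "0 \<le> \<kappa>"
  shows "sqrt (pair_bound \<kappa> j (a # ks) * (\<kappa> * pair_bound \<kappa> j ks)) = chain_weight \<kappa> j (a # ks)"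
proof (induction ks arbitrary: a)
  case Nil
  have "sqrt (\<kappa> * 2 powr (- \<epsilon> * of_int \<bar>a - j\<bar>) * (\<kappa> * \<kappa>)) = sqrt \<kappa> * sqrt (2 powr (- \<epsilon> * of_int \<bar>a - j\<bar>)) * sqrt (\<kappa> * \<kappa>)"
    by (simp only: real_sqrt_mult)
  also have "sqrt (\<kappa> * \<kappa>) = \<kappa>" using assms by simp
  finally show ?case
    unfolding sqrt_two_powr by (simp only: pair_bound.simps chain_weight.simps inner_scale_simps)
next
  case (Cons b ks)
  have "pair_bound \<kappa> j (a # b # ks) * (\<kappa> * pair_bound \<kappa> j (b # ks))
      = \<kappa> * 2 powr (- \<epsilon> * of_int \<bar>a - b\<bar>) * (pair_bound \<kappa> j (b # ks) * (\<kappa> * pair_bound \<kappa> j ks))"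
    by simp
  then have "sqrt (pair_bound \<kappa> j (a # b # ks) * (\<kappa> * pair_bound \<kappa> j (b # ks)))
      = sqrt \<kappa> * sqrt (2 powr (- \<epsilon> * of_int \<bar>a - b\<bar>)) * sqrt (pair_bound \<kappa> j (b # ks) * (\<kappa> * pair_bound \<kappa> j ks))"
    by (simp only: real_sqrt_mult)
  also have "\<dots> = chain_weight \<kappa> j (a # b # ks)"
    unfolding Cons.IH sqrt_two_powr by simp
  finally show ?case .
qed

end

text \<open>The situation of the main estimate: \<open>E\<close> is one operator of the first family, and the second family \<open>D\<close>
sums to the identity.\<close>

locale reproducing_family = doubling_space +
  fixes E :: "'a \<Rightarrow> 'a \<Rightarrow> complex" and D :: "int \<Rightarrow> 'a \<Rightarrow> 'a \<Rightarrow> complex" and j :: int and C :: real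
  assumes C: "1 \<le> C"
    and E: "hoelder_kernel C j E" "cancelling E"
    and D: "hoelder_kernel C k (D k)" "cancelling (D k)"
    and reproducing: "test_function r \<Longrightarrow> f \<in> Lp_functions 2 M \<Longrightarrow>
      (\<lambda>n. \<Sum>k\<in>{- int n..int n}. LINT z|M. r z * int_op M (D k) f z) \<longlonglongrightarrow> (LINT y|M. r y * f y)"
begin

abbreviation \<kappa> :: real where "\<kappa> \<equiv> op_const C"

abbreviation weight :: "int list \<Rightarrow> real" where "weight \<equiv> chain_weight \<kappa> j"

lemma kappa: "1 \<le> \<kappa>" by (rule op_const_ge_1[OF C])

lemma D_Lp: "g \<in> Lp_functions 2 M \<Longrightarrow> int_op M (D k) g \<in> Lp_functions 2 M"
  by (rule Lp_functions_hoelder_kernel[OF D(1) C]) auto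

lemma chain_pair_bound:
  assumes p: "1 \<le> p"
  shows "g \<in> Lp_functions 2 M \<Longrightarrow> Lp_norm p M (chain E D ks g) \<le> ennreal (pair_bound \<kappa> j ks) * Lp_norm p M g"
proof (induction ks arbitrary: g rule: induct_list012)
  case 1
  then show ?case using Lp_norm_hoelder_kernel[OF p E(1) C] by (auto simp: Lp_functions_def)
next
  case (2 a)
  then show ?case using Lp_norm_two_kernels[OF p E D C, of g a] by (simp add: abs_minus_commute)
next
  case (3 a b ks)
  have "Lp_norm p M (chain E D (a # b # ks) g) \<le> ennreal (pair_bound \<kappa> j ks) * Lp_norm p M (int_op M (D b) (int_op M (D a) g))"
    using "3.IH"(1)[OF D_Lp[OF D_Lp[OF "3.prems"]], of b a] by simp
  also have "\<dots> \<le> ennreal (pair_bound \<kappa> j ks) * (ennreal (\<kappa> * 2 powr (- \<epsilon> * of_int \<bar>b - a\<bar>)) * Lp_norm p M g)"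
    by (intro mult_left_mono Lp_norm_two_kernels[OF p D D C "3.prems"]) simp
  also have "\<dots> = ennreal (pair_bound \<kappa> j ks * (\<kappa> * 2 powr (- \<epsilon> * of_int \<bar>b - a\<bar>))) * Lp_norm p M g"
    using kappa pair_bound_nonneg[of \<kappa> j ks] by (subst ennreal_mult[of "pair_bound \<kappa> j ks"]) (simp_all add: mult.assoc)
  also have "pair_bound \<kappa> j ks * (\<kappa> * 2 powr (- \<epsilon> * of_int \<bar>b - a\<bar>)) = pair_bound \<kappa> j (a # b # ks)"
    by (simp add: abs_minus_commute)
  finally show ?case .
qed

text \<open>Besides \<open>chain_pair_bound\<close>, a second bound results from splitting off the operator that acts first and
grouping the others in pairs; the norm is at most the geometric mean of the two.\<close>

lemma chain_bound:
  assumes p: "1 \<le> p" and g: "g \<in> Lp_functions 2 M"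
  shows "Lp_norm p M (chain E D ks g) \<le> ennreal (weight ks) * Lp_norm p M g"
proof (cases ks)
  case Nil
  then show ?thesis using chain_pair_bound[OF p g, of "[]"] by simp
next
  case (Cons a ks')
  have "Lp_norm p M (chain E D ks g) \<le> ennreal (pair_bound \<kappa> j ks') * Lp_norm p M (int_op M (D a) g)"
    using chain_pair_bound[OF p D_Lp[OF g], of ks' a] by (simp add: Cons)
  also have "\<dots> \<le> ennreal (pair_bound \<kappa> j ks') * (ennreal \<kappa> * Lp_norm p M g)"
    using g by (intro mult_left_mono Lp_norm_hoelder_kernel[OF p D(1) C]) (auto simp: Lp_functions_def)
  also have "\<dots> = ennreal (\<kappa> * pair_bound \<kappa> j ks') * Lp_norm p M g"
    using kappa pair_bound_nonneg[of \<kappa> j ks']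
    by (subst ennreal_mult[of \<kappa>]) (simp_all add: ac_simps)
  finally have "Lp_norm p M (chain E D ks g) \<le> ennreal (\<kappa> * pair_bound \<kappa> j ks') * Lp_norm p M g" .
  moreover have nonneg: "0 \<le> pair_bound \<kappa> j ks" "0 \<le> \<kappa> * pair_bound \<kappa> j ks'" "0 \<le> \<kappa>"
    using kappa by (auto intro!: mult_nonneg_nonneg pair_bound_nonneg)
  ultimately have "Lp_norm p M (chain E D ks g) \<le> ennreal (sqrt (pair_bound \<kappa> j ks * (\<kappa> * pair_bound \<kappa> j ks'))) * Lp_norm p M g"
    by (intro le_geometric_mean chain_pair_bound[OF p g])
  then show ?thesis unfolding Cons sqrt_pair_bound[OF nonneg(3)] .
qed

lemma chain_measurable [measurable]: "g \<in> borel_measurable M \<Longrightarrow> chain E D ks g \<in> borel_measurable M"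
proof (induction ks arbitrary: g)
  case Nil
  then show ?case
    using C int_op_measurable[OF hoelder_kernel_measurable[OF E(1)]] by simp
next
  case (Cons a ks)
  have "int_op M (D a) g \<in> borel_measurable M"
    using C int_op_measurable[OF hoelder_kernel_measurable[OF D(1)] Cons.prems] by simp
  then show ?case using Cons.IH by simp
qed

lemma chain_row: "\<exists>r. test_function r \<and> (\<forall>f\<in>Lp_functions 2 M. chain E D ks f x = (LINT y|M. r y * f y))"
proof (induction ks)
  case Nil
  show ?case
    using C hoelder_kernel_row_test[OF E(1), of x] by (intro exI[of _ "E x"]) (auto simp: int_op_def)
next
  case (Cons a ks)
  then obtain r where r: "test_function r" "\<And>f. f \<in> Lp_functions 2 M \<Longrightarrow> chain E D ks f x = (LINT y|M. r y * f y)"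
    by blast
  show ?case
    using test_function_step[OF r(1) D(1) C, of a] r(2)[OF D_Lp]
      integral_mult_hoelder_kernel[OF r(1) D(1) C]
    by (intro exI[of _ "\<lambda>y. LINT z|M. r z * D a z y"]) auto
qed

text \<open>The chain evaluated at \<open>x\<close> is a test function paired with \<open>f\<close>, so the reproducing limit expresses it
through the chains with one more factor.\<close>

lemma chain_expand:
  assumes f: "f \<in> Lp_functions 2 M"
  shows "ennreal (norm (chain E D ks f x)) \<le> (\<integral>\<^sup>+a. ennreal (norm (chain E D (a # ks) f x)) \<partial>count_space UNIV)"
proof -
  obtain r where r: "test_function r" "\<And>f. f \<in> Lp_functions 2 M \<Longrightarrow> chain E D ks f x = (LINT y|M. r y * f y)"
    using chain_row by blast
  have "(\<lambda>n. \<Sum>a\<in>{- int n..int n}. chain E D (a # ks) f x) \<longlonglongrightarrow> chain E D ks f x"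
    using reproducing[OF r(1) f] by (simp add: r(2) f D_Lp)
  then show ?thesis by (rule norm_lim_le_nn_integral) simp
qed

end

section \<open>Summing over chains\<close>

context doubling_space
begin

text \<open>Sequences of this kind change by at most the factor that half of the decay along a link can absorb. Both
a constant and the sum over \<open>k\<close> of \<open>2\<^bsup>-(\<epsilon>/4)|k-a|\<^esup> x\<^sub>k\<close> have the property, which lets one argument treat
the remainder and the main term.\<close>

definition slow :: "(int \<Rightarrow> ennreal) \<Rightarrow> bool" where
  "slow y \<longleftrightarrow> (\<forall>a b. y b \<le> ennreal (2 powr (\<epsilon> / 4 * of_int \<bar>b - a\<bar>)) * y a)"

lemma slow_const: "slow (\<lambda>_. c)"
proof -
  have "c \<le> ennreal (2 powr (\<epsilon> / 4 * of_int \<bar>b - a\<bar>)) * c" for a b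
  proof -
    have "1 \<le> 2 powr (\<epsilon> / 4 * of_int \<bar>b - a\<bar>)" using eps by (intro ge_one_powr_ge_zero) auto
    then have "ennreal 1 * c \<le> ennreal (2 powr (\<epsilon> / 4 * of_int \<bar>b - a\<bar>)) * c"
      by (intro mult_right_mono ennreal_leI) auto
    then show ?thesis by simp
  qed
  then show ?thesis by (simp add: slow_def)
qed

lemma slow_cmult: "slow y \<Longrightarrow> slow (\<lambda>a. c * y a)"
  unfolding slow_def by (metis mult.left_commute mult_left_mono zero_le)

definition smear :: "(int \<Rightarrow> ennreal) \<Rightarrow> int \<Rightarrow> ennreal" where
  "smear x a = (\<integral>\<^sup>+k. ennreal (2 powr (- (\<epsilon> / 4) * of_int \<bar>k - a\<bar>)) * x k \<partial>count_space UNIV)"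

lemma le_smear: "x a \<le> smear x a"
  unfolding smear_def
  using le_nn_integral_count_space[of "\<lambda>k. ennreal (2 powr (- (\<epsilon> / 4) * of_int \<bar>k - a\<bar>)) * x k" a] by simp

lemma slow_smear: "slow (smear x)"
  unfolding slow_def
proof (intro allI)
  fix a b
  have "2 powr (- (\<epsilon> / 4) * of_int \<bar>k - b\<bar>) \<le> 2 powr (\<epsilon> / 4 * of_int \<bar>b - a\<bar>) * 2 powr (- (\<epsilon> / 4) * of_int \<bar>k - a\<bar>)" for k
  proof -
    have "real_of_int \<bar>k - a\<bar> \<le> of_int \<bar>k - b\<bar> + of_int \<bar>b - a\<bar>" by linarith
    then have "\<epsilon> / 4 * real_of_int \<bar>k - a\<bar> \<le> \<epsilon> / 4 * (of_int \<bar>k - b\<bar> + of_int \<bar>b - a\<bar>)"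
      using eps by (intro mult_left_mono) auto
    then show ?thesis unfolding powr_add[symmetric] by (intro powr_mono) (auto simp: distrib_left)
  qed
  then have "smear x b \<le> (\<integral>\<^sup>+k. ennreal (2 powr (\<epsilon> / 4 * of_int \<bar>b - a\<bar>)) * (ennreal (2 powr (- (\<epsilon> / 4) * of_int \<bar>k - a\<bar>)) * x k) \<partial>count_space UNIV)"
    unfolding smear_def mult.assoc[symmetric]
    by (intro nn_integral_mono mult_right_mono) (auto simp: ennreal_mult[symmetric] intro: ennreal_leI)
  also have "\<dots> = ennreal (2 powr (\<epsilon> / 4 * of_int \<bar>b - a\<bar>)) * smear x a"
    unfolding smear_def by (rule nn_integral_cmult) simp
  finally show "smear x b \<le> ennreal (2 powr (\<epsilon> / 4 * of_int \<bar>b - a\<bar>)) * smear x a" .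
qed

text \<open>The separation \<open>N\<close> beyond which a pair of scales counts as far: one round of expansion over far pairs then
has total weight at most \<open>1/2\<close>.\<close>

definition gap :: "real \<Rightarrow> nat" where
  "gap \<kappa> = (SOME N. \<kappa> * 2 powr (- (\<epsilon> / 8) * real N) * geom_sum (\<epsilon> / 4) * geom_sum (\<epsilon> / 8) \<le> 1 / 2)"

lemma gap: "\<kappa> * 2 powr (- (\<epsilon> / 8) * real (gap \<kappa>)) * geom_sum (\<epsilon> / 4) * geom_sum (\<epsilon> / 8) \<le> 1 / 2"
proof -
  have "2 powr (- (\<epsilon> / 8)) < (1 :: real)" using eps powr_less_mono[of "- (\<epsilon> / 8)" 0 2] by simp
  then have "(\<lambda>N. \<kappa> * (2 powr (- (\<epsilon> / 8))) ^ N * geom_sum (\<epsilon> / 4) * geom_sum (\<epsilon> / 8))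
      \<longlonglongrightarrow> \<kappa> * 0 * geom_sum (\<epsilon> / 4) * geom_sum (\<epsilon> / 8)"
    by (intro tendsto_intros LIMSEQ_power_zero) simp
  then have "\<forall>\<^sub>F N in sequentially. \<kappa> * (2 powr (- (\<epsilon> / 8))) ^ N * geom_sum (\<epsilon> / 4) * geom_sum (\<epsilon> / 8) < 1 / 2"
    by (rule order_tendstoD) simp
  then obtain N where "\<kappa> * (2 powr (- (\<epsilon> / 8))) ^ N * geom_sum (\<epsilon> / 4) * geom_sum (\<epsilon> / 8) < 1 / 2"
    unfolding eventually_sequentially by blast
  moreover have "(2 powr (- (\<epsilon> / 8))) ^ N = 2 powr (- (\<epsilon> / 8) * real N)"
    by (subst powr_realpow[symmetric]) (simp_all add: powr_powr)
  ultimately have "\<exists>N. \<kappa> * 2 powr (- (\<epsilon> / 8) * real N) * geom_sum (\<epsilon> / 4) * geom_sum (\<epsilon> / 8) \<le> 1 / 2"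
    by (metis less_imp_le)
  then show ?thesis unfolding gap_def by (rule someI_ex)
qed

text \<open>The last factor compares the weights of chains with \<open>n\<close> and \<open>n + 1\<close> operators when the additional link is
not longer than \<open>gap \<kappa>\<close>.\<close>

definition near_const :: "real \<Rightarrow> real" where
  "near_const \<kappa> = \<kappa> * geom_sum (\<epsilon> / 4) * geom_sum (\<epsilon> / 8) * 2 powr (\<epsilon> / 2 * real (gap \<kappa>))"

text \<open>One round of expansion, over the pairs of scales whose difference satisfies \<open>R\<close>. The argument is a function
of chains; iterating the operator for far pairs generates all terms of the expansion.\<close>

definition pair_sum :: "(int \<Rightarrow> bool) \<Rightarrow> (int list \<Rightarrow> 'a \<Rightarrow> ennreal) \<Rightarrow> int list \<Rightarrow> 'a \<Rightarrow> ennreal" where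
  "pair_sum R v ks x = (\<integral>\<^sup>+a. \<integral>\<^sup>+b. (if R (b - a) then v (b # a # ks) x else 0) \<partial>count_space UNIV \<partial>count_space UNIV)"

lemma pair_sum_mono: "(\<And>ks. v ks x \<le> w ks x) \<Longrightarrow> pair_sum R v ks x \<le> pair_sum R w ks x"
  unfolding pair_sum_def by (intro nn_integral_mono) auto

lemma pair_sum_add: "pair_sum R (\<lambda>ks x. v ks x + w ks x) ks x = pair_sum R v ks x + pair_sum R w ks x"
proof -
  have "(\<integral>\<^sup>+b. (if R (b - a) then v (b # a # ks) x + w (b # a # ks) x else 0) \<partial>count_space UNIV)
      = (\<integral>\<^sup>+b. (if R (b - a) then v (b # a # ks) x else 0) + (if R (b - a) then w (b # a # ks) x else 0) \<partial>count_space UNIV)" for a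
    by (intro nn_integral_cong) simp
  then show ?thesis unfolding pair_sum_def by (simp only: nn_integral_add borel_measurable_count_space)
qed

lemma pair_sum_measurable:
  assumes [measurable]: "\<And>ks. v ks \<in> borel_measurable M"
  shows "pair_sum R v ks \<in> borel_measurable M"
  unfolding pair_sum_def by measurable

lemma pair_sum_iterate_measurable:
  assumes "\<And>ks. v ks \<in> borel_measurable M"
  shows "(pair_sum R ^^ n) v ks \<in> borel_measurable M"
  by (induction n arbitrary: ks) (auto intro: pair_sum_measurable assms)

end

context reproducing_family
begin

text \<open>The two new links contribute \<open>2\<^bsup>-(\<epsilon>/2)(|b-a| + |a-h|)\<^esup>\<close>, where \<open>h\<close> is the inner scale of the chain before the expansion. A
factor \<open>2\<^bsup>-(\<epsilon>/4)(|b-a| + |a-h|)\<^esup>\<close> compensates the change of \<open>y\<close> from \<open>h\<close> to \<open>b\<close>. The rest is summable in \<open>a\<close>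
and \<open>b\<close>, and half of the exponent of \<open>|b-a|\<close> is given up for \<open>\<tau>\<close>.\<close>

lemma pair_sum_bound:
  assumes p: "1 \<le> p" and [measurable]: "\<And>ks. v ks \<in> borel_measurable M" and y: "slow y"
    and v: "\<And>a b ks. R (b - a) \<Longrightarrow> Lp_enorm p M (v (b # a # ks)) \<le> ennreal (weight (b # a # ks)) * y b"
    and R: "\<And>m. R m \<Longrightarrow> 2 powr (- (\<epsilon> / 8) * of_int \<bar>m\<bar>) \<le> \<tau>" and \<tau>: "0 \<le> \<tau>"
  shows "Lp_enorm p M (pair_sum R v ks)
    \<le> ennreal (\<kappa> * \<tau> * geom_sum (\<epsilon> / 4) * geom_sum (\<epsilon> / 8)) * (ennreal (weight ks) * y (inner_scale j ks))"
proof -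
  define h where "h = inner_scale j ks"
  define w where "w = ennreal (weight ks) * y h"
  define c where "c a b = \<kappa> * \<tau> * 2 powr (- (\<epsilon> / 4) * of_int \<bar>a - h\<bar>) * 2 powr (- (\<epsilon> / 8) * of_int \<bar>b - a\<bar>)" for a b
  have W: "0 \<le> weight ks" using kappa by (intro chain_weight_nonneg) auto
  have term_bound: "Lp_enorm p M (\<lambda>x. if R (b - a) then v (b # a # ks) x else 0) \<le> ennreal (c a b) * w" for a b
  proof (cases "R (b - a)")
    case True
    define s t where "s = real_of_int \<bar>b - a\<bar>" and "t = real_of_int \<bar>a - h\<bar>"
    have "Lp_enorm p M (v (b # a # ks)) \<le> ennreal (weight (b # a # ks)) * y b" by (rule v[OF True])
    also have "\<dots> \<le> ennreal (weight (b # a # ks)) * (ennreal (2 powr (\<epsilon> / 4 * of_int \<bar>b - h\<bar>)) * y h)"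
      using y unfolding slow_def by (intro mult_left_mono) auto
    also have "\<dots> = ennreal (weight (b # a # ks) * 2 powr (\<epsilon> / 4 * of_int \<bar>b - h\<bar>)) * y h"
      using kappa by (subst ennreal_mult) (auto intro: chain_weight_nonneg simp: mult.assoc simp del: chain_weight.simps)
    also have "\<dots> \<le> ennreal (c a b * weight ks) * y h"
    proof (intro mult_right_mono ennreal_leI)
      have weight_eq: "weight (b # a # ks) = \<kappa> * (2 powr (- (\<epsilon> / 2) * s) * 2 powr (- (\<epsilon> / 2) * t)) * weight ks"
      proof -
        have "weight (b # a # ks) = (sqrt \<kappa> * sqrt \<kappa>) * (2 powr (- (\<epsilon> / 2) * s) * 2 powr (- (\<epsilon> / 2) * t)) * weight ks"
          by (simp only: chain_weight.simps inner_scale_simps s_def t_def h_def ac_simps)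
        then show ?thesis using kappa by simp
      qed
      have decay: "2 powr (- (\<epsilon> / 2) * s) * 2 powr (- (\<epsilon> / 2) * t) * 2 powr (\<epsilon> / 4 * of_int \<bar>b - h\<bar>)
          \<le> \<tau> * (2 powr (- (\<epsilon> / 4) * t) * 2 powr (- (\<epsilon> / 8) * s))"
      proof -
        have "real_of_int \<bar>b - h\<bar> \<le> s + t" unfolding s_def t_def by linarith
        then have "\<epsilon> / 4 * real_of_int \<bar>b - h\<bar> \<le> \<epsilon> / 4 * (s + t)" using eps by (intro mult_left_mono) auto
        then have "2 powr (- (\<epsilon> / 2) * s + - (\<epsilon> / 2) * t + \<epsilon> / 4 * of_int \<bar>b - h\<bar>)
            \<le> 2 powr (- (\<epsilon> / 8) * s + (- (\<epsilon> / 4) * t + - (\<epsilon> / 8) * s))"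
          by (intro powr_mono) (auto simp: distrib_left)
        also have "\<dots> \<le> \<tau> * 2 powr (- (\<epsilon> / 4) * t + - (\<epsilon> / 8) * s)"
          using R[OF True] unfolding powr_add[of _ "- (\<epsilon> / 8) * s" "- (\<epsilon> / 4) * t + - (\<epsilon> / 8) * s"]
          unfolding s_def by (intro mult_right_mono) auto
        finally show ?thesis by (simp only: powr_add)
      qed
      have "weight (b # a # ks) * 2 powr (\<epsilon> / 4 * of_int \<bar>b - h\<bar>)
          = \<kappa> * weight ks * (2 powr (- (\<epsilon> / 2) * s) * 2 powr (- (\<epsilon> / 2) * t) * 2 powr (\<epsilon> / 4 * of_int \<bar>b - h\<bar>))"
        unfolding weight_eq by (simp only: ac_simps)
      also have "\<dots> \<le> \<kappa> * weight ks * (\<tau> * (2 powr (- (\<epsilon> / 4) * t) * 2 powr (- (\<epsilon> / 8) * s)))"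
        using kappa W by (intro mult_left_mono decay) auto
      finally show "weight (b # a # ks) * 2 powr (\<epsilon> / 4 * of_int \<bar>b - h\<bar>) \<le> c a b * weight ks"
        by (simp only: c_def s_def t_def ac_simps)
    qed simp
    also have "\<dots> = ennreal (c a b) * w"
      unfolding w_def using \<tau> kappa W by (subst ennreal_mult) (auto simp: c_def mult.assoc)
    finally show ?thesis using True by simp
  next
    case False
    have "Lp_enorm p M (\<lambda>x. ennreal 0 * 0) \<le> ennreal 0 * Lp_enorm p M (\<lambda>x. 0)"
      by (intro Lp_enorm_cmult[OF p]) auto
    then show ?thesis using False by simp
  qed
  have "Lp_enorm p M (pair_sum R v ks)
      \<le> (\<integral>\<^sup>+a. Lp_enorm p M (\<lambda>x. \<integral>\<^sup>+b. (if R (b - a) then v (b # a # ks) x else 0) \<partial>count_space UNIV) \<partial>count_space UNIV)"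
    unfolding pair_sum_def by (rule Lp_enorm_nn_integral_count_space[OF p]) measurable
  also have "\<dots> \<le> (\<integral>\<^sup>+a. \<integral>\<^sup>+b. Lp_enorm p M (\<lambda>x. if R (b - a) then v (b # a # ks) x else 0) \<partial>count_space UNIV \<partial>count_space UNIV)"
    by (intro nn_integral_mono Lp_enorm_nn_integral_count_space[OF p]) measurable
  also have "\<dots> \<le> (\<integral>\<^sup>+a. \<integral>\<^sup>+b. ennreal (c a b) * w \<partial>count_space UNIV \<partial>count_space UNIV)"
    by (intro nn_integral_mono term_bound)
  also have "\<dots> = (\<integral>\<^sup>+a. \<integral>\<^sup>+b. ennreal (c a b) \<partial>count_space UNIV \<partial>count_space UNIV) * w"
    by (simp add: nn_integral_multc)
  also have "(\<integral>\<^sup>+a. \<integral>\<^sup>+b. ennreal (c a b) \<partial>count_space UNIV \<partial>count_space UNIV) = ennreal (\<kappa> * \<tau> * geom_sum (\<epsilon> / 4) * geom_sum (\<epsilon> / 8))"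
    unfolding c_def using eps kappa \<tau> by (intro nn_integral_two_step) auto
  finally show ?thesis unfolding w_def h_def .
qed

abbreviation far :: "int \<Rightarrow> bool" where "far m \<equiv> int (gap \<kappa>) < \<bar>m\<bar>"

abbreviation near :: "int \<Rightarrow> bool" where "near m \<equiv> \<bar>m\<bar> \<le> int (gap \<kappa>)"

text \<open>Each round of expansion over far pairs gains a factor \<open>1/2\<close>, by the choice of \<open>gap\<close>, and reproduces the
form of the bound.\<close>

lemma far_iterate_bound:
  assumes p: "1 \<le> p" and meas: "\<And>ks. v ks \<in> borel_measurable M" and y: "slow y"
    and v: "\<And>ks. Lp_enorm p M (v ks) \<le> ennreal (weight ks) * y (inner_scale j ks)"
  shows "Lp_enorm p M ((pair_sum far ^^ n) v ks) \<le> ennreal ((1 / 2) ^ n) * (ennreal (weight ks) * y (inner_scale j ks))"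
proof (induction n arbitrary: ks)
  case 0
  then show ?case using v by simp
next
  case (Suc n)
  let ?y = "\<lambda>a. ennreal ((1 / 2) ^ n) * y a"
  have "Lp_enorm p M (pair_sum far ((pair_sum far ^^ n) v) ks)
      \<le> ennreal (\<kappa> * 2 powr (- (\<epsilon> / 8) * real (gap \<kappa>)) * geom_sum (\<epsilon> / 4) * geom_sum (\<epsilon> / 8)) * (ennreal (weight ks) * ?y (inner_scale j ks))"
  proof (rule pair_sum_bound[OF p])
    show "(pair_sum far ^^ n) v ks \<in> borel_measurable M" for ks by (rule pair_sum_iterate_measurable[OF meas])
    show "slow ?y" by (rule slow_cmult[OF y])
    show "Lp_enorm p M ((pair_sum far ^^ n) v (b # a # ks)) \<le> ennreal (weight (b # a # ks)) * ?y b" for a b ks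
      using Suc[of "b # a # ks"] unfolding inner_scale_simps by (simp only: mult.left_commute)
    show "2 powr (- (\<epsilon> / 8) * of_int \<bar>m\<bar>) \<le> 2 powr (- (\<epsilon> / 8) * real (gap \<kappa>))" if "far m" for m
    proof (intro powr_mono)
      have "real (gap \<kappa>) \<le> of_int \<bar>m\<bar>" using that by linarith
      then show "- (\<epsilon> / 8) * of_int \<bar>m\<bar> \<le> - (\<epsilon> / 8) * real (gap \<kappa>)" using eps by simp
    qed simp
  qed simp
  also have "\<dots> \<le> ennreal (1 / 2) * (ennreal (weight ks) * ?y (inner_scale j ks))"
    by (intro mult_right_mono ennreal_leI gap) simp
  also have "\<dots> = (ennreal (1 / 2) * ennreal ((1 / 2) ^ n)) * (ennreal (weight ks) * y (inner_scale j ks))"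
    by (simp only: ac_simps)
  also have "ennreal (1 / 2) * ennreal ((1 / 2) ^ n) = ennreal ((1 / 2) ^ Suc n)"
    by (subst ennreal_mult[symmetric]) auto
  finally show ?case by simp
qed

text \<open>The operator that acts first is kept together with \<open>f\<close>, so the weight of the remaining chain lacks the factor
of the link to it. That link is short, and inserting its factor costs no more than a constant.\<close>

lemma near_bound:
  assumes p: "1 \<le> p" and f: "f \<in> Lp_functions 2 M"
    and y: "slow y" "\<And>k. Lp_norm p M (int_op M (D k) f) \<le> y k"
  shows "Lp_enorm p M (pair_sum near (\<lambda>ks x. ennreal (norm (chain E D ks f x))) ks)
    \<le> ennreal (near_const \<kappa>) * (ennreal (weight ks) * y (inner_scale j ks))"
proof -
  have [measurable]: "f \<in> borel_measurable M" using f by (simp add: Lp_functions_def)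
  define q where "q = 2 powr (\<epsilon> / 2 * real (gap \<kappa>))"
  have "Lp_enorm p M (pair_sum near (\<lambda>ks x. ennreal (norm (chain E D ks f x))) ks)
    \<le> ennreal (\<kappa> * 1 * geom_sum (\<epsilon> / 4) * geom_sum (\<epsilon> / 8)) * (ennreal (weight ks) * (ennreal q * y (inner_scale j ks)))"
  proof (rule pair_sum_bound[OF p])
    show "slow (\<lambda>a. ennreal q * y a)" by (rule slow_cmult[OF y(1)])
    show "2 powr (- (\<epsilon> / 8) * of_int \<bar>m\<bar>) \<le> 1" for m
      using eps powr_mono[of "- (\<epsilon> / 8) * of_int \<bar>m\<bar>" 0 2] by simp
    fix a b ks assume R: "near (b - a)"
    have "weight (a # ks) \<le> weight (b # a # ks) * q"
    proof -
      have W: "0 \<le> weight (a # ks)" using kappa by (intro chain_weight_nonneg) auto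
      have "\<epsilon> / 2 * of_int \<bar>b - a\<bar> \<le> \<epsilon> / 2 * real (gap \<kappa>)"
        using R eps by (intro mult_left_mono) linarith+
      then have "1 \<le> 2 powr (- (\<epsilon> / 2) * of_int \<bar>b - a\<bar> + \<epsilon> / 2 * real (gap \<kappa>))"
        by (intro ge_one_powr_ge_zero) auto
      then have "1 * 1 \<le> sqrt \<kappa> * (2 powr (- (\<epsilon> / 2) * of_int \<bar>b - a\<bar>) * q)"
        using kappa unfolding q_def powr_add[symmetric] by (intro mult_mono) auto
      from mult_right_mono[OF this W] show ?thesis
        by (simp only: chain_weight.simps(2)[of _ _ b] inner_scale_simps mult_1 ac_simps)
    qed
    then have "ennreal (weight (a # ks)) * y b \<le> ennreal (weight (b # a # ks) * q) * y b"
      by (intro mult_right_mono ennreal_leI) auto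
    moreover have "Lp_enorm p M (\<lambda>x. ennreal (norm (chain E D (b # a # ks) f x))) \<le> ennreal (weight (a # ks)) * y b"
      using order_trans[OF chain_bound[OF p D_Lp[OF f], of "a # ks" b] mult_left_mono[OF y(2)[of b]]]
      by (simp add: Lp_norm_eq del: chain_weight.simps)
    moreover have "ennreal (weight (b # a # ks) * q) = ennreal (weight (b # a # ks)) * ennreal q"
      using kappa by (intro ennreal_mult chain_weight_nonneg) (auto simp: q_def)
    ultimately show "Lp_enorm p M (\<lambda>x. ennreal (norm (chain E D (b # a # ks) f x))) \<le> ennreal (weight (b # a # ks)) * (ennreal q * y b)"
      by (simp only: mult.assoc[symmetric])
  qed auto
  also have "\<dots> = ennreal (\<kappa> * 1 * geom_sum (\<epsilon> / 4) * geom_sum (\<epsilon> / 8)) * ennreal q * (ennreal (weight ks) * y (inner_scale j ks))"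
    by (simp only: ac_simps)
  also have "ennreal (\<kappa> * 1 * geom_sum (\<epsilon> / 4) * geom_sum (\<epsilon> / 8)) * ennreal q = ennreal (near_const \<kappa>)"
    unfolding near_const_def q_def using kappa geom_sum_nonneg by (subst ennreal_mult[symmetric]) auto
  finally show ?thesis .
qed

lemma chain_split:
  assumes f: "f \<in> Lp_functions 2 M"
  defines "u \<equiv> \<lambda>ks x. ennreal (norm (chain E D ks f x))"
  shows "u ks x \<le> pair_sum near u ks x + pair_sum far u ks x"
proof -
  have "u ks x \<le> (\<integral>\<^sup>+a. u (a # ks) x \<partial>count_space UNIV)"
    unfolding u_def by (rule chain_expand[OF f])
  also have "\<dots> \<le> (\<integral>\<^sup>+a. \<integral>\<^sup>+b. u (b # a # ks) x \<partial>count_space UNIV \<partial>count_space UNIV)"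
    unfolding u_def by (intro nn_integral_mono chain_expand[OF f])
  also have "\<dots> = (\<integral>\<^sup>+a. \<integral>\<^sup>+b. (if near (b - a) then u (b # a # ks) x else 0)
      + (if far (b - a) then u (b # a # ks) x else 0) \<partial>count_space UNIV \<partial>count_space UNIV)"
    by (intro nn_integral_cong) auto
  also have "\<dots> = pair_sum near u ks x + pair_sum far u ks x"
    unfolding pair_sum_def by (simp add: nn_integral_add)
  finally show ?thesis .
qed

text \<open>The near pairs of every round are kept, and the far pairs are expanded further.\<close>

lemma chain_iterate:
  assumes f: "f \<in> Lp_functions 2 M"
  defines "u \<equiv> \<lambda>ks x. ennreal (norm (chain E D ks f x))"
  shows "u ks x \<le> (\<Sum>m<n. (pair_sum far ^^ m) (pair_sum near u) ks x) + (pair_sum far ^^ n) u ks x"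
proof -
  have step: "(pair_sum far ^^ n) u ks x \<le> (pair_sum far ^^ n) (pair_sum near u) ks x + (pair_sum far ^^ Suc n) u ks x" for n
  proof (induction n arbitrary: ks)
    case 0
    show ?case using chain_split[OF f] by (simp add: u_def)
  next
    case (Suc n)
    have "(pair_sum far ^^ Suc n) u ks x
        \<le> pair_sum far (\<lambda>ks x. (pair_sum far ^^ n) (pair_sum near u) ks x + (pair_sum far ^^ Suc n) u ks x) ks x"
      unfolding funpow.simps(2) comp_apply
      by (rule pair_sum_mono) (use Suc in simp)
    then show ?case by (simp add: pair_sum_add)
  qed
  show ?thesis
  proof (induction n)
    case (Suc n)
    show ?case using order_trans[OF Suc add_left_mono[OF step[of n]]] by (simp add: add.assoc)
  qed simp
qed

text \<open>The terms of the expansion sum to a geometric series. The remainder is controlled in \<open>L\<^sup>2\<close> only, which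
suffices: it shows that the series bounds \<open>E f\<close> almost everywhere.\<close>

lemma Lp_norm_le_smear:
  assumes p: "1 \<le> p" and f: "f \<in> Lp_functions 2 M"
  shows "Lp_norm p M (int_op M E f)
    \<le> ennreal (2 * \<kappa> * near_const \<kappa>) * smear (\<lambda>k. Lp_norm p M (int_op M (D k) f)) j"
proof -
  have [measurable]: "f \<in> borel_measurable M" using f by (simp add: Lp_functions_def)
  define u where "u ks x = ennreal (norm (chain E D ks f x))" for ks x
  define T where "T m = (pair_sum far ^^ m) (pair_sum near u) []" for m
  define h where "h n = (pair_sum far ^^ n) u []" for n
  define y where "y = smear (\<lambda>k. Lp_norm p M (int_op M (D k) f))"
  have u [measurable]: "u ks \<in> borel_measurable M" for ks unfolding u_def by measurable
  have [measurable]: "T m \<in> borel_measurable M" "h m \<in> borel_measurable M" for m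
    unfolding T_def h_def by (intro pair_sum_iterate_measurable pair_sum_measurable u)+
  have nc: "0 \<le> near_const \<kappa>" using kappa geom_sum_nonneg by (simp add: near_const_def)
  have "Lp_enorm 2 M (h n) \<le> ennreal (\<kappa> * enn2real (Lp_norm 2 M f) * (1 / 2) ^ n)" for n
  proof -
    have "Lp_enorm 2 M (h n) \<le> ennreal ((1 / 2) ^ n) * (ennreal (weight []) * Lp_norm 2 M f)"
      unfolding h_def
    proof (rule far_iterate_bound[OF _ u slow_const])
      show "Lp_enorm 2 M (u ks) \<le> ennreal (weight ks) * Lp_norm 2 M f" for ks
        using chain_bound[OF _ f, of 2 ks] unfolding u_def Lp_norm_eq by simp
    qed simp
    also have "\<dots> = ennreal (\<kappa> * enn2real (Lp_norm 2 M f) * (1 / 2) ^ n)"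
      using f kappa by (simp add: Lp_functions_def ennreal_mult less_top ac_simps)
    finally show ?thesis .
  qed
  then have "AE x in M. (INF n. h n x) = 0" by (intro AE_INF_eq_0) measurable
  then have "AE x in M. u [] x \<le> (\<integral>\<^sup>+m. T m x \<partial>count_space UNIV)"
  proof eventually_elim
    case (elim x)
    show ?case
    proof (rule ennreal_le_epsilon)
      fix e :: real assume e: "0 < e"
      then have "(INF n. h n x) < ennreal e" using elim by simp
      then obtain n where n: "h n x < ennreal e" by (auto simp: INF_less_iff)
      have "u [] x \<le> (\<Sum>m<n. T m x) + h n x"
        unfolding T_def h_def using chain_iterate[OF f, of "[]" x n] unfolding u_def[abs_def] .
      also have "\<dots> \<le> (\<integral>\<^sup>+m. T m x \<partial>count_space UNIV) + ennreal e"
        using n by (intro add_mono sum_le_nn_integral_count_space) auto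
      finally show "u [] x \<le> (\<integral>\<^sup>+m. T m x \<partial>count_space UNIV) + ennreal e" .
    qed
  qed
  then have "Lp_enorm p M (u []) \<le> Lp_enorm p M (\<lambda>x. \<integral>\<^sup>+m. T m x \<partial>count_space UNIV)"
    by (intro Lp_enorm_mono_AE[OF p]) auto
  also have "\<dots> \<le> (\<integral>\<^sup>+m. Lp_enorm p M (T m) \<partial>count_space UNIV)"
    by (rule Lp_enorm_nn_integral_count_space[OF p]) measurable
  also have "\<dots> \<le> (\<integral>\<^sup>+m. ennreal ((1 / 2) ^ m) * (ennreal (weight []) * (ennreal (near_const \<kappa>) * y j)) \<partial>count_space UNIV)"
  proof (rule nn_integral_mono)
    fix m
    have "Lp_enorm p M (T m) \<le> ennreal ((1 / 2) ^ m) * (ennreal (weight []) * (ennreal (near_const \<kappa>) * y (inner_scale j [])))"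
      unfolding T_def
    proof (rule far_iterate_bound[OF p pair_sum_measurable[OF u]])
      show "slow (\<lambda>a. ennreal (near_const \<kappa>) * y a)" unfolding y_def by (rule slow_cmult[OF slow_smear])
      show "Lp_enorm p M (pair_sum near u ks) \<le> ennreal (weight ks) * (ennreal (near_const \<kappa>) * y (inner_scale j ks))" for ks
        unfolding mult.left_commute[of "ennreal (weight ks)"] u_def[abs_def] y_def
        by (rule near_bound[OF p f slow_smear le_smear])
    qed
    then show "Lp_enorm p M (T m) \<le> ennreal ((1 / 2) ^ m) * (ennreal (weight []) * (ennreal (near_const \<kappa>) * y j))" by simp
  qed
  also have "\<dots> = (\<integral>\<^sup>+m. ennreal ((1 / 2) ^ m) \<partial>count_space UNIV) * (ennreal \<kappa> * (ennreal (near_const \<kappa>) * y j))"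
    by (simp add: nn_integral_multc)
  also have "(\<integral>\<^sup>+m. ennreal ((1 / 2) ^ m) \<partial>count_space UNIV) = ennreal 2"
    unfolding nn_integral_count_space_nat
    using geometric_sums[of "1 / 2 :: real"] by (intro suminf_ennreal_eq) auto
  also have "ennreal 2 * (ennreal \<kappa> * (ennreal (near_const \<kappa>) * y j)) = ennreal (2 * \<kappa> * near_const \<kappa>) * y j"
    using kappa nc by (simp add: ennreal_mult mult.assoc)
  finally show ?thesis unfolding y_def u_def Lp_norm_eq by simp
qed

end

section \<open>Comparison of Besov norms\<close>

lemma infsum_eq_nn_integral:
  fixes f :: "int \<Rightarrow> ennreal"
  shows "(\<Sum>\<^sub>\<infinity>k. f k) = (\<integral>\<^sup>+k. f k \<partial>count_space UNIV)"
proof (rule antisym)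
  have eq: "(\<Sum>\<^sub>\<infinity>k. f k) = (SUP A\<in>{A. finite A \<and> A \<subseteq> UNIV}. \<Sum>k\<in>A. f k)"
    by (rule nonneg_infsum_complete) simp
  then show "(\<Sum>\<^sub>\<infinity>k. f k) \<le> (\<integral>\<^sup>+k. f k \<partial>count_space UNIV)"
    by (auto intro!: SUP_least sum_le_nn_integral_count_space)
  have "(\<integral>\<^sup>+k. f k \<partial>count_space UNIV) = (\<Sum>n. f (int_decode n))"
    using nn_integral_bij_count_space[OF bij_int_decode, of f] by (simp add: nn_integral_count_space_nat)
  also have "\<dots> = (SUP n. \<Sum>i<n. f (int_decode i))"
    by (rule suminf_eq_SUP)
  also have "\<dots> \<le> (\<Sum>\<^sub>\<infinity>k. f k)"
  proof (rule SUP_least)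
    fix n
    have "(\<Sum>i<n. f (int_decode i)) = (\<Sum>k\<in>int_decode ` {..<n}. f k)"
      by (subst sum.reindex) (auto intro: inj_on_subset[OF inj_int_decode])
    also have "\<dots> \<le> (\<Sum>\<^sub>\<infinity>k. f k)" unfolding eq by (rule SUP_upper) auto
    finally show "(\<Sum>i<n. f (int_decode i)) \<le> (\<Sum>\<^sub>\<infinity>k. f k)" .
  qed
  finally show "(\<integral>\<^sup>+k. f k \<partial>count_space UNIV) \<le> (\<Sum>\<^sub>\<infinity>k. f k)" .
qed

text \<open>The sequence norm is a Lebesgue norm for counting measure, so Schur's test covers the convolution below.\<close>

lemma besov_norm_eq:
  assumes "1 \<le> q"
  shows "besov_norm \<alpha> p q M S f
    = Lp_enorm q (count_space UNIV) (\<lambda>k. ennreal (2 powr (of_int k * \<alpha>)) * Lp_norm p M (diff_op M S k f))"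
proof (cases "q = \<infinity>")
  case True
  have "esssup (count_space UNIV) F = (SUP k. F k)" for F :: "int \<Rightarrow> ennreal"
  proof (rule antisym)
    show "esssup (count_space UNIV) F \<le> (SUP k. F k)"
      by (rule esssup_I) (auto simp: AE_count_space intro: SUP_upper)
    show "(SUP k. F k) \<le> esssup (count_space UNIV) F"
      using esssup_AE[of F "count_space UNIV"] by (intro SUP_least) (auto simp: AE_count_space)
  qed
  then show ?thesis unfolding besov_norm_def Lp_enorm_def by (simp add: True)
next
  case False
  then show ?thesis unfolding besov_norm_def Lp_enorm_def infsum_eq_nn_integral by simp
qed

text \<open>The summand \<open>1\<close> keeps the constant positive, as Schur's test demands.\<close>

lemma Lp_enorm_convolution:
  assumes q: "1 \<le> q" and t: "0 < t"
  shows "Lp_enorm q (count_space UNIV) (\<lambda>j. \<integral>\<^sup>+k. ennreal (2 powr (- t * of_int \<bar>k - j\<bar>)) * Y k \<partial>count_space UNIV)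
    \<le> ennreal (1 + geom_sum t) * Lp_enorm q (count_space (UNIV :: int set)) Y"
proof (rule Lp_enorm_Schur[OF q])
  show "sigma_finite_measure (count_space (UNIV :: int set))"
    by (simp add: sigma_finite_measure_count_space)
  have pair: "count_space (UNIV :: int set) \<Otimes>\<^sub>M count_space (UNIV :: int set) = count_space UNIV"
    by (simp add: pair_measure_countable)
  show "(\<lambda>(j, k). ennreal (2 powr (- t * of_int \<bar>k - j\<bar>))) \<in> borel_measurable (count_space (UNIV :: int set) \<Otimes>\<^sub>M count_space UNIV)"
    unfolding pair by simp
  fix h :: int
  have le: "ennreal (geom_sum t) \<le> ennreal (1 + geom_sum t)" by (intro ennreal_leI) simp
  show "(\<integral>\<^sup>+k. ennreal (2 powr (- t * of_int \<bar>k - h\<bar>)) \<partial>count_space UNIV) \<le> ennreal (1 + geom_sum t)"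
    unfolding nn_integral_geometric[OF t] by (rule le)
  show "(\<integral>\<^sup>+k. ennreal (2 powr (- t * of_int \<bar>h - k\<bar>)) \<partial>count_space UNIV) \<le> ennreal (1 + geom_sum t)"
    unfolding abs_minus_commute[of h] nn_integral_geometric[OF t] by (rule le)
qed (use geom_sum_nonneg[of t] in auto)

context doubling_space
begin

text \<open>Moving the weight \<open>2\<^bsup>j\<alpha>\<^esup>\<close> from the index \<open>j\<close> to the index \<open>k\<close> costs \<open>2\<^bsup>|\<alpha>||j-k|\<^esup>\<close>, so of the decay \<open>2\<^bsup>-(\<epsilon>/4)|j-k|\<^esup>\<close> the
exponent \<open>\<epsilon>/4 - |\<alpha>|\<close> remains.\<close>

lemma besov_norm_le:
  assumes S: "unit_kernels C S" and P: "unit_kernels C P"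
    and \<alpha>: "\<bar>\<alpha>\<bar> < \<epsilon> / 4" and p: "1 \<le> p" and q: "1 \<le> q"
  shows "\<exists>B>0. \<forall>f\<in>Lp_functions 2 M. besov_norm \<alpha> p q M P f \<le> ennreal B * besov_norm \<alpha> p q M S f"
proof -
  have C: "1 \<le> C" using S by (simp add: unit_kernels_def)
  have fam: "reproducing_family M d A\<^sub>0 C\<^sub>d \<epsilon> (differences P j) (differences S) j (2 * C)" for j
    using C differences_hoelder_kernel[OF S] differences_hoelder_kernel[OF P]
      differences_cancelling[OF S] differences_cancelling[OF P] reproducing_limit[OF S]
    by unfold_locales auto
  define B where "B = 2 * op_const (2 * C) * near_const (op_const (2 * C))"
  have B: "0 \<le> B"
    using op_const_ge_1[of "2 * C"] C geom_sum_nonneg by (simp add: B_def near_const_def)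
  define t where "t = \<epsilon> / 4 - \<bar>\<alpha>\<bar>"
  have t: "0 < t" using \<alpha> by (simp add: t_def)
  have shift: "2 powr (of_int j * \<alpha>) * 2 powr (- (\<epsilon> / 4) * of_int \<bar>k - j\<bar>)
      \<le> 2 powr (- t * of_int \<bar>k - j\<bar>) * 2 powr (of_int k * \<alpha>)" for j k :: int
  proof -
    have "(of_int j - of_int k) * \<alpha> \<le> \<bar>(of_int j - of_int k) * \<alpha>\<bar>" by (rule abs_ge_self)
    also have "\<dots> = of_int \<bar>k - j\<bar> * \<bar>\<alpha>\<bar>" by (simp add: abs_mult abs_minus_commute)
    finally show ?thesis
      unfolding powr_add[symmetric] by (intro powr_mono) (auto simp: t_def algebra_simps)
  qed
  have "besov_norm \<alpha> p q M P f \<le> ennreal (B * (1 + geom_sum t)) * besov_norm \<alpha> p q M S f"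
    if f: "f \<in> Lp_functions 2 M" for f
  proof -
    define X where "X j = ennreal (2 powr (of_int j * \<alpha>)) * Lp_norm p M (diff_op M P j f)" for j
    define Y where "Y k = ennreal (2 powr (of_int k * \<alpha>)) * Lp_norm p M (diff_op M S k f)" for k
    have XY: "X j \<le> ennreal B * (\<integral>\<^sup>+k. ennreal (2 powr (- t * of_int \<bar>k - j\<bar>)) * Y k \<partial>count_space UNIV)" for j
    proof -
      have "X j \<le> ennreal (2 powr (of_int j * \<alpha>)) * (ennreal B * smear (\<lambda>k. Lp_norm p M (diff_op M S k f)) j)"
        using reproducing_family.Lp_norm_le_smear[OF fam p f, of j]
        unfolding X_def B_def int_op_differences[OF S f] int_op_differences[OF P f] by (rule mult_left_mono) simp
      also have "\<dots> = ennreal B * (\<integral>\<^sup>+k. ennreal (2 powr (of_int j * \<alpha>)) *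
          (ennreal (2 powr (- (\<epsilon> / 4) * of_int \<bar>k - j\<bar>)) * Lp_norm p M (diff_op M S k f)) \<partial>count_space UNIV)"
        unfolding smear_def by (subst nn_integral_cmult) (simp_all only: mult.left_commute borel_measurable_count_space)
      also have "\<dots> \<le> ennreal B * (\<integral>\<^sup>+k. ennreal (2 powr (- t * of_int \<bar>k - j\<bar>)) * Y k \<partial>count_space UNIV)"
        unfolding Y_def mult.assoc[symmetric]
        by (intro mult_left_mono nn_integral_mono mult_right_mono)
           (simp_all only: ennreal_mult[OF powr_ge_zero powr_ge_zero, symmetric] ennreal_leI[OF shift] zero_le)
      finally show ?thesis .
    qed
    have "Lp_enorm q (count_space UNIV) X
        \<le> Lp_enorm q (count_space UNIV) (\<lambda>j. ennreal B * (\<integral>\<^sup>+k. ennreal (2 powr (- t * of_int \<bar>k - j\<bar>)) * Y k \<partial>count_space UNIV))"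
      by (rule Lp_enorm_mono[OF q _ XY]) simp
    also have "\<dots> \<le> ennreal B * Lp_enorm q (count_space UNIV) (\<lambda>j. \<integral>\<^sup>+k. ennreal (2 powr (- t * of_int \<bar>k - j\<bar>)) * Y k \<partial>count_space UNIV)"
      by (rule Lp_enorm_cmult[OF q _ B]) simp
    also have "\<dots> \<le> ennreal B * (ennreal (1 + geom_sum t) * Lp_enorm q (count_space UNIV) Y)"
      by (intro mult_left_mono Lp_enorm_convolution[OF q t]) simp
    also have "\<dots> = ennreal (B * (1 + geom_sum t)) * Lp_enorm q (count_space UNIV) Y"
      using B geom_sum_nonneg[of t] by (simp add: ennreal_mult mult.assoc)
    finally show ?thesis unfolding besov_norm_eq[OF q] X_def Y_def .
  qed
  then have "besov_norm \<alpha> p q M P f \<le> ennreal (B * (1 + geom_sum t) + 1) * besov_norm \<alpha> p q M S f"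
    if "f \<in> Lp_functions 2 M" for f
    by (rule order_trans[OF _ mult_right_mono[OF ennreal_leI]]) (use that in auto)
  moreover have "0 < B * (1 + geom_sum t) + 1"
    using B geom_sum_nonneg[of t] by (intro add_nonneg_pos mult_nonneg_nonneg) auto
  ultimately show ?thesis by blast
qed

lemma besov_norm_equivalent:
  assumes S: "approx_identity M d \<epsilon> S" and P: "approx_identity M d \<epsilon> P"
    and \<alpha>: "\<bar>\<alpha>\<bar> < \<epsilon> / 4" and p: "1 \<le> p" and q: "1 \<le> q"
  shows "\<exists>B>0. \<forall>f\<in>Lp_functions 2 M.
           besov_norm \<alpha> p q M S f \<le> ennreal B * besov_norm \<alpha> p q M P f \<and>
           besov_norm \<alpha> p q M P f \<le> ennreal B * besov_norm \<alpha> p q M S f"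
proof -
  obtain C\<^sub>1 C\<^sub>2 where "unit_kernels C\<^sub>1 S" "unit_kernels C\<^sub>2 P"
    using approx_identity_imp_unit_kernels[OF S] approx_identity_imp_unit_kernels[OF P] by blast
  then have unit: "unit_kernels (max C\<^sub>1 C\<^sub>2) S" "unit_kernels (max C\<^sub>1 C\<^sub>2) P"
    by (auto intro: unit_kernels_mono)
  obtain B\<^sub>1 where B1: "0 < B\<^sub>1"
      "\<And>f. f \<in> Lp_functions 2 M \<Longrightarrow> besov_norm \<alpha> p q M P f \<le> ennreal B\<^sub>1 * besov_norm \<alpha> p q M S f"
    using besov_norm_le[OF unit \<alpha> p q] by blast
  obtain B\<^sub>2 where B2: "0 < B\<^sub>2"
      "\<And>f. f \<in> Lp_functions 2 M \<Longrightarrow> besov_norm \<alpha> p q M S f \<le> ennreal B\<^sub>2 * besov_norm \<alpha> p q M P f"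
    using besov_norm_le[OF unit(2,1) \<alpha> p q] by blast
  have max: "ennreal B\<^sub>1 * x \<le> ennreal (max B\<^sub>1 B\<^sub>2) * x" "ennreal B\<^sub>2 * x \<le> ennreal (max B\<^sub>1 B\<^sub>2) * x" for x
    by (auto intro!: mult_right_mono ennreal_leI)
  show ?thesis
    using B1 B2(2) order_trans[OF B1(2) max(1)] order_trans[OF B2(2) max(2)]
    by (intro exI[of _ "max B\<^sub>1 B\<^sub>2"]) auto
qed

end


section \<open>Continuity of the quasi-metric and the equivalence of norms\<close>

lemma smooth_imp_continuous_gradient:
  assumes "smooth \<phi>"
  shows "continuous_on UNIV (gradient \<phi>)"
proof -
  have "times_continuously_differentiable (Suc 0) \<phi>"
    using assms unfolding smooth_def by blast
  then have "continuous_on UNIV (partial i \<phi>)" for i by simp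
  then show "continuous_on UNIV (gradient \<phi>)"
    unfolding gradient_def[abs_def] by (intro continuous_on_vec_lambda)
qed

text \<open>The sum \<open>rho \<phi> x a + rho \<phi> a x\<close> is the inner product of \<open>\<nabla>\<phi>(x) - \<nabla>\<phi>(a)\<close> and \<open>x - a\<close>. It tends to zero as \<open>x\<close> tends
to \<open>a\<close>, and then so does \<open>d x a\<close>; the regularity condition extends the continuity off the diagonal.\<close>

lemma continuous_quasi_metric:
  fixes d :: "real^'n \<Rightarrow> real^'n \<Rightarrow> real"
  assumes \<phi>: "smooth \<phi>"
    and sym: "\<And>x y. d x y = d y x" and nonneg: "\<And>x y. 0 \<le> d x y"
    and upper: "\<And>x y. d x y \<le> c * ((rho \<phi> x y + rho \<phi> y x) / 2)"
    and triangle: "1 \<le> A" "\<And>x y z. d x y \<le> A * (d x z + d z y)"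
    and regular: "0 < \<epsilon>" "\<epsilon> < 1"
      "\<And>x x' y. \<bar>d x y - d x' y\<bar> \<le> C * d x x' powr \<epsilon> * (d x y + d x' y) powr (1 - \<epsilon>)"
  shows "continuous_on UNIV (\<lambda>(x, y). d x y)"
proof -
  define C' where "C' = max 0 C"
  have local: "((\<lambda>x. d x a) \<longlongrightarrow> 0) F" if "filterlim (\<lambda>x. x) (nhds a) F" for a F
  proof (rule tendsto_sandwich[of "\<lambda>_. 0"])
    have [tendsto_intros]: "((\<lambda>x. gradient \<phi> x) \<longlongrightarrow> gradient \<phi> a) F"
      using continuous_on_tendsto_compose[OF smooth_imp_continuous_gradient[OF \<phi>] that] by simp
    have eq: "rho \<phi> x a + rho \<phi> a x = (gradient \<phi> x - gradient \<phi> a) \<bullet> (x - a)" for x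
      by (simp add: rho_def inner_diff_left inner_diff_right)
    have "((\<lambda>x. c * (((gradient \<phi> x - gradient \<phi> a) \<bullet> (x - a)) / 2)) \<longlongrightarrow> c * (((gradient \<phi> a - gradient \<phi> a) \<bullet> (a - a)) / 2)) F"
      using that by (intro tendsto_intros) auto
    then show "((\<lambda>x. c * ((rho \<phi> x a + rho \<phi> a x) / 2)) \<longlongrightarrow> 0) F" by (simp add: eq)
    show "\<forall>\<^sub>F x in F. d x a \<le> c * ((rho \<phi> x a + rho \<phi> a x) / 2)"
      by (intro always_eventually allI upper)
  qed (simp_all add: nonneg always_eventually)
  \<comment> \<open>the triangle inequality leaves only \<open>d x x'\<close>, which tends to zero as \<open>x\<close> tends to \<open>x'\<close>, and a distance from the fixed point \<open>x'\<close>\<close>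
  have osc: "\<bar>d x y - d x' y\<bar> \<le> C' * d x x' powr \<epsilon> * ((A + 1) * (d x x' + d x' y)) powr (1 - \<epsilon>)" for x x' y
  proof -
    have "d x y + d x' y \<le> (A + 1) * (d x x' + d x' y)"
      using triangle(2)[of x y x'] nonneg[of x x'] by (simp add: algebra_simps)
    then have "(d x y + d x' y) powr (1 - \<epsilon>) \<le> ((A + 1) * (d x x' + d x' y)) powr (1 - \<epsilon>)"
      using nonneg regular by (intro powr_mono2) auto
    then have "C * d x x' powr \<epsilon> * (d x y + d x' y) powr (1 - \<epsilon>)
        \<le> C' * d x x' powr \<epsilon> * ((A + 1) * (d x x' + d x' y)) powr (1 - \<epsilon>)"
      by (intro mult_mono) (auto simp: C'_def)
    with regular(3)[of x y x'] show ?thesis by linarith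
  qed
  show ?thesis
    unfolding continuous_on_eq_continuous_at[OF open_UNIV] isCont_def
  proof (rule ballI)
    fix w :: "(real^'n) \<times> (real^'n)"
    obtain a b where w: "w = (a, b)" by (cases w)
    let ?F = "at (a, b)"
    have fst: "(fst \<longlongrightarrow> a) ?F" and snd: "(snd \<longlongrightarrow> b) ?F"
      by (auto intro!: tendsto_eq_intros)
    have d1: "((\<lambda>z. d (fst z) a) \<longlongrightarrow> 0) ?F"
      using filterlim_compose[OF local[OF filterlim_ident] fst] .
    have d2: "((\<lambda>z. d (snd z) b) \<longlongrightarrow> 0) ?F"
      using filterlim_compose[OF local[OF filterlim_ident] snd] .
    define R where "R z = C' * d (snd z) b powr \<epsilon> * ((A + 1) * (d (snd z) b + A * (d (fst z) a + d a b))) powr (1 - \<epsilon>)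
                        + C' * d (fst z) a powr \<epsilon> * ((A + 1) * (d (fst z) a + d a b)) powr (1 - \<epsilon>)" for z
    have "((\<lambda>z. R z) \<longlongrightarrow> C' * 0 * ((A + 1) * (0 + A * (0 + d a b))) powr (1 - \<epsilon>)
                        + C' * 0 * ((A + 1) * (0 + d a b)) powr (1 - \<epsilon>)) ?F"
      unfolding R_def using regular triangle nonneg
      by (intro tendsto_intros tendsto_zero_powrI[OF _ tendsto_const] tendsto_powr' d1 d2) (auto intro!: always_eventually)
    then have R0: "(R \<longlongrightarrow> 0) ?F" by simp
    have "\<bar>d x y - d a b\<bar> \<le> R (x, y)" for x y
    proof -
      have "\<bar>d y x - d b x\<bar> \<le> C' * d y b powr \<epsilon> * ((A + 1) * (d y b + d b x)) powr (1 - \<epsilon>)" by (rule osc)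
      also have "\<dots> \<le> C' * d y b powr \<epsilon> * ((A + 1) * (d y b + A * (d x a + d a b))) powr (1 - \<epsilon>)"
        using nonneg triangle regular sym[of b x]
        by (intro mult_left_mono powr_mono2 add_left_mono) (auto simp: C'_def)
      finally show ?thesis
        using osc[of x b a] abs_triangle_ineq[of "d x y - d x b" "d x b - d a b"]
        by (simp add: R_def sym[of y x] sym[of b x])
    qed
    then have "\<forall>\<^sub>F z in ?F. norm ((case z of (x, y) \<Rightarrow> d x y) - d a b) \<le> R z"
      by (intro always_eventually) auto
    then have "((\<lambda>z. (case z of (x, y) \<Rightarrow> d x y) - d a b) \<longlongrightarrow> 0) ?F"
      by (rule Lim_null_comparison[OF _ R0])
    then show "((\<lambda>z. case z of (x, y) \<Rightarrow> d x y) \<longlongrightarrow> (case w of (x, y) \<Rightarrow> d x y)) (at w)"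
      unfolding w prod.case by (subst Lim_null)
  qed
qed
theorem proposition4p1:
  fixes \<phi> :: "real^'n \<Rightarrow> real"
    and \<rho>b :: "real^'n \<Rightarrow> real^'n \<Rightarrow> real"
    and \<mu> :: "(real^'n) measure"
    and S P :: "int \<Rightarrow> real^'n \<Rightarrow> real^'n \<Rightarrow> complex"
    and A\<^sub>0 C\<^sub>0 \<epsilon> c\<^sub>1 c\<^sub>2 C\<^sub>\<mu> \<alpha> :: real
    and p q :: ennreal
  assumes phi: "strictly_convex \<phi>" "smooth \<phi>"
    and mu: "\<mu> = monge_ampere \<phi>"
    and doubling: "doubling_on_sections \<phi>"
    and sym: "\<And>x y. \<rho>b x y = \<rho>b y x"
    and nonneg: "\<And>x y. 0 \<le> \<rho>b x y"
    and zero: "\<And>x y. \<rho>b x y = 0 \<longleftrightarrow> x = y"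
    and equiv: "0 < c\<^sub>1" "0 < c\<^sub>2"
      "\<And>x y. c\<^sub>1 * ((rho \<phi> x y + rho \<phi> y x) / 2) \<le> \<rho>b x y"
      "\<And>x y. \<rho>b x y \<le> c\<^sub>2 * ((rho \<phi> x y + rho \<phi> y x) / 2)"
    and quasi_triangle: "1 \<le> A\<^sub>0" "\<And>x y z. \<rho>b x y \<le> A\<^sub>0 * (\<rho>b x z + \<rho>b z y)"
    and regular: "0 < \<epsilon>" "\<epsilon> < 1"
      "\<And>x x' y. \<bar>\<rho>b x y - \<rho>b x' y\<bar>
          \<le> C\<^sub>0 * \<rho>b x x' powr \<epsilon> * (\<rho>b x y + \<rho>b x' y) powr (1 - \<epsilon>)"
    and ball_doubling:
      "\<And>x t. 0 < t \<Longrightarrow> emeasure \<mu> (qball \<rho>b x (2 * t)) \<le> ennreal C\<^sub>\<mu> * emeasure \<mu> (qball \<rho>b x t)"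
      "\<And>x t. 0 < t \<Longrightarrow> emeasure \<mu> (qball \<rho>b x t) < \<infinity>"
    and infinite_measure: "emeasure \<mu> UNIV = \<infinity>"
    and alpha: "\<bar>\<alpha>\<bar> < \<epsilon> / 4"
    and pq: "1 \<le> p" "1 \<le> q"
    and S: "approx_identity \<mu> \<rho>b \<epsilon> S"
    and P: "approx_identity \<mu> \<rho>b \<epsilon> P"
  shows "\<exists>C>0. \<forall>f \<in> Lp_functions 2 \<mu>.
           besov_norm \<alpha> p q \<mu> S f \<le> ennreal C * besov_norm \<alpha> p q \<mu> P f \<and>
           besov_norm \<alpha> p q \<mu> P f \<le> ennreal C * besov_norm \<alpha> p q \<mu> S f"
proof -
  have "doubling_space \<mu> \<rho>b A\<^sub>0 C\<^sub>\<mu> \<epsilon>"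
  proof
    show "sets \<mu> = sets borel" by (simp add: mu monge_ampere_def)
    show "continuous_on UNIV (\<lambda>(x, y). \<rho>b x y)"
      using phi(2) sym nonneg equiv(4) quasi_triangle regular by (rule continuous_quasi_metric)
  qed (use sym nonneg zero quasi_triangle regular ball_doubling infinite_measure in auto)
  then interpret doubling_space \<mu> \<rho>b A\<^sub>0 C\<^sub>\<mu> \<epsilon> .
  show ?thesis by (rule besov_norm_equivalent[OF S P alpha pq])
qed

end
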